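(* Let $W$ be an $\mathbb{R}^d$-valued Brownian sheet and let $b:[0,1]\times\mathbb{R}^d\to\mathbb{R}$ be a Borel measurable function such that $|b(t,x)|\le1$ everywhere on $[0,1]\times\mathbb{R}^d$. For $(s,s',x,x')\in\,]0,1]^2\times\mathbb{R}^{2d}$ with $s\le s'$, $(s,x)\ne(s',x')$, and $0\le a<a'\le1$, define $$\rho(s,x;s',x'):=\int_a^{a'}\left\{b(t,x'+W_{s',t})-b(t,x+W_{s,t})\right\}\mathrm{d}t .$$ Then there exist positive constants $\alpha$ and $C$ such that, for all such $(s,s',x,x')$, $a$, $a'$ and every $\eta>0$, $$\mathbb{P}\left(\sqrt{s}\,|\rho(s,x;s',x')|\ge\eta\sqrt{\varepsilon}\,\big(|x'-x|+\sqrt{s'-s}\big)\right)\le Ce^{-\alpha\eta},$$ where $\varepsilon=a'-a$.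
   Context: A one-dimensional Brownian sheet is a centered continuous Gaussian process with covariance $(s\wedge s')(t\wedge t')$; an $\mathbb{R}^d$-valued Brownian sheet has independent one-dimensional Brownian sheets as components. $|\cdot|$ is the maximum norm on $\mathbb{R}^d$. *)

theory Defs
  imports "HOL-Probability.Probability"
begin

text \<open>Constants count as (degenerate) Gaussian variables; the Brownian sheet vanishes on the
  axes, and linear combinations of its values may be degenerate.\<close>

definition gaussian_rv :: "'a measure \<Rightarrow> ('a \<Rightarrow> real) \<Rightarrow> bool" where
  "gaussian_rv M X \<longleftrightarrow> X \<in> borel_measurable M \<and>
     ((\<exists>\<mu> \<sigma>. \<sigma> > 0 \<and> distributed M lborel X (normal_density \<mu> \<sigma>)) \<or>
      (\<exists>\<mu>. AE \<omega> in M. X \<omega> = \<mu>))"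

definition gaussian_process_on :: "'a measure \<Rightarrow> 'i set \<Rightarrow> ('i \<Rightarrow> 'a \<Rightarrow> real) \<Rightarrow> bool" where
  "gaussian_process_on M T X \<longleftrightarrow>
     (\<forall>F c. finite F \<and> F \<subseteq> T \<longrightarrow> gaussian_rv M (\<lambda>\<omega>. \<Sum>z\<in>F. c z * X z \<omega>))"

definition covariance :: "'a measure \<Rightarrow> ('a \<Rightarrow> real) \<Rightarrow> ('a \<Rightarrow> real) \<Rightarrow> real" where
  "covariance M X Y =
     integral\<^sup>L M (\<lambda>\<omega>. (X \<omega> - integral\<^sup>L M X) * (Y \<omega> - integral\<^sup>L M Y))"

text \<open>The parameter set \<open>T\<close> is a subset of the quadrant, usually the unit square or the
  whole quadrant. Continuity is required of every sample path.\<close>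

definition brownian_sheet1_on ::
    "'a measure \<Rightarrow> (real \<times> real) set \<Rightarrow> (real \<times> real \<Rightarrow> 'a \<Rightarrow> real) \<Rightarrow> bool" where
  "brownian_sheet1_on M T X \<longleftrightarrow>
     gaussian_process_on M T X \<and>
     (\<forall>z\<in>T. integral\<^sup>L M (X z) = 0) \<and>
     (\<forall>\<omega>\<in>space M. continuous_on T (\<lambda>z. X z \<omega>)) \<and>
     (\<forall>s t s' t'. (s, t) \<in> T \<and> (s', t') \<in> T \<longrightarrow>
        covariance M (X (s, t)) (X (s', t')) = min s s' * min t t')"

text \<open>The components are independent as processes: each is viewed as one random element of
  the product space over \<open>T\<close>.\<close>

definition brownian_sheet_on ::
    "'a measure \<Rightarrow> (real \<times> real) set \<Rightarrow> (real \<times> real \<Rightarrow> 'a \<Rightarrow> real ^ 'd) \<Rightarrow> bool" where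
  "brownian_sheet_on M T W \<longleftrightarrow>
     (\<forall>i. brownian_sheet1_on M T (\<lambda>z \<omega>. W z \<omega> $ i)) \<and>
     prob_space.indep_vars M (\<lambda>i. PiM T (\<lambda>_. borel)) (\<lambda>i \<omega>. \<lambda>z\<in>T. W z \<omega> $ i) UNIV"

definition rho ::
    "(real \<times> (real ^ 'd) \<Rightarrow> real) \<Rightarrow> (real \<times> real \<Rightarrow> 'a \<Rightarrow> real ^ 'd) \<Rightarrow> real \<Rightarrow> real \<Rightarrow>
     real \<Rightarrow> real ^ 'd \<Rightarrow> real \<Rightarrow> real ^ 'd \<Rightarrow> 'a \<Rightarrow> real" where
  "rho b W a a' s x s' x' \<omega> =
     (LINT t:{a..a'}|lborel. b (t, x' + W (s', t) \<omega>) - b (t, x + W (s, t) \<omega>))"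

end

theory Submission
  imports Defs
begin

text \<open>Write \<open>W (s', t) = W (s, t) + B t\<close>, where \<open>B\<close> is independent of \<open>W (s, _)\<close>, and pass from the path
\<open>x + W (s, _)\<close> to the path \<open>x' + W (s', _)\<close> one coordinate at a time. Changing coordinate \<open>i\<close> shifts the
standard Brownian motion \<open>X t = W (s, t) $ i / sqrt s\<close> by
\<open>f t = (x' $ i - x $ i + B t $ i) / sqrt s\<close>. The shift \<open>f\<close> and all other coordinates are independent of
\<open>X\<close>, so they can be put into the sigma-algebra \<open>F 0\<close> of a filtration for which \<open>X\<close> is still a Brownian
motion. What remains is a statement in one dimension about
\<open>A u v = \<integral>t\<in>{u..v}. g t (X t + f t) - g t (X t)\<close>, where \<open>\<bar>g\<bar> \<le> 1\<close>, \<open>\<bar>f\<bar> \<le> R\<close> and \<open>g\<close>, \<open>f\<close> are random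
but known at time \<open>0\<close>; in the locale \<open>brownian_shift\<close> below, \<open>A\<close> is called \<open>shift_effect\<close>.

The heart is the bound \<open>E (Y * (A u v)\<^sup>2) \<le> 112 * R\<^sup>2 * (v - u) * E Y\<close> for all nonnegative bounded
\<open>F u\<close>-measurable \<open>Y\<close> (lemma \<open>second_moment\<close>), in other words a bound on the conditional second moment
of \<open>A u v\<close>. It is trivial for \<open>R\<^sup>2 \<ge> v - u\<close>. Otherwise let \<open>\<phi> t = g t (X t + f t) - g t (X t)\<close> and expand the square into integrals of
\<open>E (Y * \<phi> t * \<phi> r)\<close> with \<open>t < r\<close>. The pairs with \<open>r - t \<le> h = R\<^sup>2\<close> contribute the right order
trivially. For \<open>r > t + h\<close>, shifting the path by \<open>f t\<close> after time \<open>t + h\<close> amounts, by Cameron and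
Martin, to a weight \<open>1 + L t\<close> that depends on the increment of \<open>X\<close> over \<open>[t, t + h]\<close> only. This gives
\<open>E (Y * \<phi> t * \<phi> r) = - E (Y * g t (X t + f t) * L t * \<phi> r)\<close> up to an error of order
\<open>R\<^sup>2 / sqrt ((t - u) * (r - t))\<close>, which is integrable (lemma \<open>far_pair_bound\<close>). The main term integrates
to \<open>- E (Y * Z * A u v)\<close> with \<open>Z = \<integral>t. g t (X t + f t) * L t\<close>. Since \<open>L t\<close> and \<open>L r\<close> are
uncorrelated for \<open>\<bar>t - r\<bar> \<ge> h\<close> and have variance at most \<open>2\<close>, the second moment of \<open>Z\<close> is of order
\<open>h * (v - u)\<close>, and the product with \<open>A\<close> is absorbed into the left-hand side.

The second moments scale like \<open>v - u\<close> on every interval, so bisecting the interval bounds the \<open>n\<close>-th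
absolute moment, \<open>n \<ge> 3\<close>, by the lower ones (lemma \<open>mom_bound_bisect\<close>) and yields
\<open>E \<bar>A u v\<bar> ^ n \<le> n! * (33 * R) ^ n * sqrt (v - u) ^ n / 3\<close>. Hence a suitable exponential moment on an
interval of length \<open>d\<close> is at most \<open>2\<close>; multiplying over \<open>N\<close> consecutive pieces gives the tail bound
of lemma \<open>shift_effect_tail\<close>, which is Gaussian after optimizing \<open>N\<close>.

Finally \<open>f\<close> is not bounded, but for large \<open>\<eta>\<close> the supremum of \<open>\<bar>B $ i\<bar>\<close> exceeds \<open>sqrt \<eta> * sqrt (s' - s)\<close> with probability
at most of order \<open>exp (- \<eta> / 32)\<close> (lemma \<open>brownian_sup_tail\<close>, by chaining over dyadic times). Truncating
\<open>f\<close> at \<open>R = sqrt \<eta> * (infnorm (x' - x) + sqrt (s' - s)) / sqrt s\<close> and taking \<open>N\<close> proportional to \<open>\<eta>\<close>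
gives \<open>exp (- \<alpha> * \<eta>)\<close> (lemma \<open>coordinate_tail\<close>). The filtration rests on the fact that a variable in
the Gaussian space of the sheet is independent of the sigma-algebra generated by variables orthogonal to
it (lemma \<open>gspan_indep\<close>), which follows from the one-dimensional uniqueness theorem for characteristic
functions.\<close>

section \<open>Gaussian laws on the line and their translates\<close>

text \<open>The centered normal law with variance \<open>v\<close>; it is used for \<open>v > 0\<close> only.\<close>

definition normal_law :: "real \<Rightarrow> real measure" where
  "normal_law v = density lborel (\<lambda>w. ennreal (normal_density 0 (sqrt v) w))"

text \<open>The Cameron--Martin weight: the density of the normal law translated by \<open>c\<close>, relative to the centered
normal law with variance \<open>v\<close>.\<close>

definition cm_weight :: "real \<Rightarrow> real \<Rightarrow> real \<Rightarrow> real" where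
  "cm_weight v c w = exp (c * w / v - c\<^sup>2 / (2 * v))"

lemma sets_normal_law [measurable_cong, simp]: "sets (normal_law v) = sets borel"
  by (simp add: normal_law_def)

lemma space_normal_law [simp]: "space (normal_law v) = UNIV"
  by (simp add: normal_law_def)

lemma prob_space_normal_law: "v > 0 \<Longrightarrow> prob_space (normal_law v)"
  unfolding normal_law_def by (rule prob_space_normal_density) simp

lemma measure_normal_law_UNIV [simp]: "v > 0 \<Longrightarrow> measure (normal_law v) UNIV = 1"
  using prob_space.prob_space[OF prob_space_normal_law, of v] by simp

lemma cm_measurable [measurable]:
  assumes "c \<in> borel_measurable N" "D \<in> borel_measurable N"
  shows "(\<lambda>x. cm_weight v (c x) (D x)) \<in> borel_measurable N"
  using assms unfolding cm_weight_def by measurable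

lemma cm_pos: "cm_weight v c w > 0"
  by (simp add: cm_weight_def)

lemma cm_normal_density:
  assumes "v > 0"
  shows "normal_density 0 (sqrt v) (w - c) = normal_density 0 (sqrt v) w * cm_weight v c w"
proof -
  have "- ((w - c)\<^sup>2 / (2 * v)) = - (w\<^sup>2 / (2 * v)) + (c * w / v - c\<^sup>2 / (2 * v))"
    using assms by (simp add: field_simps power2_eq_square)
  then show ?thesis
    using assms by (simp add: normal_density_def cm_weight_def mult_exp_exp)
qed

lemma integrable_normal_law_iff:
  fixes f :: "real \<Rightarrow> real"
  assumes "f \<in> borel_measurable borel"
  shows "integrable (normal_law v) f \<longleftrightarrow> integrable lborel (\<lambda>w. normal_density 0 (sqrt v) w * f w)"
  unfolding normal_law_def using assms by (subst integrable_density) auto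

lemma integral_normal_law:
  fixes f :: "real \<Rightarrow> real"
  assumes "f \<in> borel_measurable borel"
  shows "(\<integral>w. f w \<partial>normal_law v) = (\<integral>w. normal_density 0 (sqrt v) w * f w \<partial>lborel)"
  unfolding normal_law_def using assms by (subst integral_density) auto

lemma normal_law_translate:
  fixes f :: "real \<Rightarrow> real"
  assumes "v > 0" and [measurable]: "f \<in> borel_measurable borel"
  shows "(\<integral>w. f (w + c) \<partial>normal_law v) = (\<integral>w. f w * cm_weight v c w \<partial>normal_law v)"
proof -
  have "(\<integral>w. f (w + c) \<partial>normal_law v) = (\<integral>w. normal_density 0 (sqrt v) w * f (w + c) \<partial>lborel)"
    by (rule integral_normal_law) measurable
  also have "\<dots> = (\<integral>w. normal_density 0 (sqrt v) (w - c) * f w \<partial>lborel)"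
    using lborel_integral_real_affine[of 1 "\<lambda>w. normal_density 0 (sqrt v) (w - c) * f w" c]
    by (simp add: add.commute)
  also have "\<dots> = (\<integral>w. normal_density 0 (sqrt v) w * (f w * cm_weight v c w) \<partial>lborel)"
    using assms by (simp add: cm_normal_density mult_ac)
  also have "\<dots> = (\<integral>w. f w * cm_weight v c w \<partial>normal_law v)"
    by (rule integral_normal_law[symmetric]) measurable
  finally show ?thesis .
qed

lemma cm_integrable_integral:
  assumes "v > 0"
  shows integrable_cm: "integrable (normal_law v) (cm_weight v c)"
    and integral_cm: "(\<integral>w. cm_weight v c w \<partial>normal_law v) = 1"
proof -
  have "integrable lborel (\<lambda>w. normal_density 0 (sqrt v) (- c + 1 * w))"
    by (rule lborel_integrable_real_affine) (use assms in auto)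
  then have "integrable lborel (\<lambda>w. normal_density 0 (sqrt v) w * cm_weight v c w)"
    using assms by (simp add: cm_normal_density[symmetric])
  then show "integrable (normal_law v) (cm_weight v c)"
    by (subst integrable_normal_law_iff) auto
  show "(\<integral>w. cm_weight v c w \<partial>normal_law v) = 1"
    using normal_law_translate[OF assms, of "\<lambda>_. 1" c] prob_space.prob_space[OF prob_space_normal_law[OF assms]]
    by simp
qed

lemma cm_power2: "v > 0 \<Longrightarrow> (cm_weight v c w)\<^sup>2 = exp (c\<^sup>2 / v) * cm_weight v (2 * c) w"
  unfolding cm_weight_def by (simp add: power2_eq_square mult_exp_exp field_simps)

lemma cm_minus_one_power2:
  assumes "v > 0"
  shows integrable_cm_minus_one_power2: "integrable (normal_law v) (\<lambda>w. (cm_weight v c w - 1)\<^sup>2)"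
    and integral_cm_minus_one_power2: "(\<integral>w. (cm_weight v c w - 1)\<^sup>2 \<partial>normal_law v) = exp (c\<^sup>2 / v) - 1"
proof -
  interpret prob_space "normal_law v" by (rule prob_space_normal_law[OF assms])
  have eq: "(\<lambda>w. (cm_weight v c w - 1)\<^sup>2) = (\<lambda>w. exp (c\<^sup>2 / v) * cm_weight v (2 * c) w + (1 - 2 * cm_weight v c w))"
    by (rule ext) (simp add: power2_diff cm_power2[OF assms])
  have [simp]: "integrable (normal_law v) (cm_weight v a)" for a
    by (rule integrable_cm[OF assms])
  show "integrable (normal_law v) (\<lambda>w. (cm_weight v c w - 1)\<^sup>2)"
    unfolding eq by auto
  show "(\<integral>w. (cm_weight v c w - 1)\<^sup>2 \<partial>normal_law v) = exp (c\<^sup>2 / v) - 1"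
    unfolding eq by (simp add: integral_cm[OF assms] assms)
qed

lemma exp_minus_one_le: "0 \<le> x \<Longrightarrow> x \<le> 1 \<Longrightarrow> exp x - 1 \<le> 2 * (x::real)"
  using exp_bound[of x] mult_left_le[of x x] by (simp add: power2_eq_square)

lemma exp_one_le_3: "exp 1 \<le> (3::real)"
  using exp_bound[of 1] by simp

text \<open>Translating a centered Gaussian law of variance \<open>v\<close> by \<open>c\<close> moves it by at most
  \<open>2 \<bar>c\<bar> / sqrt v\<close> in total variation.\<close>

lemma normal_law_shift_le:
  fixes f :: "real \<Rightarrow> real"
  assumes v: "v > 0" and [measurable]: "f \<in> borel_measurable borel" and K: "\<And>w. \<bar>f w\<bar> \<le> K"
  shows "\<bar>(\<integral>w. f (w + c) \<partial>normal_law v) - (\<integral>w. f w \<partial>normal_law v)\<bar> \<le> 2 * K * \<bar>c\<bar> / sqrt v"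
proof -
  interpret prob_space "normal_law v" by (rule prob_space_normal_law[OF v])
  have K0: "K \<ge> 0" using K[of 0] by linarith
  have intf: "integrable (normal_law v) f" "integrable (normal_law v) (\<lambda>w. f (w + c))"
    by (rule integrable_const_bound[of _ K]; use K in auto)+
  show ?thesis
  proof (cases "c\<^sup>2 \<le> v")
    case True
    have i1: "integrable (normal_law v) (\<lambda>w. f w * cm_weight v c w)"
      by (rule Bochner_Integration.integrable_bound[OF integrable_mult_right[OF integrable_cm[OF v, of c], of K]])
         (auto simp: abs_mult intro!: mult_mono K AE_I2 order_trans[OF K] simp: less_imp_le[OF cm_pos] K0)
    define s where "s = \<bar>c\<bar> / sqrt v"
    have ss: "c\<^sup>2 / v = s * s" using v by (simp add: s_def power2_eq_square)
    have "(\<integral>w. f (w + c) \<partial>normal_law v) - (\<integral>w. f w \<partial>normal_law v) = (\<integral>w. f w * (cm_weight v c w - 1) \<partial>normal_law v)"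
      using i1 intf by (simp add: normal_law_translate[OF v] right_diff_distrib)
    moreover have "\<bar>\<integral>w. f w * (cm_weight v c w - 1) \<partial>normal_law v\<bar> \<le> 2 * K * s"
    proof (cases "c = 0")
      case True
      then show ?thesis by (simp add: cm_weight_def s_def)
    next
      case False
      then have s: "s > 0" using v by (simp add: s_def)
      \<comment> \<open>A weighted form of \<open>2ab \<le> a\<^sup>2 + b\<^sup>2\<close> replaces the Cauchy--Schwarz inequality; \<open>s\<close> is the size of the
        standard deviation of the weight.\<close>
      have amgm: "\<bar>x\<bar> \<le> x\<^sup>2 / (2 * s) + s / 2" for x :: real
      proof -
        have "0 \<le> (\<bar>x\<bar> - s)\<^sup>2" by simp
        then have "\<bar>x\<bar> * (2 * s) \<le> x\<^sup>2 + s * s"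
          by (simp add: power2_diff power2_eq_square algebra_simps)
        then have "\<bar>x\<bar> \<le> (x\<^sup>2 + s * s) / (2 * s)"
          using s by (subst pos_le_divide_eq) auto
        also have "\<dots> = x\<^sup>2 / (2 * s) + s / 2" using s by (simp add: add_divide_distrib)
        finally show ?thesis .
      qed
      have "\<bar>\<integral>w. f w * (cm_weight v c w - 1) \<partial>normal_law v\<bar> \<le> (\<integral>w. \<bar>f w * (cm_weight v c w - 1)\<bar> \<partial>normal_law v)"
        by (rule integral_abs_bound)
      also have "\<dots> \<le> (\<integral>w. K * ((cm_weight v c w - 1)\<^sup>2 / (2 * s) + s / 2) \<partial>normal_law v)"
      proof (rule integral_mono)
        show "integrable (normal_law v) (\<lambda>w. \<bar>f w * (cm_weight v c w - 1)\<bar>)"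
          using i1 intf by (auto simp: right_diff_distrib)
        show "integrable (normal_law v) (\<lambda>w. K * ((cm_weight v c w - 1)\<^sup>2 / (2 * s) + s / 2))"
          using integrable_cm_minus_one_power2[OF v, of c] by auto
        show "\<bar>f w * (cm_weight v c w - 1)\<bar> \<le> K * ((cm_weight v c w - 1)\<^sup>2 / (2 * s) + s / 2)" for w
          unfolding abs_mult by (rule mult_mono[OF K amgm]) (use K0 in auto)
      qed
      also have "\<dots> = K * ((exp (c\<^sup>2 / v) - 1) / (2 * s) + s / 2)"
        using integrable_cm_minus_one_power2[OF v, of c]
        by (simp add: integral_cm_minus_one_power2[OF v] v)
      also have "\<dots> \<le> K * (2 * (c\<^sup>2 / v) / (2 * s) + s / 2)"
        using exp_minus_one_le[of "c\<^sup>2 / v"] True v s K0 divide_le_eq_1_pos[of v "c\<^sup>2"]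
        by (intro mult_left_mono add_right_mono divide_right_mono) (auto simp: ss)
      also note ss
      also have "K * (2 * (s * s) / (2 * s) + s / 2) = K * s * (3/2)"
        using s by (simp add: field_simps)
      also have "\<dots> \<le> 2 * K * s" using s K0 by simp
      finally show ?thesis .
    qed
    ultimately show ?thesis by (simp add: s_def)
  next
    case False
    then have "sqrt v \<le> \<bar>c\<bar>" by (metis less_le_not_le linorder_linear real_sqrt_abs real_sqrt_le_iff)
    then have "1 \<le> \<bar>c\<bar> / sqrt v" using v by simp
    then have "2 * K \<le> 2 * K * (\<bar>c\<bar> / sqrt v)" using K0 mult_left_mono[of 1 "\<bar>c\<bar> / sqrt v" "2 * K"] by simp
    moreover have "\<bar>\<integral>w. h w \<partial>normal_law v\<bar> \<le> K"
      if "integrable (normal_law v) h" "\<And>w. \<bar>h w\<bar> \<le> K" for h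
      using integral_mono[of "normal_law v" "\<lambda>w. \<bar>h w\<bar>" "\<lambda>_. K"] that v
      by (intro order_trans[OF integral_abs_bound]) auto
    from this[OF intf(1) K] this[OF intf(2) K]
    have "\<bar>(\<integral>w. f (w + c) \<partial>normal_law v) - (\<integral>w. f w \<partial>normal_law v)\<bar> \<le> 2 * K"
      by linarith
    ultimately show ?thesis by simp
  qed
qed

section \<open>Brownian motion in an environment known at time zero\<close>

text \<open>A standard Brownian motion \<open>X\<close> on \<open>[0, 1]\<close> for the filtration \<open>F\<close>, together with a random function \<open>g\<close> of
time and space, bounded by \<open>1\<close>, and a random shift \<open>f\<close>, bounded by \<open>R\<close>, both \<open>F 0\<close>-measurable. The path
is frozen after time \<open>1\<close>, so that \<open>X\<close> is jointly measurable in all real times. The assumption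
\<open>X_incr\<close> says both that \<open>X t - X u\<close> has the normal law with variance \<open>t - u\<close> and that it is independent
of \<open>F u\<close>.\<close>

locale brownian_shift = prob_space M for M :: "'a measure" +
  fixes F :: "real \<Rightarrow> 'a measure" and X :: "real \<Rightarrow> 'a \<Rightarrow> real"
    and g :: "real \<Rightarrow> real \<Rightarrow> 'a \<Rightarrow> real" and f :: "real \<Rightarrow> 'a \<Rightarrow> real" and R :: real
  assumes space_F: "\<And>m. space (F m) = space M"
    and sets_F: "\<And>m. sets (F m) \<subseteq> sets M"
    and F_mono: "\<And>m m'. m \<le> m' \<Longrightarrow> sets (F m) \<subseteq> sets (F m')"
    and X_stop: "\<And>t. X (min t 1) = X t"
    and X_prog: "\<And>m. 0 \<le> m \<Longrightarrow> m \<le> 1 \<Longrightarrow> (\<lambda>(t, \<omega>). X (min t m) \<omega>) \<in> borel_measurable (borel \<Otimes>\<^sub>M F m)"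
    and X_incr: "\<And>u t A B. 0 \<le> u \<Longrightarrow> u < t \<Longrightarrow> t \<le> 1 \<Longrightarrow> A \<in> sets (F u) \<Longrightarrow> B \<in> sets borel \<Longrightarrow>
      prob (A \<inter> (\<lambda>\<omega>. X t \<omega> - X u \<omega>) -` B) = prob A * measure (normal_law (t - u)) B"
    and g_meas: "(\<lambda>(t, y, \<omega>). g t y \<omega>) \<in> borel_measurable (borel \<Otimes>\<^sub>M borel \<Otimes>\<^sub>M F 0)"
    and g_le: "\<And>t y \<omega>. \<bar>g t y \<omega>\<bar> \<le> 1"
    and f_meas: "(\<lambda>(t, \<omega>). f t \<omega>) \<in> borel_measurable (borel \<Otimes>\<^sub>M F 0)"
    and f_le: "\<And>t \<omega>. \<bar>f t \<omega>\<bar> \<le> R"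
    and R_pos: "R > 0"
begin

lemma measurable_id_F: "0 \<le> m \<Longrightarrow> (\<lambda>x. x) \<in> measurable M (F m)"
  using sets_F space_F by (auto simp: measurable_def Int_absorb2 sets.sets_into_space)

lemma measurable_F_M: "w \<in> measurable N M \<Longrightarrow> w \<in> measurable N (F m)"
  using sets_F[of m] space_F[of m] by (auto simp: measurable_def)

lemma measurable_F_mono: "w \<in> measurable N (F m) \<Longrightarrow> m' \<le> m \<Longrightarrow> w \<in> measurable N (F m')"
  using F_mono[of m' m] space_F by (auto simp: measurable_def)

lemma borel_measurable_F_mono: "Z \<in> borel_measurable (F m) \<Longrightarrow> m \<le> m' \<Longrightarrow> Z \<in> borel_measurable (F m')"
  using F_mono[of m m'] space_F by (auto simp: measurable_def)

lemma borel_measurable_F_M: "Z \<in> borel_measurable (F m) \<Longrightarrow> Z \<in> borel_measurable M"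
  using sets_F[of m] space_F[of m] by (auto simp: measurable_def)

lemma g_meas_F:
  assumes "a \<in> borel_measurable N" "b \<in> borel_measurable N" "w \<in> measurable N (F m)" "0 \<le> m"
  shows "(\<lambda>x. g (a x) (b x) (w x)) \<in> borel_measurable N"
proof -
  have [measurable]: "w \<in> measurable N (F 0)" using assms measurable_F_mono by blast
  have "(\<lambda>x. (a x, b x, w x)) \<in> measurable N (borel \<Otimes>\<^sub>M borel \<Otimes>\<^sub>M F 0)"
    using assms(1,2) by measurable
  from measurable_compose[OF this g_meas] show ?thesis by simp
qed

lemma f_meas_F:
  assumes "a \<in> borel_measurable N" "w \<in> measurable N (F m)" "0 \<le> m"
  shows "(\<lambda>x. f (a x) (w x)) \<in> borel_measurable N"
proof -
  have [measurable]: "w \<in> measurable N (F 0)" using assms measurable_F_mono by blast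
  have "(\<lambda>x. (a x, w x)) \<in> measurable N (borel \<Otimes>\<^sub>M F 0)"
    using assms(1) by measurable
  from measurable_compose[OF this f_meas] show ?thesis by simp
qed

lemma X_meas_F:
  assumes "a \<in> borel_measurable N" "w \<in> measurable N (F m)" "0 \<le> m" "m \<le> 1"
    and le: "\<And>x. x \<in> space N \<Longrightarrow> a x \<le> m"
  shows "(\<lambda>x. X (a x) (w x)) \<in> borel_measurable N"
proof -
  have "(\<lambda>x. (a x, w x)) \<in> measurable N (borel \<Otimes>\<^sub>M F m)"
    using assms(1,2) by measurable
  from measurable_compose[OF this X_prog[OF assms(3,4)]]
  have "(\<lambda>x. X (min (a x) m) (w x)) \<in> borel_measurable N" by simp
  also have "?this \<longleftrightarrow> ?thesis"
    by (rule measurable_cong) (use le in \<open>simp add: min_absorb1\<close>)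
  finally show ?thesis .
qed

lemma g_meas_M [measurable (raw)]:
  "a \<in> borel_measurable N \<Longrightarrow> b \<in> borel_measurable N \<Longrightarrow> w \<in> measurable N M \<Longrightarrow>
    (\<lambda>x. g (a x) (b x) (w x)) \<in> borel_measurable N"
  by (rule g_meas_F[OF _ _ measurable_F_M order_refl])

lemma f_meas_M [measurable (raw)]:
  "a \<in> borel_measurable N \<Longrightarrow> w \<in> measurable N M \<Longrightarrow> (\<lambda>x. f (a x) (w x)) \<in> borel_measurable N"
  by (rule f_meas_F[OF _ measurable_F_M order_refl])

lemma X_meas_M [measurable (raw)]:
  assumes "a \<in> borel_measurable N" "w \<in> measurable N M"
  shows "(\<lambda>x. X (a x) (w x)) \<in> borel_measurable N"
proof -
  have "(\<lambda>x. X (min (a x) 1) (w x)) \<in> borel_measurable N"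
    by (rule X_meas_F[where m=1]) (use assms measurable_F_M[of _ _ 1] in auto)
  then show ?thesis by (simp add: X_stop)
qed

text \<open>Integrating out an increment of the path while the past is kept fixed.\<close>

lemma
  assumes ut: "0 \<le> u" "u < t" "t \<le> 1"
    and H: "(\<lambda>(\<omega>, w). H \<omega> w) \<in> borel_measurable (F u \<Otimes>\<^sub>M borel)"
  shows markov_nn: "(\<integral>\<^sup>+\<omega>. ennreal (H \<omega> (X t \<omega> - X u \<omega>)) \<partial>M) = (\<integral>\<^sup>+\<omega>. (\<integral>\<^sup>+w. ennreal (H \<omega> w) \<partial>normal_law (t - u)) \<partial>M)"
    and markov: "integrable M (\<lambda>\<omega>. H \<omega> (X t \<omega> - X u \<omega>)) \<Longrightarrow>
      (\<integral>\<omega>. H \<omega> (X t \<omega> - X u \<omega>) \<partial>M) = (\<integral>\<omega>. (\<integral>w. H \<omega> w \<partial>normal_law (t - u)) \<partial>M)"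
proof -
  interpret N: prob_space "normal_law (t - u)" by (rule prob_space_normal_law) (use ut in simp)
  have idF[measurable]: "(\<lambda>x. x) \<in> measurable M (F u)" by (rule measurable_id_F[OF ut(1)])
  interpret D: prob_space "distr M (F u) (\<lambda>x. x)" by (rule prob_space_distr[OF idF])
  interpret P: pair_sigma_finite "distr M (F u) (\<lambda>x. x)" "normal_law (t - u)" ..
  have map[measurable]: "(\<lambda>x. (x, X t x - X u x)) \<in> measurable M (F u \<Otimes>\<^sub>M borel)"
    by measurable
  have eq: "distr M (F u) (\<lambda>\<omega>. \<omega>) \<Otimes>\<^sub>M normal_law (t - u) = distr M (F u \<Otimes>\<^sub>M borel) (\<lambda>x. (x, X t x - X u x))"
  proof (rule pair_measure_eqI)
    fix A B assume A: "A \<in> sets (distr M (F u) (\<lambda>x. x))" and B: "B \<in> sets (normal_law (t - u))"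
    then have A': "A \<in> sets (F u)" and B': "B \<in> sets borel" by auto
    have "A \<in> sets M" using A' sets_F by blast
    then have AM: "A \<inter> space M = A" using sets.sets_into_space by blast
    have "emeasure (distr M (F u) (\<lambda>x. x)) A * emeasure (normal_law (t - u)) B = ennreal (prob A * measure (normal_law (t - u)) B)"
      using A' AM idF by (simp add: emeasure_distr emeasure_eq_measure N.emeasure_eq_measure ennreal_mult)
    also have "\<dots> = emeasure M (A \<inter> (\<lambda>\<omega>. X t \<omega> - X u \<omega>) -` B)"
      using X_incr[OF ut A' B'] by (simp add: emeasure_eq_measure)
    also have "A \<inter> (\<lambda>\<omega>. X t \<omega> - X u \<omega>) -` B = (\<lambda>x. (x, X t x - X u x)) -` (A \<times> B) \<inter> space M"
      using AM by auto
    finally show "emeasure (distr M (F u) (\<lambda>x. x)) A * emeasure (normal_law (t - u)) B =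
        emeasure (distr M (F u \<Otimes>\<^sub>M borel) (\<lambda>x. (x, X t x - X u x))) (A \<times> B)"
      using A' B' by (simp add: emeasure_distr)
  qed (auto intro!: sets_pair_measure_cong D.sigma_finite_measure_axioms N.sigma_finite_measure_axioms)
  note H[measurable]
  have "(\<integral>\<^sup>+\<omega>. ennreal (H \<omega> (X t \<omega> - X u \<omega>)) \<partial>M) = (\<integral>\<^sup>+x. (case x of (\<omega>, w) \<Rightarrow> ennreal (H \<omega> w)) \<partial>distr M (F u \<Otimes>\<^sub>M borel) (\<lambda>x. (x, X t x - X u x)))"
    by (subst nn_integral_distr) auto
  also have "\<dots> = (\<integral>\<^sup>+x. (case x of (\<omega>, w) \<Rightarrow> ennreal (H \<omega> w)) \<partial>(distr M (F u) (\<lambda>\<omega>. \<omega>) \<Otimes>\<^sub>M normal_law (t - u)))"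
    by (simp add: eq)
  also have "\<dots> = (\<integral>\<^sup>+\<omega>. (\<integral>\<^sup>+w. ennreal (H \<omega> w) \<partial>normal_law (t - u)) \<partial>distr M (F u) (\<lambda>\<omega>. \<omega>))"
    by (subst N.nn_integral_fst[symmetric]) auto
  also have "\<dots> = (\<integral>\<^sup>+\<omega>. (\<integral>\<^sup>+w. ennreal (H \<omega> w) \<partial>normal_law (t - u)) \<partial>M)"
    by (subst nn_integral_distr) auto
  finally show "(\<integral>\<^sup>+\<omega>. ennreal (H \<omega> (X t \<omega> - X u \<omega>)) \<partial>M) = (\<integral>\<^sup>+\<omega>. (\<integral>\<^sup>+w. ennreal (H \<omega> w) \<partial>normal_law (t - u)) \<partial>M)" .
  assume int: "integrable M (\<lambda>\<omega>. H \<omega> (X t \<omega> - X u \<omega>))"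
  then have int': "integrable (distr M (F u) (\<lambda>\<omega>. \<omega>) \<Otimes>\<^sub>M normal_law (t - u)) (\<lambda>(\<omega>, w). H \<omega> w)"
    unfolding eq by (subst integrable_distr_eq) auto
  have "(\<integral>\<omega>. H \<omega> (X t \<omega> - X u \<omega>) \<partial>M) = (\<integral>x. (case x of (\<omega>, w) \<Rightarrow> H \<omega> w) \<partial>distr M (F u \<Otimes>\<^sub>M borel) (\<lambda>x. (x, X t x - X u x)))"
    by (subst integral_distr) auto
  also have "\<dots> = (\<integral>x. (case x of (\<omega>, w) \<Rightarrow> H \<omega> w) \<partial>(distr M (F u) (\<lambda>\<omega>. \<omega>) \<Otimes>\<^sub>M normal_law (t - u)))"
    by (simp add: eq)
  also have "\<dots> = (\<integral>\<omega>. (\<integral>w. H \<omega> w \<partial>normal_law (t - u)) \<partial>distr M (F u) (\<lambda>\<omega>. \<omega>))"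
    by (rule P.integral_fst[OF int', symmetric])
  also have "\<dots> = (\<integral>\<omega>. (\<integral>w. H \<omega> w \<partial>normal_law (t - u)) \<partial>M)"
    by (subst integral_distr) auto
  finally show "(\<integral>\<omega>. H \<omega> (X t \<omega> - X u \<omega>) \<partial>M) = (\<integral>\<omega>. (\<integral>w. H \<omega> w \<partial>normal_law (t - u)) \<partial>M)" .
qed

text \<open>The change of \<open>g\<close> under the shift at time \<open>r\<close> and position \<open>y\<close>, and its average over a centered normal
displacement with variance \<open>v\<close>, that is, its conditional expectation a time \<open>v\<close> earlier.\<close>

definition shift_diff :: "real \<Rightarrow> real \<Rightarrow> 'a \<Rightarrow> real" where
  "shift_diff r y \<omega> = g r (y + f r \<omega>) \<omega> - g r y \<omega>"

definition smoothed :: "real \<Rightarrow> real \<Rightarrow> real \<Rightarrow> 'a \<Rightarrow> real" where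
  "smoothed v r y \<omega> = (\<integral>z. shift_diff r (y + z) \<omega> \<partial>normal_law v)"

lemma shift_diff_meas_F:
  assumes [measurable]: "a \<in> borel_measurable N" "b \<in> borel_measurable N" "w \<in> measurable N (F m)" and "0 \<le> m"
  shows "(\<lambda>x. shift_diff (a x) (b x) (w x)) \<in> borel_measurable N"
proof -
  note [measurable] = f_meas_F[OF assms(1,3,4)]
  show ?thesis
    unfolding shift_diff_def by (intro borel_measurable_diff g_meas_F[OF _ _ assms(3,4)]) auto
qed

lemma shift_diff_meas_M [measurable (raw)]:
  "a \<in> borel_measurable N \<Longrightarrow> b \<in> borel_measurable N \<Longrightarrow> w \<in> measurable N M \<Longrightarrow>
    (\<lambda>x. shift_diff (a x) (b x) (w x)) \<in> borel_measurable N"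
  by (rule shift_diff_meas_F[OF _ _ measurable_F_M order_refl])

lemma smoothed_meas_F:
  assumes v: "v > 0" and [measurable]: "a \<in> borel_measurable N" "b \<in> borel_measurable N" "w \<in> measurable N (F m)" and "0 \<le> m"
  shows "(\<lambda>x. smoothed v (a x) (b x) (w x)) \<in> borel_measurable N"
proof -
  interpret N: prob_space "normal_law v" by (rule prob_space_normal_law[OF v])
  have "(\<lambda>(x, z). shift_diff (a x) (b x + z) (w x)) \<in> borel_measurable (N \<Otimes>\<^sub>M borel)"
    unfolding case_prod_beta by (rule shift_diff_meas_F[OF _ _ _ \<open>0 \<le> m\<close>]) measurable
  then show ?thesis
    unfolding smoothed_def by measurable
qed

lemma smoothed_meas_M [measurable (raw)]:
  "v > 0 \<Longrightarrow> a \<in> borel_measurable N \<Longrightarrow> b \<in> borel_measurable N \<Longrightarrow> w \<in> measurable N M \<Longrightarrow>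
    (\<lambda>x. smoothed v (a x) (b x) (w x)) \<in> borel_measurable N"
  by (rule smoothed_meas_F[OF _ _ _ measurable_F_M order_refl])

lemma shift_diff_le: "\<bar>shift_diff r y \<omega>\<bar> \<le> 2"
  unfolding shift_diff_def using g_le[of r "y + f r \<omega>" \<omega>] g_le[of r y \<omega>] by linarith

lemma g_section [measurable]: "\<omega> \<in> space M \<Longrightarrow> (\<lambda>y. g r y \<omega>) \<in> borel_measurable borel"
  by measurable

text \<open>Averaging gains the factor \<open>R / sqrt v\<close>, because the shift can be moved from \<open>g\<close> to the normal law.\<close>

lemma smoothed_le:
  assumes v: "v > 0" and \<omega>: "\<omega> \<in> space M"
  shows "\<bar>smoothed v r y \<omega>\<bar> \<le> 2 * R / sqrt v"
proof -
  interpret N: prob_space "normal_law v" by (rule prob_space_normal_law[OF v])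
  note [measurable] = g_section[OF \<omega>]
  have [measurable]: "(\<lambda>z. g r (y + z) \<omega>) \<in> borel_measurable borel" by measurable
  have i: "integrable (normal_law v) (\<lambda>z. g r (y + z + f r \<omega>) \<omega>)" "integrable (normal_law v) (\<lambda>z. g r (y + z) \<omega>)"
    by (rule N.integrable_const_bound[of _ 1]; use g_le in auto)+
  have "smoothed v r y \<omega> = (\<integral>z. g r (y + (z + f r \<omega>)) \<omega> \<partial>normal_law v) - (\<integral>z. g r (y + z) \<omega> \<partial>normal_law v)"
    unfolding smoothed_def shift_diff_def using i by (simp add: add.assoc)
  also have "\<bar>\<dots>\<bar> \<le> 2 * 1 * \<bar>f r \<omega>\<bar> / sqrt v"
    by (rule normal_law_shift_le[OF v]) (auto intro: g_le)
  also have "\<dots> \<le> 2 * R / sqrt v"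
    using f_le[of r \<omega>] v by (intro divide_right_mono) auto
  finally show ?thesis .
qed

lemma markov_shift_diff:
  assumes tr: "0 \<le> t" "t < r" "r \<le> 1"
    and Z: "Z \<in> borel_measurable (F t)" "integrable M Z" and e: "e \<in> borel_measurable (F t)"
  shows "(\<integral>\<omega>. Z \<omega> * shift_diff r (X r \<omega> + e \<omega>) \<omega> \<partial>M) = (\<integral>\<omega>. Z \<omega> * smoothed (r - t) r (X t \<omega> + e \<omega>) \<omega> \<partial>M)"
proof -
  have [measurable]: "Z \<in> borel_measurable M" "e \<in> borel_measurable M"
    using Z e by (auto intro: borel_measurable_F_M)
  have X: "X t \<in> borel_measurable (F t)"
    by (rule X_meas_F[where m=t]) (use tr in auto)
  let ?H = "\<lambda>\<omega> z. Z \<omega> * shift_diff r (X t \<omega> + e \<omega> + z) \<omega>"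
  have "(\<lambda>(\<omega>, z). shift_diff r (X t \<omega> + e \<omega> + z) \<omega>) \<in> borel_measurable (F t \<Otimes>\<^sub>M borel)"
    unfolding case_prod_beta
    by (rule shift_diff_meas_F[where m=t]) (use tr X e in measurable)
  then have H: "(\<lambda>(\<omega>, z). ?H \<omega> z) \<in> borel_measurable (F t \<Otimes>\<^sub>M borel)"
    using Z(1) by (simp add: case_prod_beta)
  have "integrable M (\<lambda>\<omega>. ?H \<omega> (X r \<omega> - X t \<omega>))"
    by (rule Bochner_Integration.integrable_bound[OF integrable_mult_left[OF Z(2), of 2]])
       (auto simp: abs_mult intro!: mult_left_mono shift_diff_le AE_I2)
  from markov[OF tr H this] show ?thesis
    by (simp add: smoothed_def algebra_simps)
qed

text \<open>For a shift of size at most \<open>R\<close> and \<open>h \<ge> R\<^sup>2\<close>, the Cameron--Martin weight over \<open>[t, t + h]\<close>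
has conditional variance at most \<open>2\<close>.\<close>

lemma
  assumes t: "0 \<le> t" "0 < h" "t + h \<le> 1" and e: "e \<in> borel_measurable (F t)"
  shows integrable_cm_weight_increment: "integrable M (\<lambda>\<omega>. cm_weight h (e \<omega>) (X (t + h) \<omega> - X t \<omega>))"
    and nn_integral_cm_weight_square_le: "Z \<in> borel_measurable (F t) \<Longrightarrow> (\<And>\<omega>. 0 \<le> Z \<omega>) \<Longrightarrow> (\<And>\<omega>. \<bar>e \<omega>\<bar> \<le> R) \<Longrightarrow> R\<^sup>2 \<le> h \<Longrightarrow> 
       (\<integral>\<^sup>+\<omega>. ennreal (Z \<omega> * (cm_weight h (e \<omega>) (X (t + h) \<omega> - X t \<omega>) - 1)\<^sup>2) \<partial>M) \<le> (\<integral>\<^sup>+\<omega>. ennreal (2 * Z \<omega>) \<partial>M)"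
proof -
  have t': "t < t + h" using t by simp
  interpret N: prob_space "normal_law h" by (rule prob_space_normal_law[OF t(2)])
  have [measurable]: "e \<in> borel_measurable M"
    using e by (auto intro: borel_measurable_F_M)
  have H: "(\<lambda>(\<omega>, w). cm_weight h (e \<omega>) w) \<in> borel_measurable (F t \<Otimes>\<^sub>M borel)"
    using e by measurable
  show "integrable M (\<lambda>\<omega>. cm_weight h (e \<omega>) (X (t + h) \<omega> - X t \<omega>))"
  proof (rule integrableI_nonneg)
    have "(\<integral>\<^sup>+w. ennreal (cm_weight h c w) \<partial>normal_law h) = 1" for c
      using integral_cm[OF t(2), of c] integrable_cm[OF t(2), of c]
      by (subst nn_integral_eq_integral) (auto simp: less_imp_le[OF cm_pos])
    then have "(\<integral>\<^sup>+\<omega>. ennreal (cm_weight h (e \<omega>) (X (t + h) \<omega> - X t \<omega>)) \<partial>M) = 1"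
      using markov_nn[OF t(1) t' t(3) H] by (simp add: emeasure_space_1)
    then show "(\<integral>\<^sup>+\<omega>. ennreal (cm_weight h (e \<omega>) (X (t + h) \<omega> - X t \<omega>)) \<partial>M) < \<infinity>" by simp
  qed (auto simp: less_imp_le[OF cm_pos])
  assume Z: "Z \<in> borel_measurable (F t)" "\<And>\<omega>. 0 \<le> Z \<omega>" and eR: "\<And>\<omega>. \<bar>e \<omega>\<bar> \<le> R" and R: "R\<^sup>2 \<le> h"
  have H2: "(\<lambda>(\<omega>, w). Z \<omega> * (cm_weight h (e \<omega>) w - 1)\<^sup>2) \<in> borel_measurable (F t \<Otimes>\<^sub>M borel)"
    using e Z by measurable
  have "(\<integral>\<^sup>+w. ennreal (Z \<omega> * (cm_weight h (e \<omega>) w - 1)\<^sup>2) \<partial>normal_law h) \<le> ennreal (2 * Z \<omega>)" for \<omega>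
  proof -
    have "(e \<omega>)\<^sup>2 \<le> R\<^sup>2" using eR[of \<omega>] R_pos by (metis abs_le_square_iff abs_of_pos)
    then have le: "(e \<omega>)\<^sup>2 / h \<le> 1" using R t by simp
    have "exp ((e \<omega>)\<^sup>2 / h) - 1 \<le> 2 * ((e \<omega>)\<^sup>2 / h)"
      using t by (intro exp_minus_one_le le) auto
    also have "\<dots> \<le> 2" using le by simp
    finally have *: "exp ((e \<omega>)\<^sup>2 / h) - 1 \<le> 2" .
    have "(\<integral>\<^sup>+w. ennreal (Z \<omega> * (cm_weight h (e \<omega>) w - 1)\<^sup>2) \<partial>normal_law h) = ennreal (Z \<omega> * (exp ((e \<omega>)\<^sup>2 / h) - 1))"
      using integrable_cm_minus_one_power2[OF t(2), of "e \<omega>"] Z(2)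
      by (subst nn_integral_eq_integral) (auto simp: integral_cm_minus_one_power2[OF t(2)])
    also have "\<dots> \<le> ennreal (2 * Z \<omega>)"
      using mult_left_mono[OF * Z(2)[of \<omega>]] by (intro ennreal_leI) (simp add: mult.commute)
    finally show ?thesis .
  qed
  then show "(\<integral>\<^sup>+\<omega>. ennreal (Z \<omega> * (cm_weight h (e \<omega>) (X (t + h) \<omega> - X t \<omega>) - 1)\<^sup>2) \<partial>M) \<le> (\<integral>\<^sup>+\<omega>. ennreal (2 * Z \<omega>) \<partial>M)"
    using markov_nn[OF t(1) t' t(3) H2] by (simp add: nn_integral_mono)
qed

text \<open>Cameron--Martin: an \<open>F t\<close>-measurable shift of the path after time \<open>t + h\<close> can be
  traded for a weight that depends on the increment over \<open>[t, t + h]\<close> only.\<close>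

lemma girsanov_shift_diff:
  assumes tr: "0 \<le> t" "0 < h" "t + h < r" "r \<le> 1"
    and Z: "Z \<in> borel_measurable (F t)" "\<And>\<omega>. \<bar>Z \<omega>\<bar> \<le> K" and e: "e \<in> borel_measurable (F t)"
  shows "(\<integral>\<omega>. Z \<omega> * shift_diff r (X r \<omega> + e \<omega>) \<omega> \<partial>M) =
         (\<integral>\<omega>. Z \<omega> * cm_weight h (e \<omega>) (X (t + h) \<omega> - X t \<omega>) * shift_diff r (X r \<omega>) \<omega> \<partial>M)"
proof -
  have t': "t < t + h" "0 \<le> t + h" "t + h \<le> 1" "r - (t + h) > 0" and tht: "t + h - t = h" using tr by auto
  have K0: "0 \<le> K" using Z(2)[of undefined] by linarith
  have [measurable]: "Z \<in> borel_measurable M" "e \<in> borel_measurable M"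
    using Z e by (auto intro: borel_measurable_F_M)
  have X: "X t \<in> borel_measurable (F t)"
    by (rule X_meas_F[where m=t]) (use tr in auto)
  have X': "X t \<in> borel_measurable (F (t + h))" "X (t + h) \<in> borel_measurable (F (t + h))"
    by (rule X_meas_F[where m="t+h"]; use tr in auto)+
  have Z': "Z \<in> borel_measurable (F (t + h))" and e': "e \<in> borel_measurable (F (t + h))"
    using borel_measurable_F_mono[OF Z(1), of "t+h"] borel_measurable_F_mono[OF e, of "t+h"] tr by auto
  have intZ: "integrable M Z"
    by (rule integrable_const_bound[of _ K]) (auto intro: Z(2))
  let ?G = "\<lambda>y \<omega>. smoothed (r - (t + h)) r y \<omega>"
  let ?B = "2 * R / sqrt (r - (t + h))"
  have B0: "?B \<ge> 0" using R_pos t' by auto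
  have GB: "\<omega> \<in> space M \<Longrightarrow> \<bar>?G y \<omega>\<bar> \<le> ?B" for y \<omega> by (rule smoothed_le) (use t' in auto)
  have [measurable]: "\<And>a b N w. b \<in> borel_measurable N \<Longrightarrow> w \<in> measurable N M \<Longrightarrow>
    (\<lambda>x. ?G (b x) (w x)) \<in> borel_measurable N" using t' by measurable
  have Gm: "(\<lambda>(\<omega>, w). ?G (X t \<omega> + c \<omega> + w) \<omega>) \<in> borel_measurable (F t \<Otimes>\<^sub>M borel)"
    if "c \<in> borel_measurable (F t)" for c
    unfolding case_prod_beta
    by (rule smoothed_meas_F[where m=t]) (use tr X t' that in measurable)
  have "(\<integral>\<omega>. Z \<omega> * shift_diff r (X r \<omega> + e \<omega>) \<omega> \<partial>M) = (\<integral>\<omega>. Z \<omega> * ?G (X (t + h) \<omega> + e \<omega>) \<omega> \<partial>M)"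
    by (rule markov_shift_diff[OF t'(2) tr(3,4) Z' intZ e'])
  also have "\<dots> = (\<integral>\<omega>. Z \<omega> * ?G (X t \<omega> + e \<omega> + (X (t + h) \<omega> - X t \<omega>)) \<omega> \<partial>M)"
    by (simp add: algebra_simps)
  also have "\<dots> = (\<integral>\<omega>. (\<integral>w. Z \<omega> * ?G (X t \<omega> + e \<omega> + w) \<omega> \<partial>normal_law (t + h - t)) \<partial>M)"
  proof (rule markov[OF tr(1) t'(1,3)])
    show "(\<lambda>(\<omega>, w). Z \<omega> * ?G (X t \<omega> + e \<omega> + w) \<omega>) \<in> borel_measurable (F t \<Otimes>\<^sub>M borel)"
      using Gm[OF e] Z(1) by (simp add: case_prod_beta)
    show "integrable M (\<lambda>\<omega>. Z \<omega> * ?G (X t \<omega> + e \<omega> + (X (t + h) \<omega> - X t \<omega>)) \<omega>)"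
    proof (rule integrable_const_bound[of _ "K * ?B"])
      show "AE \<omega> in M. norm (Z \<omega> * ?G (X t \<omega> + e \<omega> + (X (t + h) \<omega> - X t \<omega>)) \<omega>) \<le> K * ?B"
        unfolding real_norm_def abs_mult by (rule AE_I2, rule mult_mono[OF Z(2) GB]) (use K0 in auto)
    qed measurable
  qed
  \<comment> \<open>The translation of the normal law of the increment, conditionally on \<open>F t\<close>.\<close>
  also have "\<dots> = (\<integral>\<omega>. (\<integral>w. Z \<omega> * cm_weight h (e \<omega>) w * ?G (X t \<omega> + 0 + w) \<omega> \<partial>normal_law (t + h - t)) \<partial>M)"
  proof (rule Bochner_Integration.integral_cong[OF refl])
    fix \<omega> assume [measurable]: "\<omega> \<in> space M"
    have "(\<integral>w. ?G (X t \<omega> + (w + e \<omega>)) \<omega> \<partial>normal_law h) = (\<integral>w. ?G (X t \<omega> + w) \<omega> * cm_weight h (e \<omega>) w \<partial>normal_law h)"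
      by (rule normal_law_translate[OF tr(2)]) measurable
    then show "(\<integral>w. Z \<omega> * ?G (X t \<omega> + e \<omega> + w) \<omega> \<partial>normal_law (t + h - t)) = (\<integral>w. Z \<omega> * cm_weight h (e \<omega>) w * ?G (X t \<omega> + 0 + w) \<omega> \<partial>normal_law (t + h - t))"
      unfolding tht mult.assoc by (simp add: algebra_simps)
  qed
  also have "\<dots> = (\<integral>\<omega>. Z \<omega> * cm_weight h (e \<omega>) (X (t + h) \<omega> - X t \<omega>) * ?G (X t \<omega> + 0 + (X (t + h) \<omega> - X t \<omega>)) \<omega> \<partial>M)"
  proof (rule markov[OF tr(1) t'(1,3), symmetric])
    show "(\<lambda>(\<omega>, w). Z \<omega> * cm_weight h (e \<omega>) w * ?G (X t \<omega> + 0 + w) \<omega>) \<in> borel_measurable (F t \<Otimes>\<^sub>M borel)"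
      using Gm[of "\<lambda>_. 0"] Z(1) e by (simp add: case_prod_beta)
    show "integrable M (\<lambda>\<omega>. Z \<omega> * cm_weight h (e \<omega>) (X (t + h) \<omega> - X t \<omega>) * ?G (X t \<omega> + 0 + (X (t + h) \<omega> - X t \<omega>)) \<omega>)"
    proof (rule Bochner_Integration.integrable_bound[OF integrable_mult_right[OF integrable_cm_weight_increment[OF tr(1,2) t'(3) e], of "K * ?B"]])
      show "AE \<omega> in M. norm (Z \<omega> * cm_weight h (e \<omega>) (X (t + h) \<omega> - X t \<omega>) * ?G (X t \<omega> + 0 + (X (t + h) \<omega> - X t \<omega>)) \<omega>)
          \<le> norm (K * ?B * cm_weight h (e \<omega>) (X (t + h) \<omega> - X t \<omega>))"
      proof (rule AE_I2)
        fix \<omega> assume \<omega>: "\<omega> \<in> space M"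
        define C where "C = cm_weight h (e \<omega>) (X (t + h) \<omega> - X t \<omega>)"
        have "C \<ge> 0" unfolding C_def by (rule less_imp_le[OF cm_pos])
        moreover have "\<bar>Z \<omega>\<bar> * \<bar>?G y \<omega>\<bar> \<le> K * ?B" for y
          by (rule mult_mono[OF Z(2) GB[OF \<omega>]]) (use K0 in auto)
        ultimately have "(\<bar>Z \<omega>\<bar> * \<bar>?G y \<omega>\<bar>) * C \<le> \<bar>K * ?B\<bar> * C" for y
          by (intro mult_right_mono order_trans[OF _ abs_ge_self]) auto
        with \<open>C \<ge> 0\<close> show "norm (Z \<omega> * cm_weight h (e \<omega>) (X (t + h) \<omega> - X t \<omega>) * ?G (X t \<omega> + 0 + (X (t + h) \<omega> - X t \<omega>)) \<omega>)
          \<le> norm (K * ?B * cm_weight h (e \<omega>) (X (t + h) \<omega> - X t \<omega>))"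
          unfolding C_def[symmetric] real_norm_def abs_mult[of _ C] by (simp only: abs_mult abs_of_nonneg mult_ac)
      qed
    qed measurable
  qed
  also have "\<dots> = (\<integral>\<omega>. Z \<omega> * cm_weight h (e \<omega>) (X (t + h) \<omega> - X t \<omega>) * ?G (X (t + h) \<omega> + 0) \<omega> \<partial>M)"
    by (simp add: algebra_simps)
  also have "\<dots> = (\<integral>\<omega>. Z \<omega> * cm_weight h (e \<omega>) (X (t + h) \<omega> - X t \<omega>) * shift_diff r (X r \<omega> + 0) \<omega> \<partial>M)"
  proof (rule markov_shift_diff[OF t'(2) tr(3,4), symmetric])
    show "(\<lambda>\<omega>. Z \<omega> * cm_weight h (e \<omega>) (X (t + h) \<omega> - X t \<omega>)) \<in> borel_measurable (F (t + h))"
      using Z' X' e' by measurable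
    show "integrable M (\<lambda>\<omega>. Z \<omega> * cm_weight h (e \<omega>) (X (t + h) \<omega> - X t \<omega>))"
      by (rule Bochner_Integration.integrable_bound[OF integrable_mult_right[OF integrable_cm_weight_increment[OF tr(1,2) t'(3) e], of "K"]])
         (auto simp: abs_mult less_imp_le[OF cm_pos] K0 intro!: mult_mono Z(2) AE_I2)
  qed auto
  finally show ?thesis by simp
qed

end

section \<open>Integrals over a time interval\<close>

text \<open>Lebesgue measure restricted to \<open>[u, v]\<close>, as a finite measure on all Borel sets of the line, so that no
restricted sigma-algebras appear.\<close>

definition lborel_on :: "real \<Rightarrow> real \<Rightarrow> real measure" where
  "lborel_on u v = density lborel (\<lambda>t. ennreal (indicator {u..v} t))"

lemma sets_lborel_on [measurable_cong, simp]: "sets (lborel_on u v) = sets borel"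
  by (simp add: lborel_on_def)

lemma space_lborel_on [simp]: "space (lborel_on u v) = UNIV"
  by (simp add: lborel_on_def)

lemma emeasure_lborel_on: "A \<in> sets borel \<Longrightarrow> emeasure (lborel_on u v) A = emeasure lborel (A \<inter> {u..v})"
  unfolding lborel_on_def
  by (subst emeasure_density) (auto simp: ennreal_indicator nn_integral_indicator[symmetric] indicator_inter_arith intro!: nn_integral_cong simp: mult.commute simp del: nn_integral_indicator)

lemma finite_measure_lborel_on: "finite_measure (lborel_on u v)"
  by (rule finite_measureI) (simp add: emeasure_lborel_on emeasure_lborel_Icc_eq)

lemma measure_lborel_on_UNIV: "u \<le> v \<Longrightarrow> measure (lborel_on u v) UNIV = v - u"
  by (simp add: measure_def emeasure_lborel_on emeasure_lborel_Icc_eq)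

lemma AE_lborel_on: "AE t in lborel_on u v. u < t \<and> t < v"
proof -
  have "AE t in lborel. t \<noteq> u" "AE t in lborel. t \<noteq> v"
    by (rule AE_lborel_singleton)+
  then have "AE t in lborel. t \<in> {u..v} \<longrightarrow> u < t \<and> t < v"
    by eventually_elim auto
  then show ?thesis
    unfolding lborel_on_def by (subst AE_density) (auto simp: indicator_def)
qed

lemma measure_lborel_on_Icc_le: "c \<le> d \<Longrightarrow> measure (lborel_on u v) {c..d} \<le> d - c"
proof -
  assume "c \<le> d"
  have "emeasure (lborel_on u v) {c..d} \<le> emeasure lborel {c..d}"
    by (simp add: emeasure_lborel_on) (rule emeasure_mono, auto)
  also have "\<dots> = ennreal (d - c)" using \<open>c \<le> d\<close> by simp
  finally show ?thesis
    using \<open>c \<le> d\<close> unfolding measure_def by (intro enn2real_leI) auto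
qed

text \<open>The singularity of the error term in \<open>far_pair_bound\<close> is integrable; the indicator excludes the times
where the square root of a negative number would be taken.\<close>

lemma lborel_on_inv_sqrt:
  assumes "u \<le> t" "t \<le> v"
  shows integrable_lborel_on_inv_sqrt: "integrable (lborel_on u v) (\<lambda>r. indicator {t<..} r / sqrt (r - t))"
    and integral_lborel_on_inv_sqrt: "(\<integral>r. indicator {t<..} r / sqrt (r - t) \<partial>lborel_on u v) \<le> 2 * sqrt (v - u)"
proof -
  have "((\<lambda>r. 1 / sqrt (r - t)) has_integral (2 * sqrt (v - t) - 2 * sqrt (t - t))) {t..v}"
  proof (rule fundamental_theorem_of_calculus_interior[OF assms(2)])
    show "continuous_on {t..v} (\<lambda>r. 2 * sqrt (r - t))"
      by (intro continuous_intros)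
    fix r assume r: "r \<in> {t<..<v}"
    have "((\<lambda>r. 2 * sqrt (r - t)) has_real_derivative 1 / sqrt (r - t)) (at r)"
      using r by (auto intro!: derivative_eq_intros simp: field_simps)
    then show "((\<lambda>r. 2 * sqrt (r - t)) has_vector_derivative 1 / sqrt (r - t)) (at r)"
      by (simp add: has_real_derivative_iff_has_vector_derivative)
  qed
  then have "((\<lambda>r. 1 / sqrt (r - t)) has_integral (2 * sqrt (v - t))) {t..v}" by simp
  then have I: "((\<lambda>r. indicator {t<..} r / sqrt (r - t)) has_integral (2 * sqrt (v - t))) {t..v}"
    by (rule has_integral_spike_finite[of "{t}", rotated 2]) auto
  have "((\<lambda>r. indicator {t..v} r * (indicator {t<..} r / sqrt (r - t))) has_integral (2 * sqrt (v - t))) UNIV"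
    using I by (subst (asm) has_integral_restrict_UNIV[symmetric])
      (erule has_integral_eq[rotated], simp add: indicator_def)
  then have "(\<integral>\<^sup>+ r. ennreal (indicator {t..v} r * (indicator {t<..} r / sqrt (r - t))) \<partial>lborel) = ennreal (2 * sqrt (v - t))"
    by (intro nn_integral_has_integral_lborel) (auto simp: indicator_def)
  moreover have "(\<integral>\<^sup>+ r. ennreal (indicator {t<..} r / sqrt (r - t)) \<partial>lborel_on u v) =
      (\<integral>\<^sup>+ r. ennreal (indicator {t..v} r * (indicator {t<..} r / sqrt (r - t))) \<partial>lborel)"
    unfolding lborel_on_def using assms
    by (subst nn_integral_density) (auto simp: ennreal_mult'[symmetric] indicator_def intro!: nn_integral_cong)
  ultimately have eq: "(\<integral>\<^sup>+ r. ennreal (indicator {t<..} r / sqrt (r - t)) \<partial>lborel_on u v) = ennreal (2 * sqrt (v - t))"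
    by simp
  show i: "integrable (lborel_on u v) (\<lambda>r. indicator {t<..} r / sqrt (r - t))"
  proof (rule integrableI_nonneg)
    show "(\<integral>\<^sup>+ r. ennreal (indicator {t<..} r / sqrt (r - t)) \<partial>lborel_on u v) < \<infinity>"
      unfolding eq by simp
  qed (auto simp: indicator_def)
  have "(\<integral>r. indicator {t<..} r / sqrt (r - t) \<partial>lborel_on u v) = 2 * sqrt (v - t)"
  proof (subst integral_eq_nn_integral)
    show "enn2real (\<integral>\<^sup>+ r. ennreal (indicator {t<..} r / sqrt (r - t)) \<partial>lborel_on u v) = 2 * sqrt (v - t)"
      unfolding eq using assms by simp
  qed (auto simp: indicator_def)
  then show "(\<integral>r. indicator {t<..} r / sqrt (r - t) \<partial>lborel_on u v) \<le> 2 * sqrt (v - u)"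
    using assms by simp
qed

text \<open>The expectation of a product of two time integrals, for integrands that are bounded in square mean
but need not be bounded.\<close>

lemma (in prob_space) fubini_product:
  fixes a b :: "real \<Rightarrow> 'a \<Rightarrow> real"
  assumes U: "finite_measure U" and [measurable_cong]: "sets U = sets borel"
    and [measurable]: "(\<lambda>(t, \<omega>). a t \<omega>) \<in> borel_measurable (borel \<Otimes>\<^sub>M M)"
      "(\<lambda>(t, \<omega>). b t \<omega>) \<in> borel_measurable (borel \<Otimes>\<^sub>M M)"
      "Y \<in> borel_measurable M"
    and Y: "\<And>\<omega>. \<bar>Y \<omega>\<bar> \<le> K" and B0: "0 \<le> B"
    and a: "\<And>t. (\<integral>\<^sup>+\<omega>. ennreal ((a t \<omega>)\<^sup>2) \<partial>M) \<le> ennreal B"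
    and b: "\<And>t. (\<integral>\<^sup>+\<omega>. ennreal ((b t \<omega>)\<^sup>2) \<partial>M) \<le> ennreal B"
  shows "integrable M (\<lambda>\<omega>. Y \<omega> * ((\<integral>t. a t \<omega> \<partial>U) * (\<integral>t. b t \<omega> \<partial>U)))" (is ?int)
    and "(\<integral>\<omega>. Y \<omega> * ((\<integral>t. a t \<omega> \<partial>U) * (\<integral>t. b t \<omega> \<partial>U)) \<partial>M) = (\<integral>t. (\<integral>r. (\<integral>\<omega>. Y \<omega> * a t \<omega> * b r \<omega> \<partial>M) \<partial>U) \<partial>U)" (is ?eq)
proof -
  interpret U: finite_measure U by (rule U)
  interpret UU: pair_sigma_finite U U ..
  interpret MU: pair_sigma_finite M U ..
  interpret M3: pair_sigma_finite M "U \<Otimes>\<^sub>M U" ..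
  have K0: "0 \<le> K" using Y[of undefined] by linarith
  let ?P = "\<lambda>(\<omega>, t, r). Y \<omega> * a t \<omega> * b r \<omega>"
  have PM[measurable]: "?P \<in> borel_measurable (M \<Otimes>\<^sub>M (U \<Otimes>\<^sub>M U))" by measurable
  have P: "integrable (M \<Otimes>\<^sub>M (U \<Otimes>\<^sub>M U)) ?P"
  proof (rule integrableI_bounded)
    have "(\<integral>\<^sup>+x. ennreal (norm (?P x)) \<partial>(M \<Otimes>\<^sub>M (U \<Otimes>\<^sub>M U))) =
        (\<integral>\<^sup>+y. (\<integral>\<^sup>+\<omega>. ennreal (norm (?P (\<omega>, y))) \<partial>M) \<partial>(U \<Otimes>\<^sub>M U))"
      by (rule M3.nn_integral_snd[symmetric]) measurable
    also have "\<dots> \<le> (\<integral>\<^sup>+y. ennreal (K * (B + B)) \<partial>(U \<Otimes>\<^sub>M U))"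
    proof (rule nn_integral_mono)
      fix y :: "real \<times> real"
      obtain t r where y: "y = (t, r)" by force
      have "(\<integral>\<^sup>+\<omega>. ennreal (norm (?P (\<omega>, y))) \<partial>M) \<le> (\<integral>\<^sup>+\<omega>. ennreal K * (ennreal ((a t \<omega>)\<^sup>2) + ennreal ((b r \<omega>)\<^sup>2)) \<partial>M)"
      proof (rule nn_integral_mono)
        fix \<omega>
        have "\<bar>a t \<omega>\<bar> * \<bar>b r \<omega>\<bar> \<le> (a t \<omega>)\<^sup>2 + (b r \<omega>)\<^sup>2"
          using sum_squares_bound[of "\<bar>a t \<omega>\<bar>" "\<bar>b r \<omega>\<bar>"] mult_nonneg_nonneg[OF abs_ge_zero abs_ge_zero, of "a t \<omega>" "b r \<omega>"]
          unfolding power2_abs by linarith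
        then have "\<bar>Y \<omega>\<bar> * (\<bar>a t \<omega>\<bar> * \<bar>b r \<omega>\<bar>) \<le> K * ((a t \<omega>)\<^sup>2 + (b r \<omega>)\<^sup>2)"
          by (intro mult_mono Y) (use K0 in auto)
        then show "ennreal (norm (?P (\<omega>, y))) \<le> ennreal K * (ennreal ((a t \<omega>)\<^sup>2) + ennreal ((b r \<omega>)\<^sup>2))"
          using K0 by (simp add: y abs_mult mult.assoc ennreal_mult[symmetric] ennreal_plus[symmetric] del: ennreal_plus)
      qed
      also have "\<dots> = ennreal K * ((\<integral>\<^sup>+\<omega>. ennreal ((a t \<omega>)\<^sup>2) \<partial>M) + (\<integral>\<^sup>+\<omega>. ennreal ((b r \<omega>)\<^sup>2) \<partial>M))"
        by (simp add: nn_integral_cmult nn_integral_add)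
      also have "\<dots> \<le> ennreal K * (ennreal B + ennreal B)"
        by (intro mult_left_mono add_mono a b) auto
      also have "\<dots> \<le> ennreal (K * (B + B))"
        using K0 B0 by (simp add: ennreal_mult[symmetric] ennreal_plus[symmetric] del: ennreal_plus)
      finally show "(\<integral>\<^sup>+\<omega>. ennreal (norm (?P (\<omega>, y))) \<partial>M) \<le> ennreal (K * (B + B))" .
    qed
    also have "\<dots> < \<infinity>"
      by (simp add: UU.emeasure_pair_measure_Times[symmetric] space_pair_measure U.emeasure_pair_measure_Times
          ennreal_mult_less_top U.emeasure_eq_measure)
    finally show "(\<integral>\<^sup>+x. ennreal (norm (?P x)) \<partial>(M \<Otimes>\<^sub>M (U \<Otimes>\<^sub>M U))) < \<infinity>" .
  qed (rule PM)
  have P': "integrable (M \<Otimes>\<^sub>M (U \<Otimes>\<^sub>M U)) (\<lambda>(\<omega>, y). ?P (\<omega>, y))"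
    by (rule P[THEN back_subst[of "integrable _"]]) (auto simp: fun_eq_iff)
  have intU: "AE \<omega> in M. integrable U (\<lambda>t. c t \<omega>)"
    if [measurable]: "(\<lambda>(t, \<omega>). c t \<omega>) \<in> borel_measurable (borel \<Otimes>\<^sub>M M)"
      and c: "\<And>t. (\<integral>\<^sup>+\<omega>. ennreal ((c t \<omega>)\<^sup>2) \<partial>M) \<le> ennreal B" for c :: "real \<Rightarrow> 'a \<Rightarrow> real"
  proof -
    have "integrable (M \<Otimes>\<^sub>M U) (\<lambda>(\<omega>, t). c t \<omega>)"
    proof (rule integrableI_bounded)
      have "(\<integral>\<^sup>+x. ennreal (norm (case x of (\<omega>, t) \<Rightarrow> c t \<omega>)) \<partial>(M \<Otimes>\<^sub>M U)) = (\<integral>\<^sup>+t. (\<integral>\<^sup>+\<omega>. ennreal \<bar>c t \<omega>\<bar> \<partial>M) \<partial>U)"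
        by (subst MU.nn_integral_snd[symmetric]) auto
      also have "\<dots> \<le> (\<integral>\<^sup>+t. 1 + ennreal B \<partial>U)"
      proof (rule nn_integral_mono)
        fix t
        have "(\<integral>\<^sup>+\<omega>. ennreal \<bar>c t \<omega>\<bar> \<partial>M) \<le> (\<integral>\<^sup>+\<omega>. 1 + ennreal ((c t \<omega>)\<^sup>2) \<partial>M)"
        proof (rule nn_integral_mono)
          fix \<omega>
          have "\<bar>c t \<omega>\<bar> \<le> 1 + (c t \<omega>)\<^sup>2"
            using sum_squares_bound[of 1 "\<bar>c t \<omega>\<bar>"] by (simp add: power2_eq_square)
          then have "ennreal \<bar>c t \<omega>\<bar> \<le> ennreal (1 + (c t \<omega>)\<^sup>2)" by (rule ennreal_leI)
          then show "ennreal \<bar>c t \<omega>\<bar> \<le> 1 + ennreal ((c t \<omega>)\<^sup>2)" by simp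
        qed
        also have "\<dots> \<le> 1 + ennreal B"
          by (subst nn_integral_add) (auto intro!: add_mono c simp: emeasure_space_1)
        finally show "(\<integral>\<^sup>+\<omega>. ennreal \<bar>c t \<omega>\<bar> \<partial>M) \<le> 1 + ennreal B" .
      qed
      also have "\<dots> < \<infinity>"
        by (simp add: ennreal_mult_less_top U.emeasure_eq_measure)
      finally show "(\<integral>\<^sup>+x. ennreal (norm (case x of (\<omega>, t) \<Rightarrow> c t \<omega>)) \<partial>(M \<Otimes>\<^sub>M U)) < \<infinity>" .
    qed measurable
    from MU.AE_integrable_fst'[OF this] show ?thesis by simp
  qed
  have ae: "AE \<omega> in M. (\<integral>y. ?P (\<omega>, y) \<partial>(U \<Otimes>\<^sub>M U)) = Y \<omega> * ((\<integral>t. a t \<omega> \<partial>U) * (\<integral>t. b t \<omega> \<partial>U))"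
    using intU[OF assms(3) a] intU[OF assms(4) b] AE_space
  proof eventually_elim
    case (elim \<omega>)
    from elim(3) have [measurable]: "(\<lambda>t. a t \<omega>) \<in> borel_measurable borel" "(\<lambda>t. b t \<omega>) \<in> borel_measurable borel"
      by measurable
    have i: "integrable (U \<Otimes>\<^sub>M U) (\<lambda>(t, r). a t \<omega> * b r \<omega>)"
    proof (rule UU.Fubini_integrable)
      show "(\<lambda>(t, r). a t \<omega> * b r \<omega>) \<in> borel_measurable (U \<Otimes>\<^sub>M U)" by measurable
      show "integrable U (\<lambda>t. \<integral>r. norm (case (t, r) of (t, r) \<Rightarrow> a t \<omega> * b r \<omega>) \<partial>U)"
        using elim(1,2) by (simp add: abs_mult)
      show "AE t in U. integrable U (\<lambda>r. case (t, r) of (t, r) \<Rightarrow> a t \<omega> * b r \<omega>)"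
        using elim(1,2) by simp
    qed
    have "(\<integral>y. ?P (\<omega>, y) \<partial>(U \<Otimes>\<^sub>M U)) = Y \<omega> * (\<integral>y. (case y of (t, r) \<Rightarrow> a t \<omega> * b r \<omega>) \<partial>(U \<Otimes>\<^sub>M U))"
      by (subst integral_mult_right_zero[symmetric]) (simp add: case_prod_beta mult.assoc)
    also have "(\<integral>y. (case y of (t, r) \<Rightarrow> a t \<omega> * b r \<omega>) \<partial>(U \<Otimes>\<^sub>M U)) = (\<integral>t. (\<integral>r. a t \<omega> * b r \<omega> \<partial>U) \<partial>U)"
      by (rule UU.integral_fst[OF i, symmetric])
    finally show ?case using elim(1,2) by simp
  qed
  have "integrable M (\<lambda>\<omega>. \<integral>y. ?P (\<omega>, y) \<partial>(U \<Otimes>\<^sub>M U))"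
    by (rule M3.integrable_fst'[OF P])
  then show ?int
    by (subst integrable_cong_AE[OF _ _ ae, symmetric]) auto
  have "(\<integral>\<omega>. Y \<omega> * ((\<integral>t. a t \<omega> \<partial>U) * (\<integral>t. b t \<omega> \<partial>U)) \<partial>M) = (\<integral>\<omega>. (\<integral>y. ?P (\<omega>, y) \<partial>(U \<Otimes>\<^sub>M U)) \<partial>M)"
    by (rule integral_cong_AE[symmetric, OF _ _ ae]) auto
  also have "\<dots> = (\<integral>y. (\<integral>\<omega>. ?P (\<omega>, y) \<partial>M) \<partial>(U \<Otimes>\<^sub>M U))"
    by (rule M3.Fubini_integral[OF P', symmetric])
  also have "\<dots> = (\<integral>t. (\<integral>r. (\<integral>\<omega>. ?P (\<omega>, t, r) \<partial>M) \<partial>U) \<partial>U)"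
    by (rule UU.integral_fst'[symmetric]) (rule M3.integrable_snd[OF P'])
  finally show ?eq by simp
qed

context brownian_shift
begin

text \<open>The integrand \<open>\<phi> t\<close> along the path and its parts: \<open>path_diff\<close> is \<open>\<phi>\<close>, \<open>shifted_val\<close> is the value of \<open>g\<close>
at the shifted path, \<open>tilt h t\<close> is the centered Cameron--Martin weight \<open>L t\<close> of the shift \<open>f t\<close> over
\<open>[t, t + h]\<close>, and \<open>shift_effect u v\<close> is the integral \<open>A u v\<close>.\<close>

definition path_diff :: "real \<Rightarrow> 'a \<Rightarrow> real" where
  "path_diff t \<omega> = shift_diff t (X t \<omega>) \<omega>"

definition shifted_val :: "real \<Rightarrow> 'a \<Rightarrow> real" where
  "shifted_val t \<omega> = g t (X t \<omega> + f t \<omega>) \<omega>"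

definition tilt :: "real \<Rightarrow> real \<Rightarrow> 'a \<Rightarrow> real" where
  "tilt h t \<omega> = cm_weight h (f t \<omega>) (X (t + h) \<omega> - X t \<omega>) - 1"

definition shift_effect :: "real \<Rightarrow> real \<Rightarrow> 'a \<Rightarrow> real" where
  "shift_effect u v \<omega> = (\<integral>t. path_diff t \<omega> \<partial>lborel_on u v)"

lemma path_diff_meas_M [measurable (raw)]:
  assumes [measurable]: "a \<in> borel_measurable N" "w \<in> measurable N M"
  shows "(\<lambda>x. path_diff (a x) (w x)) \<in> borel_measurable N"
  unfolding path_diff_def by measurable

lemma shifted_val_meas_M [measurable (raw)]:
  assumes [measurable]: "a \<in> borel_measurable N" "w \<in> measurable N M"
  shows "(\<lambda>x. shifted_val (a x) (w x)) \<in> borel_measurable N"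
  unfolding shifted_val_def by measurable

lemma tilt_meas_M [measurable (raw)]:
  assumes [measurable]: "a \<in> borel_measurable N" "w \<in> measurable N M"
  shows "(\<lambda>x. tilt h (a x) (w x)) \<in> borel_measurable N"
  unfolding tilt_def by measurable

lemma X_adapted: "0 \<le> t \<Longrightarrow> t \<le> m \<Longrightarrow> m \<le> 1 \<Longrightarrow> X t \<in> borel_measurable (F m)"
  by (rule X_meas_F[where m=m]) auto

lemma f_adapted: "0 \<le> m \<Longrightarrow> f t \<in> borel_measurable (F m)"
  by (rule f_meas_F[where m=m]) auto

lemma path_diff_adapted: "0 \<le> t \<Longrightarrow> t \<le> m \<Longrightarrow> m \<le> 1 \<Longrightarrow> path_diff t \<in> borel_measurable (F m)"
  unfolding path_diff_def by (rule shift_diff_meas_F[where m=m]) (auto intro: X_adapted)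

lemma shifted_val_adapted: "0 \<le> t \<Longrightarrow> t \<le> m \<Longrightarrow> m \<le> 1 \<Longrightarrow> shifted_val t \<in> borel_measurable (F m)"
  unfolding shifted_val_def by (rule g_meas_F[where m=m]) (auto intro!: X_adapted f_adapted borel_measurable_add)

lemma tilt_adapted: "0 \<le> t \<Longrightarrow> 0 < h \<Longrightarrow> t + h \<le> m \<Longrightarrow> m \<le> 1 \<Longrightarrow> tilt h t \<in> borel_measurable (F m)"
  unfolding tilt_def by (intro borel_measurable_diff cm_measurable) (auto intro!: X_adapted f_adapted)

lemma path_diff_le: "\<bar>path_diff t \<omega>\<bar> \<le> 2"
  unfolding path_diff_def by (rule shift_diff_le)

lemma shifted_val_le: "\<bar>shifted_val t \<omega>\<bar> \<le> 1"
  unfolding shifted_val_def by (rule g_le)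

lemma shift_effect_meas [measurable]: "shift_effect u v \<in> borel_measurable M"
proof -
  interpret finite_measure "lborel_on u v" by (rule finite_measure_lborel_on)
  show ?thesis unfolding shift_effect_def by measurable
qed

lemma shift_effect_adapted:
  assumes "0 \<le> u" "u \<le> v" "v \<le> 1"
  shows "shift_effect u v \<in> borel_measurable (F v)"
proof -
  interpret finite_measure "lborel_on u v" by (rule finite_measure_lborel_on)
  have "(\<lambda>(\<omega>, t). X (min t v) \<omega>) \<in> borel_measurable (F v \<Otimes>\<^sub>M borel)"
    unfolding case_prod_beta by (rule X_meas_F[where m=v]) (use assms in auto)
  then have X': "(\<lambda>x. X (min (snd x) v) (fst x)) \<in> borel_measurable (F v \<Otimes>\<^sub>M borel)"
    by (simp add: case_prod_beta)
  have "(\<lambda>(\<omega>, t). shift_diff t (X (min t v) \<omega>) \<omega>) \<in> borel_measurable (F v \<Otimes>\<^sub>M borel)"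
    unfolding case_prod_beta by (rule shift_diff_meas_F[where m=v]) (use assms X' in auto)
  then have [measurable]: "(\<lambda>(\<omega>, t). shift_diff t (X (min t v) \<omega>) \<omega>) \<in> borel_measurable (F v \<Otimes>\<^sub>M lborel_on u v)"
    by measurable
  have "(\<lambda>\<omega>. \<integral>t. shift_diff t (X (min t v) \<omega>) \<omega> \<partial>lborel_on u v) \<in> borel_measurable (F v)"
    by measurable
  also have "?this \<longleftrightarrow> ?thesis"
  proof (rule measurable_cong)
    fix \<omega> assume "\<omega> \<in> space (F v)"
    then have [measurable]: "\<omega> \<in> space M" by (simp add: space_F)
    show "(\<integral>t. shift_diff t (X (min t v) \<omega>) \<omega> \<partial>lborel_on u v) = shift_effect u v \<omega>"
      unfolding shift_effect_def path_diff_def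
    proof (rule integral_cong_AE)
      show "AE t in lborel_on u v. shift_diff t (X (min t v) \<omega>) \<omega> = shift_diff t (X t \<omega>) \<omega>"
        using AE_lborel_on by eventually_elim (simp add: min_absorb1)
    qed measurable
  qed
  finally show ?thesis .
qed

lemma integrable_path_diff: "\<omega> \<in> space M \<Longrightarrow> integrable (lborel_on u v) (\<lambda>t. path_diff t \<omega>)"
proof -
  assume [measurable]: "\<omega> \<in> space M"
  interpret finite_measure "lborel_on u v" by (rule finite_measure_lborel_on)
  show ?thesis
    by (rule integrable_const_bound[of _ 2]) (auto simp: path_diff_le)
qed

lemma shift_effect_le:
  assumes "u \<le> v" "\<omega> \<in> space M"
  shows "\<bar>shift_effect u v \<omega>\<bar> \<le> 2 * (v - u)"
proof -
  interpret finite_measure "lborel_on u v" by (rule finite_measure_lborel_on)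
  have "\<bar>shift_effect u v \<omega>\<bar> \<le> (\<integral>t. \<bar>path_diff t \<omega>\<bar> \<partial>lborel_on u v)"
    unfolding shift_effect_def by (rule integral_abs_bound)
  also have "\<dots> \<le> (\<integral>t. 2 \<partial>lborel_on u v)"
    by (rule integral_mono) (use integrable_path_diff[OF assms(2)] in \<open>auto simp: path_diff_le\<close>)
  also have "\<dots> = 2 * (v - u)"
    using assms by (simp add: measure_lborel_on_UNIV)
  finally show ?thesis .
qed

end

context brownian_shift
begin

text \<open>Apart from the term with the weight, the correlation of \<open>\<phi> t\<close> and \<open>\<phi> r\<close> is the expected change, under the
shift by \<open>f t\<close> at time \<open>t\<close>, of \<open>\<Psi> y = g t y * smoothed (r - t) r y\<close>. The function \<open>\<Psi>\<close> is of size
\<open>R / sqrt (r - t)\<close>, and moving the shift to the law of \<open>X t - X u\<close> gains \<open>R / sqrt (t - u)\<close>.\<close>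

lemma far_pair_bound:
  assumes tr: "0 \<le> u" "u < t" "0 < h" "t + h < r" "r \<le> 1"
    and Y: "Y \<in> borel_measurable (F u)" "\<And>\<omega>. 0 \<le> Y \<omega>" "\<And>\<omega>. Y \<omega> \<le> K"
  shows "\<bar>(\<integral>\<omega>. Y \<omega> * path_diff t \<omega> * path_diff r \<omega> \<partial>M) + (\<integral>\<omega>. Y \<omega> * (shifted_val t \<omega> * tilt h t \<omega>) * path_diff r \<omega> \<partial>M)\<bar>
     \<le> 4 * R\<^sup>2 * (1 / sqrt (t - u)) * (1 / sqrt (r - t)) * (\<integral>\<omega>. Y \<omega> \<partial>M)"
proof -
  have K0: "0 \<le> K" using Y(2,3)[of undefined] by linarith
  have YK: "\<bar>Y \<omega>\<bar> \<le> K" for \<omega> using Y(2,3)[of \<omega>] by auto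
  have t': "0 \<le> t" "t < r" "t \<le> 1" "t + h \<le> 1" "r - t > 0" "t - u > 0" using tr by auto
  have Yt: "Y \<in> borel_measurable (F t)"
    by (rule borel_measurable_F_mono[OF Y(1)]) (use tr in auto)
  have [measurable]: "Y \<in> borel_measurable M" by (rule borel_measurable_F_M[OF Y(1)])
  have Xt: "X t \<in> borel_measurable (F t)" by (rule X_adapted) (use t' in auto)
  have Xu: "X u \<in> borel_measurable (F u)" by (rule X_adapted) (use tr in auto)
  have ft: "f t \<in> borel_measurable (F t)" "f t \<in> borel_measurable (F u)" by (rule f_adapted; use tr in simp)+
  define Z1 where "Z1 \<omega> = Y \<omega> * shifted_val t \<omega>" for \<omega>
  define Z2 where "Z2 \<omega> = Y \<omega> * g t (X t \<omega>) \<omega>" for \<omega>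
  have Z1F: "Z1 \<in> borel_measurable (F t)"
    unfolding Z1_def using Yt shifted_val_adapted[of t t] t' by measurable
  have "(\<lambda>\<omega>. g t (X t \<omega>) \<omega>) \<in> borel_measurable (F t)"
    by (rule g_meas_F[where m=t]) (use Xt t' in auto)
  then have Z2F: "Z2 \<in> borel_measurable (F t)"
    unfolding Z2_def using Yt by measurable
  have Z1K: "\<bar>Z1 \<omega>\<bar> \<le> K" for \<omega>
    unfolding Z1_def abs_mult using mult_mono[OF YK[of \<omega>] shifted_val_le[of t \<omega>]] K0 by simp
  have Z2K: "\<bar>Z2 \<omega>\<bar> \<le> K" for \<omega>
    unfolding Z2_def abs_mult using mult_mono[OF YK[of \<omega>] g_le[of t "X t \<omega>" \<omega>]] K0 by simp
  have [measurable]: "Z1 \<in> borel_measurable M" "Z2 \<in> borel_measurable M"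
    unfolding Z1_def Z2_def by measurable
  have iZ: "integrable M Z1" "integrable M Z2"
    by (rule integrable_const_bound[of _ K]; use Z1K Z2K in simp)+
  have iZph: "integrable M (\<lambda>\<omega>. Z1 \<omega> * path_diff r \<omega>)" "integrable M (\<lambda>\<omega>. Z2 \<omega> * path_diff r \<omega>)"
    by (rule integrable_const_bound[of _ "K * 2"];
        use Z1K Z2K path_diff_le K0 in \<open>auto simp: abs_mult intro!: mult_mono\<close>)+
  let ?C = "\<lambda>\<omega>. cm_weight h (f t \<omega>) (X (t + h) \<omega> - X t \<omega>)"
  have iC: "integrable M (\<lambda>\<omega>. Z1 \<omega> * ?C \<omega> * path_diff r \<omega>)"
  proof (rule Bochner_Integration.integrable_bound[OF integrable_mult_right[OF integrable_cm_weight_increment[OF t'(1) tr(3) t'(4) ft(1)], of "K * 2"]])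
    show "AE \<omega> in M. norm (Z1 \<omega> * ?C \<omega> * path_diff r \<omega>) \<le> norm (K * 2 * ?C \<omega>)"
    proof (rule AE_I2)
      fix \<omega>
      have "\<bar>Z1 \<omega>\<bar> * \<bar>path_diff r \<omega>\<bar> \<le> K * 2"
        by (rule mult_mono[OF Z1K path_diff_le]) (use K0 in auto)
      then have "(\<bar>Z1 \<omega>\<bar> * \<bar>path_diff r \<omega>\<bar>) * ?C \<omega> \<le> (K * 2) * ?C \<omega>"
        by (rule mult_right_mono) (rule less_imp_le[OF cm_pos])
      then show "norm (Z1 \<omega> * ?C \<omega> * path_diff r \<omega>) \<le> norm (K * 2 * ?C \<omega>)"
        using K0 less_imp_le[OF cm_pos, of h "f t \<omega>" "X (t + h) \<omega> - X t \<omega>"] by (simp add: abs_mult mult_ac)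
    qed
  qed measurable
  define \<Psi> where "\<Psi> y \<omega> = g t y \<omega> * smoothed (r - t) r y \<omega>" for y \<omega>
  have \<Psi>M[measurable (raw)]: "(\<lambda>x. \<Psi> (b x) (w x)) \<in> borel_measurable N"
    if "b \<in> borel_measurable N" "w \<in> measurable N M" for b w and N :: "'b measure"
    unfolding \<Psi>_def using that t' by measurable
  have \<Psi>_F: "(\<lambda>x. \<Psi> (b x) (w x)) \<in> borel_measurable N"
    if "b \<in> borel_measurable N" "w \<in> measurable N (F u)" for b w and N :: "'c measure"
    unfolding \<Psi>_def
    by (intro borel_measurable_times g_meas_F[where m=u] smoothed_meas_F[where m=u]) (use that tr in auto)
  let ?B = "2 * R / sqrt (r - t)"
  have B0: "?B \<ge> 0" using R_pos t' by simp
  have \<Psi>_le: "\<bar>\<Psi> y \<omega>\<bar> \<le> ?B" if "\<omega> \<in> space M" for y \<omega>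
    unfolding \<Psi>_def abs_mult using mult_mono[OF g_le[of t y \<omega>] smoothed_le[OF t'(5) that, of r y]] B0 by simp
  let ?H = "\<lambda>\<omega> w. Y \<omega> * (\<Psi> (X u \<omega> + w + f t \<omega>) \<omega> - \<Psi> (X u \<omega> + w) \<omega>)"
  have i3: "integrable M (\<lambda>\<omega>. Y \<omega> * \<Psi> (X t \<omega> + f t \<omega>) \<omega>)" "integrable M (\<lambda>\<omega>. Y \<omega> * \<Psi> (X t \<omega>) \<omega>)"
    by (rule integrable_const_bound[of _ "K * ?B"]; 
      (rule AE_I2, unfold real_norm_def abs_mult, rule mult_mono[OF YK \<Psi>_le])?; use K0 in simp)+
  have "(\<integral>\<omega>. Y \<omega> * path_diff t \<omega> * path_diff r \<omega> \<partial>M) + (\<integral>\<omega>. Y \<omega> * (shifted_val t \<omega> * tilt h t \<omega>) * path_diff r \<omega> \<partial>M)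
      = (\<integral>\<omega>. Z1 \<omega> * path_diff r \<omega> - Z2 \<omega> * path_diff r \<omega> \<partial>M) + (\<integral>\<omega>. Z1 \<omega> * ?C \<omega> * path_diff r \<omega> - Z1 \<omega> * path_diff r \<omega> \<partial>M)"
    by (intro arg_cong2[where f="(+)"] Bochner_Integration.integral_cong)
       (auto simp: Z1_def Z2_def tilt_def shifted_val_def path_diff_def[of t] shift_diff_def algebra_simps)
  also have "\<dots> = (\<integral>\<omega>. Z1 \<omega> * ?C \<omega> * path_diff r \<omega> \<partial>M) - (\<integral>\<omega>. Z2 \<omega> * path_diff r \<omega> \<partial>M)"
    using iZph iC by simp
  also have "(\<integral>\<omega>. Z1 \<omega> * ?C \<omega> * path_diff r \<omega> \<partial>M) = (\<integral>\<omega>. Z1 \<omega> * shift_diff r (X r \<omega> + f t \<omega>) \<omega> \<partial>M)"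
    unfolding path_diff_def by (rule girsanov_shift_diff[OF t'(1) tr(3-5) Z1F Z1K ft(1), symmetric])
  also have "\<dots> = (\<integral>\<omega>. Z1 \<omega> * smoothed (r - t) r (X t \<omega> + f t \<omega>) \<omega> \<partial>M)"
    by (rule markov_shift_diff[OF t'(1,2) tr(5) Z1F iZ(1) ft(1)])
  also have "(\<integral>\<omega>. Z2 \<omega> * path_diff r \<omega> \<partial>M) = (\<integral>\<omega>. Z2 \<omega> * shift_diff r (X r \<omega> + 0) \<omega> \<partial>M)"
    by (simp add: path_diff_def)
  also have "\<dots> = (\<integral>\<omega>. Z2 \<omega> * smoothed (r - t) r (X t \<omega> + 0) \<omega> \<partial>M)"
    by (rule markov_shift_diff[OF t'(1,2) tr(5) Z2F iZ(2)]) simp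
  also have "(\<integral>\<omega>. Z1 \<omega> * smoothed (r - t) r (X t \<omega> + f t \<omega>) \<omega> \<partial>M) - (\<integral>\<omega>. Z2 \<omega> * smoothed (r - t) r (X t \<omega> + 0) \<omega> \<partial>M)
     = (\<integral>\<omega>. Y \<omega> * \<Psi> (X t \<omega> + f t \<omega>) \<omega> \<partial>M) - (\<integral>\<omega>. Y \<omega> * \<Psi> (X t \<omega>) \<omega> \<partial>M)"
    by (simp add: \<Psi>_def Z1_def Z2_def shifted_val_def mult.assoc)
  also have "\<dots> = (\<integral>\<omega>. ?H \<omega> (X t \<omega> - X u \<omega>) \<partial>M)"
    using i3 by (simp add: right_diff_distrib)
  also have "\<dots> = (\<integral>\<omega>. (\<integral>w. ?H \<omega> w \<partial>normal_law (t - u)) \<partial>M)"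
  proof (rule markov[OF tr(1,2) t'(3)])
    have "(\<lambda>x. \<Psi> (X u (fst x) + snd x + f t (fst x)) (fst x)) \<in> borel_measurable (F u \<Otimes>\<^sub>M borel)"
      "(\<lambda>x. \<Psi> (X u (fst x) + snd x) (fst x)) \<in> borel_measurable (F u \<Otimes>\<^sub>M borel)"
      by (rule \<Psi>_F; use Xu ft in measurable)+
    then show "(\<lambda>(\<omega>, w). ?H \<omega> w) \<in> borel_measurable (F u \<Otimes>\<^sub>M borel)"
      using Y(1) by (simp add: case_prod_beta)
    show "integrable M (\<lambda>\<omega>. ?H \<omega> (X t \<omega> - X u \<omega>))"
      using i3 by (simp add: right_diff_distrib)
  qed
  finally have eq: "(\<integral>\<omega>. Y \<omega> * path_diff t \<omega> * path_diff r \<omega> \<partial>M) + (\<integral>\<omega>. Y \<omega> * (shifted_val t \<omega> * tilt h t \<omega>) * path_diff r \<omega> \<partial>M)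
      = (\<integral>\<omega>. (\<integral>w. ?H \<omega> w \<partial>normal_law (t - u)) \<partial>M)" .
  let ?D = "4 * R\<^sup>2 * (1 / sqrt (t - u)) * (1 / sqrt (r - t))"
  interpret N: prob_space "normal_law (t - u)" by (rule prob_space_normal_law[OF t'(6)])
  have Hle: "\<bar>\<integral>w. ?H \<omega> w \<partial>normal_law (t - u)\<bar> \<le> ?D * Y \<omega>" if \<omega>[measurable]: "\<omega> \<in> space M" for \<omega>
  proof -
    let ?k = "\<lambda>w. \<Psi> (X u \<omega> + w) \<omega>"
    have [measurable]: "?k \<in> borel_measurable borel" by measurable
    have i: "integrable (normal_law (t - u)) (\<lambda>w. ?k (w + f t \<omega>))" "integrable (normal_law (t - u)) ?k"
      by (rule N.integrable_const_bound[of _ ?B]; use \<Psi>_le[OF \<omega>] in simp)+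
    have "(\<integral>w. ?H \<omega> w \<partial>normal_law (t - u)) = Y \<omega> * ((\<integral>w. ?k (w + f t \<omega>) \<partial>normal_law (t - u)) - (\<integral>w. ?k w \<partial>normal_law (t - u)))"
      using i by (simp add: add.assoc)
    also have "\<bar>\<dots>\<bar> \<le> Y \<omega> * (2 * ?B * \<bar>f t \<omega>\<bar> / sqrt (t - u))"
      unfolding abs_mult using Y(2)[of \<omega>]
      by (simp del: times_divide_eq_right times_divide_eq_left)
         (intro mult_left_mono normal_law_shift_le[OF t'(6)] \<Psi>_le[OF \<omega>], auto)
    also have "\<dots> \<le> Y \<omega> * (2 * ?B * R / sqrt (t - u))"
      using Y(2) B0 t' f_le by (intro mult_left_mono divide_right_mono) auto
    also have "\<dots> = ?D * Y \<omega>"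
      by (simp add: power2_eq_square field_simps)
    finally show ?thesis .
  qed
  have iY: "integrable M Y" by (rule integrable_const_bound[of _ K]) (auto simp: YK[unfolded real_norm_def])
  have "\<bar>\<integral>\<omega>. (\<integral>w. ?H \<omega> w \<partial>normal_law (t - u)) \<partial>M\<bar> \<le> (\<integral>\<omega>. \<bar>\<integral>w. ?H \<omega> w \<partial>normal_law (t - u)\<bar> \<partial>M)"
    by (rule integral_abs_bound)
  also have "\<dots> \<le> (\<integral>\<omega>. ?D * Y \<omega> \<partial>M)"
    by (rule integral_mono_AE') (use iY Hle Y t' in \<open>auto intro!: AE_I2 divide_nonneg_nonneg mult_nonneg_nonneg\<close>)
  finally show ?thesis
    unfolding eq by simp
qed

lemma integral_tilt_eq_0:
  assumes t: "0 \<le> t" "0 < h" "t + h \<le> 1" and Z: "Z \<in> borel_measurable (F t)"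
    and int: "integrable M (\<lambda>\<omega>. Z \<omega> * tilt h t \<omega>)"
  shows "(\<integral>\<omega>. Z \<omega> * tilt h t \<omega> \<partial>M) = 0"
proof -
  have t': "t < t + h" using t by simp
  interpret N: prob_space "normal_law h" by (rule prob_space_normal_law[OF t(2)])
  have e: "f t \<in> borel_measurable (F t)" by (rule f_adapted[OF t(1)])
  have "(\<integral>\<omega>. Z \<omega> * tilt h t \<omega> \<partial>M) = (\<integral>\<omega>. (\<integral>w. Z \<omega> * (cm_weight h (f t \<omega>) w - 1) \<partial>normal_law (t + h - t)) \<partial>M)"
    unfolding tilt_def
  proof (rule markov[OF t(1) t' t(3)])
    show "(\<lambda>(\<omega>, w). Z \<omega> * (cm_weight h (f t \<omega>) w - 1)) \<in> borel_measurable (F t \<Otimes>\<^sub>M borel)"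
      using Z e by measurable
  qed (use int in \<open>simp add: tilt_def\<close>)
  also have "\<dots> = 0"
    using integrable_cm[OF t(2)] integral_cm[OF t(2)] t(2) by simp
  finally show ?thesis .
qed

end

section \<open>The conditional second moment\<close>

lemma abs_integral_le_indicator:
  fixes \<psi> :: "real \<Rightarrow> real"
  assumes U: "finite_measure U" "sets U = sets borel" and [measurable]: "\<psi> \<in> borel_measurable borel"
    and le: "AE r in U. \<bar>\<psi> r\<bar> \<le> B * indicator {c..d} r"
  shows "\<bar>\<integral>r. \<psi> r \<partial>U\<bar> \<le> B * measure U {c..d}"
proof -
  note [measurable_cong] = U(2)
  interpret finite_measure U by (rule U)
  have i: "integrable U (\<lambda>r. B * indicator {c..d} r)"
    by (rule integrable_const_bound[of _ "\<bar>B\<bar>"]) (auto simp: indicator_def)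
  have "\<bar>\<integral>r. \<psi> r \<partial>U\<bar> \<le> (\<integral>r. \<bar>\<psi> r\<bar> \<partial>U)" by (rule integral_abs_bound)
  also have "\<dots> \<le> (\<integral>r. B * indicator {c..d} r \<partial>U)"
    by (rule integral_mono_AE'[OF i]) (use le in \<open>auto elim: eventually_mono intro: order_trans[OF abs_ge_zero]\<close>)
  also have "\<dots> = B * measure U {c..d}" using sets_eq_imp_space_eq[OF U(2)] by simp
  finally show ?thesis .
qed

lemma abs_integral_pair_le:
  fixes \<psi> :: "real \<times> real \<Rightarrow> real"
  assumes U: "finite_measure U" "sets U = sets borel" and [measurable]: "\<psi> \<in> borel_measurable (borel \<Otimes>\<^sub>M borel)"
    and B: "\<And>x. \<bar>\<psi> x\<bar> \<le> B"
    and le: "AE t in U. \<bar>\<integral>r. \<psi> (t, r) \<partial>U\<bar> \<le> \<beta> t" and \<beta>: "integrable U \<beta>"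
  shows "\<bar>\<integral>x. \<psi> x \<partial>(U \<Otimes>\<^sub>M U)\<bar> \<le> (\<integral>t. \<beta> t \<partial>U)"
proof -
  note [measurable_cong] = U(2)
  interpret U: finite_measure U by (rule U)
  interpret UU: pair_sigma_finite U U ..
  interpret U2: finite_measure "U \<Otimes>\<^sub>M U"
    by (rule finite_measure_pair_measure[OF U(1) U(1)])
  have i: "integrable (U \<Otimes>\<^sub>M U) \<psi>"
    by (rule U2.integrable_const_bound[of _ B]) (auto simp: B)
  have "(\<integral>x. \<psi> x \<partial>(U \<Otimes>\<^sub>M U)) = (\<integral>t. (\<integral>r. \<psi> (t, r) \<partial>U) \<partial>U)"
    by (rule UU.integral_fst'[OF i, symmetric])
  also have "\<bar>\<dots>\<bar> \<le> (\<integral>t. \<bar>\<integral>r. \<psi> (t, r) \<partial>U\<bar> \<partial>U)" by (rule integral_abs_bound)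
  also have "\<dots> \<le> (\<integral>t. \<beta> t \<partial>U)"
    by (rule integral_mono_AE'[OF \<beta> le]) (use le in \<open>auto elim: eventually_mono intro: order_trans[OF abs_ge_zero]\<close>)
  finally show ?thesis .
qed

context brownian_shift
begin

text \<open>The central estimate. It is a bound on the conditional second moment given \<open>F u\<close>, tested against the
variables \<open>Y\<close>.\<close>

lemma second_moment:
  assumes uv: "0 \<le> u" "u < v" "v \<le> 1"
    and Y: "Y \<in> borel_measurable (F u)" "\<And>\<omega>. 0 \<le> Y \<omega>" "\<And>\<omega>. Y \<omega> \<le> K"
  shows "(\<integral>\<omega>. Y \<omega> * (shift_effect u v \<omega>)\<^sup>2 \<partial>M) \<le> 112 * R\<^sup>2 * (v - u) * (\<integral>\<omega>. Y \<omega> \<partial>M)"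
proof -
  have K0: "0 \<le> K" using Y(2,3)[of undefined] by linarith
  have YK: "\<bar>Y \<omega>\<bar> \<le> K" for \<omega> using Y(2,3)[of \<omega>] by auto
  have [measurable]: "Y \<in> borel_measurable M" by (rule borel_measurable_F_M[OF Y(1)])
  have iY: "integrable M Y" by (rule integrable_const_bound[of _ K]) (auto simp: YK[unfolded real_norm_def])
  define m where "m = (\<integral>\<omega>. Y \<omega> \<partial>M)"
  have m0: "m \<ge> 0" unfolding m_def using Y by (intro Bochner_Integration.integral_nonneg)
  show ?thesis
  proof (cases "v - u \<le> R\<^sup>2")
    case True
    have "(\<integral>\<omega>. Y \<omega> * (shift_effect u v \<omega>)\<^sup>2 \<partial>M) \<le> (\<integral>\<omega>. Y \<omega> * (4 * R\<^sup>2 * (v - u)) \<partial>M)"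
    proof (rule integral_mono_AE')
      show "AE \<omega> in M. Y \<omega> * (shift_effect u v \<omega>)\<^sup>2 \<le> Y \<omega> * (4 * R\<^sup>2 * (v - u))"
      proof (rule AE_I2)
        fix \<omega> assume "\<omega> \<in> space M"
        then have "\<bar>shift_effect u v \<omega>\<bar>\<^sup>2 \<le> (2 * (v - u))\<^sup>2" using shift_effect_le[of u v \<omega>] uv by (intro power_mono) auto
        also have "\<dots> = 4 * (v - u) * (v - u)" by (simp add: power2_eq_square algebra_simps)
        also have "\<dots> \<le> 4 * R\<^sup>2 * (v - u)" using True uv by (intro mult_right_mono) auto
        finally show "Y \<omega> * (shift_effect u v \<omega>)\<^sup>2 \<le> Y \<omega> * (4 * R\<^sup>2 * (v - u))"
          using Y(2) by (intro mult_left_mono) auto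
      qed
    qed (use iY Y uv in auto)
    also have "\<dots> = 4 * R\<^sup>2 * (v - u) * m" using iY by (simp add: m_def)
    also have "\<dots> \<le> 112 * R\<^sup>2 * (v - u) * m" using m0 uv by (intro mult_right_mono) auto
    finally show ?thesis unfolding m_def .
  next
    case False
    \<comment> \<open>Up to constants, the largest window for which both the near-diagonal pairs and the variance of \<open>Z\<close> below cost only
      \<open>R\<^sup>2 * (v - u)\<close>, and the smallest one for which the weights have bounded variance.\<close>
    define h where "h = R\<^sup>2"
    define len where "len = v - u"
    have h: "0 < h" "h < len" using False R_pos by (auto simp: h_def len_def)
    have l: "0 < len" using h by simp
    \<comment> \<open>The weight is needed only where its window \<open>[t, t + h]\<close> lies inside \<open>[u, v]\<close>.\<close>
    define c where "c t \<omega> = (if u \<le> t \<and> t \<le> v - h then shifted_val t \<omega> * tilt h t \<omega> else 0)" for t \<omega>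
    have [measurable]: "(\<lambda>(t, \<omega>). c t \<omega>) \<in> borel_measurable (borel \<Otimes>\<^sub>M M)"
      unfolding c_def by measurable
    have [measurable]: "c t \<in> borel_measurable M" for t
      unfolding c_def by measurable
    let ?U = "lborel_on u v"
    interpret U: finite_measure ?U by (rule finite_measure_lborel_on)
    interpret UU: pair_sigma_finite ?U ?U ..
    interpret U2: finite_measure "?U \<Otimes>\<^sub>M ?U"
      by (rule finite_measure_pair_measure[OF finite_measure_lborel_on finite_measure_lborel_on])
    note fm = finite_measure_lborel_on sets_lborel_on
    have c2: "(c t \<omega>)\<^sup>2 \<le> (tilt h t \<omega>)\<^sup>2" if "u \<le> t" "t \<le> v - h" for t \<omega>
    proof -
      have "\<bar>shifted_val t \<omega> * tilt h t \<omega>\<bar> \<le> 1 * \<bar>tilt h t \<omega>\<bar>"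
        unfolding abs_mult by (rule mult_right_mono[OF shifted_val_le]) simp
      then show ?thesis using that by (simp add: c_def abs_le_square_iff)
    qed
    have nnc: "(\<integral>\<^sup>+\<omega>. ennreal (Z \<omega> * (c t \<omega>)\<^sup>2) \<partial>M) \<le> (\<integral>\<^sup>+\<omega>. ennreal (2 * Z \<omega>) \<partial>M)"
      if Z: "Z \<in> borel_measurable (F u)" "\<And>\<omega>. 0 \<le> Z \<omega>" for t Z
    proof (cases "u \<le> t \<and> t \<le> v - h")
      case True
      then have t: "0 \<le> t" "t + h \<le> 1" using uv by auto
      have "(\<integral>\<^sup>+\<omega>. ennreal (Z \<omega> * (c t \<omega>)\<^sup>2) \<partial>M) \<le> (\<integral>\<^sup>+\<omega>. ennreal (Z \<omega> * (tilt h t \<omega>)\<^sup>2) \<partial>M)"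
        using True c2 Z(2) by (intro nn_integral_mono ennreal_leI mult_left_mono) auto
      also have "\<dots> \<le> (\<integral>\<^sup>+\<omega>. ennreal (2 * Z \<omega>) \<partial>M)"
        unfolding tilt_def
      proof (rule nn_integral_cm_weight_square_le[OF t(1) h(1) t(2) f_adapted[OF t(1)]])
        show "Z \<in> borel_measurable (F t)" by (rule borel_measurable_F_mono[OF Z(1)]) (use True in auto)
      qed (auto simp: Z(2) f_le h_def)
      finally show ?thesis .
    qed (auto simp: c_def)
    have iYc: "integrable M (\<lambda>\<omega>. Y \<omega> * (c t \<omega>)\<^sup>2)" and EYc: "(\<integral>\<omega>. Y \<omega> * (c t \<omega>)\<^sup>2 \<partial>M) \<le> 2 * m" for t
    proof -
      have "(\<integral>\<^sup>+\<omega>. ennreal (2 * Y \<omega>) \<partial>M) = ennreal (2 * m)"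
        unfolding m_def using iY Y(2) by (subst nn_integral_eq_integral) auto
      with nnc[OF Y(1,2), of t] have nn: "(\<integral>\<^sup>+\<omega>. ennreal (Y \<omega> * (c t \<omega>)\<^sup>2) \<partial>M) \<le> ennreal (2 * m)" by simp
      show i: "integrable M (\<lambda>\<omega>. Y \<omega> * (c t \<omega>)\<^sup>2)"
        by (rule integrableI_nonneg) (use nn Y(2) in \<open>auto intro: le_less_trans\<close>)
      show "(\<integral>\<omega>. Y \<omega> * (c t \<omega>)\<^sup>2 \<partial>M) \<le> 2 * m"
        using nn i Y(2) m0 by (subst (asm) nn_integral_eq_integral) (auto simp: ennreal_le_iff)
    qed
    have Bc: "(\<integral>\<^sup>+\<omega>. ennreal ((c t \<omega>)\<^sup>2) \<partial>M) \<le> ennreal 4" for t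
      using nnc[of "\<lambda>_. 1" t] by (simp add: emeasure_space_1) (erule order_trans, simp)
    have Bp: "(\<integral>\<^sup>+\<omega>. ennreal ((path_diff t \<omega>)\<^sup>2) \<partial>M) \<le> ennreal 4" for t
    proof -
      have "(\<integral>\<^sup>+\<omega>. ennreal ((path_diff t \<omega>)\<^sup>2) \<partial>M) \<le> (\<integral>\<^sup>+\<omega>. ennreal 4 \<partial>M)"
        using path_diff_le[of t] abs_le_square_iff[of "path_diff t _" 2] by (intro nn_integral_mono ennreal_leI) auto
      then show ?thesis by (simp add: emeasure_space_1)
    qed
    define A where "A = shift_effect u v"
    define Z where "Z \<omega> = (\<integral>t. c t \<omega> \<partial>?U)" for \<omega>
    define e where "e x = (\<integral>\<omega>. Y \<omega> * path_diff (fst x) \<omega> * path_diff (snd x) \<omega> \<partial>M)" for x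
    define k where "k x = (\<integral>\<omega>. Y \<omega> * c (fst x) \<omega> * path_diff (snd x) \<omega> \<partial>M)" for x
    define q where "q x = (\<integral>\<omega>. Y \<omega> * c (fst x) \<omega> * c (snd x) \<omega> \<partial>M)" for x
    have [measurable]: "e \<in> borel_measurable (borel \<Otimes>\<^sub>M borel)" "k \<in> borel_measurable (borel \<Otimes>\<^sub>M borel)"
      "q \<in> borel_measurable (borel \<Otimes>\<^sub>M borel)"
      unfolding e_def k_def q_def by measurable
    have ie: "integrable M (\<lambda>\<omega>. Y \<omega> * path_diff t \<omega> * path_diff r \<omega>)" for t r
    proof (rule integrable_const_bound[of _ "K * 2 * 2"])
      show "AE \<omega> in M. norm (Y \<omega> * path_diff t \<omega> * path_diff r \<omega>) \<le> K * 2 * 2"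
        unfolding real_norm_def abs_mult by (intro AE_I2 mult_mono YK path_diff_le mult_nonneg_nonneg) (use K0 in auto)
    qed measurable
    have ck: "\<bar>Y \<omega> * c t \<omega> * path_diff r \<omega>\<bar> \<le> Y \<omega> + Y \<omega> * (c t \<omega>)\<^sup>2" for t r \<omega>
    proof -
      have "\<bar>c t \<omega>\<bar> * \<bar>path_diff r \<omega>\<bar> \<le> \<bar>c t \<omega>\<bar> * 2"
        by (rule mult_left_mono[OF path_diff_le]) simp
      also have "\<dots> \<le> 1 + (c t \<omega>)\<^sup>2"
        using sum_squares_bound[of 1 "\<bar>c t \<omega>\<bar>"] by (simp add: mult.commute)
      finally have "Y \<omega> * (\<bar>c t \<omega>\<bar> * \<bar>path_diff r \<omega>\<bar>) \<le> Y \<omega> * (1 + (c t \<omega>)\<^sup>2)"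
        by (rule mult_left_mono) (rule Y(2))
      then show ?thesis using Y(2)[of \<omega>] by (simp add: abs_mult distrib_left mult.assoc)
    qed
    have cq: "\<bar>Y \<omega> * c t \<omega> * c r \<omega>\<bar> \<le> (Y \<omega> * (c t \<omega>)\<^sup>2 + Y \<omega> * (c r \<omega>)\<^sup>2) / 2" for t r \<omega>
    proof -
      have "2 * (\<bar>c t \<omega>\<bar> * \<bar>c r \<omega>\<bar>) \<le> (c t \<omega>)\<^sup>2 + (c r \<omega>)\<^sup>2"
        using sum_squares_bound[of "\<bar>c t \<omega>\<bar>" "\<bar>c r \<omega>\<bar>"] by (simp add: mult.assoc)
      then have "Y \<omega> * (2 * (\<bar>c t \<omega>\<bar> * \<bar>c r \<omega>\<bar>)) \<le> Y \<omega> * ((c t \<omega>)\<^sup>2 + (c r \<omega>)\<^sup>2)"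
        by (rule mult_left_mono) (rule Y(2))
      then show ?thesis using Y(2)[of \<omega>] by (simp add: abs_mult distrib_left mult_ac)
    qed
    have ik: "integrable M (\<lambda>\<omega>. Y \<omega> * c t \<omega> * path_diff r \<omega>)" for t r
      by (rule Bochner_Integration.integrable_bound[OF Bochner_Integration.integrable_add[OF iY iYc[of t]]])
         (measurable, rule AE_I2, unfold real_norm_def, rule order_trans[OF ck abs_ge_self])
    have iq: "integrable M (\<lambda>\<omega>. Y \<omega> * c t \<omega> * c r \<omega>)" for t r
      by (rule Bochner_Integration.integrable_bound[OF integrable_divide_zero[OF Bochner_Integration.integrable_add[OF iYc[of t] iYc[of r]], of 2]])
         (measurable, rule AE_I2, unfold real_norm_def, rule order_trans[OF cq abs_ge_self])
    have e_le: "\<bar>e x\<bar> \<le> 4 * m" for x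
    proof -
      have "\<bar>e x\<bar> \<le> (\<integral>\<omega>. \<bar>Y \<omega> * path_diff (fst x) \<omega> * path_diff (snd x) \<omega>\<bar> \<partial>M)"
        unfolding e_def by (rule integral_abs_bound)
      also have "\<dots> \<le> (\<integral>\<omega>. Y \<omega> * 2 * 2 \<partial>M)"
      proof (rule integral_mono[OF integrable_abs[OF ie]])
        show "\<bar>Y \<omega> * path_diff (fst x) \<omega> * path_diff (snd x) \<omega>\<bar> \<le> Y \<omega> * 2 * 2" for \<omega>
          unfolding abs_mult abs_of_nonneg[OF Y(2)] by (intro mult_mono path_diff_le) (use Y(2) in auto)
      qed (use iY in auto)
      finally show ?thesis using iY by (simp add: m_def)
    qed
    have k_le: "\<bar>k x\<bar> \<le> 4 * m" for x
    proof -
      have "\<bar>k x\<bar> \<le> (\<integral>\<omega>. \<bar>Y \<omega> * c (fst x) \<omega> * path_diff (snd x) \<omega>\<bar> \<partial>M)"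
        unfolding k_def by (rule integral_abs_bound)
      also have "\<dots> \<le> (\<integral>\<omega>. Y \<omega> + Y \<omega> * (c (fst x) \<omega>)\<^sup>2 \<partial>M)"
        by (rule integral_mono) (use ik iY iYc ck in auto)
      also have "\<dots> \<le> 4 * m" using iY iYc EYc[of "fst x"] m0 by (simp add: m_def)
      finally show ?thesis .
    qed
    have q_le: "\<bar>q x\<bar> \<le> 2 * m" for x
    proof -
      have "\<bar>q x\<bar> \<le> (\<integral>\<omega>. \<bar>Y \<omega> * c (fst x) \<omega> * c (snd x) \<omega>\<bar> \<partial>M)"
        unfolding q_def by (rule integral_abs_bound)
      also have "\<dots> \<le> (\<integral>\<omega>. (Y \<omega> * (c (fst x) \<omega>)\<^sup>2 + Y \<omega> * (c (snd x) \<omega>)\<^sup>2) / 2 \<partial>M)"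
        by (rule integral_mono) (use iq iYc cq in auto)
      also have "\<dots> \<le> 2 * m" using iYc EYc[of "fst x"] EYc[of "snd x"] by simp
      finally show ?thesis .
    qed
    \<comment> \<open>A weight has mean zero given the past, so it is orthogonal to everything that lies before its window.\<close>
    have k0: "k (t, r) = 0" if "u < t" "u < r" "r \<le> t" "t < v" for t r
    proof (cases "t \<le> v - h")
      case True
      have eq: "Y \<omega> * c t \<omega> * path_diff r \<omega> = (Y \<omega> * shifted_val t \<omega> * path_diff r \<omega>) * tilt h t \<omega>" for \<omega>
        using that True by (simp add: c_def)
      have "(\<integral>\<omega>. (Y \<omega> * shifted_val t \<omega> * path_diff r \<omega>) * tilt h t \<omega> \<partial>M) = 0"
      proof (rule integral_tilt_eq_0)
        have "Y \<in> borel_measurable (F t)" by (rule borel_measurable_F_mono[OF Y(1)]) (use that in auto)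
        then show "(\<lambda>\<omega>. Y \<omega> * shifted_val t \<omega> * path_diff r \<omega>) \<in> borel_measurable (F t)"
          using that uv by (intro borel_measurable_times shifted_val_adapted path_diff_adapted) auto
        show "integrable M (\<lambda>\<omega>. (Y \<omega> * shifted_val t \<omega> * path_diff r \<omega>) * tilt h t \<omega>)"
          using ik[of t r] by (simp add: eq)
      qed (use that True uv h in auto)
      then show ?thesis by (simp add: k_def eq)
    qed (simp add: k_def c_def)
    have q0: "q (t, r) = 0" if "u < t" "t + h \<le> r" "r < v" for t r
    proof (cases "r \<le> v - h")
      case True
      have eq: "Y \<omega> * c t \<omega> * c r \<omega> = (Y \<omega> * (shifted_val t \<omega> * tilt h t \<omega>) * shifted_val r \<omega>) * tilt h r \<omega>" for \<omega>
        using that True h by (simp add: c_def)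
      have "(\<integral>\<omega>. (Y \<omega> * (shifted_val t \<omega> * tilt h t \<omega>) * shifted_val r \<omega>) * tilt h r \<omega> \<partial>M) = 0"
      proof (rule integral_tilt_eq_0)
        have "Y \<in> borel_measurable (F r)" by (rule borel_measurable_F_mono[OF Y(1)]) (use that h in auto)
        then show "(\<lambda>\<omega>. Y \<omega> * (shifted_val t \<omega> * tilt h t \<omega>) * shifted_val r \<omega>) \<in> borel_measurable (F r)"
          using that uv h by (intro borel_measurable_times shifted_val_adapted tilt_adapted) auto
        show "integrable M (\<lambda>\<omega>. (Y \<omega> * (shifted_val t \<omega> * tilt h t \<omega>) * shifted_val r \<omega>) * tilt h r \<omega>)"
          using iq[of t r] by (simp add: eq)
      qed (use that True uv h in auto)
      then show ?thesis by (simp add: q_def eq)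
    qed (simp add: q_def c_def)
    have q0': "q (t, r) = 0" if "u < r" "r + h \<le> t" "t < v" for t r
      using q0[of r t] that by (simp add: q_def mult_ac)
    have ek: "\<bar>e (t, r) + k (t, r)\<bar> \<le> 4 * h * m * (1 / sqrt (t - u)) * (1 / sqrt (r - t))"
      if "u < t" "t + h < r" "r < v" for t r
      using far_pair_bound[OF uv(1) that(1) h(1) that(2) _ Y] that uv h
      by (simp add: e_def k_def c_def h_def[symmetric] m_def mult_ac)
    have intb: "integrable (?U \<Otimes>\<^sub>M ?U) \<psi>" if [measurable]: "\<psi> \<in> borel_measurable (borel \<Otimes>\<^sub>M borel)" and "\<And>x. \<bar>\<psi> x\<bar> \<le> B" for \<psi> :: "real \<times> real \<Rightarrow> real" and B
      by (rule U2.integrable_const_bound[of _ B]) (auto simp: that)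
    note FP = fubini_product[OF fm]
    have dE: "(\<integral>\<omega>. Y \<omega> * (A \<omega>)\<^sup>2 \<partial>M) = (\<integral>x. e x \<partial>(?U \<Otimes>\<^sub>M ?U))"
    proof -
      have "(\<integral>\<omega>. Y \<omega> * (A \<omega>)\<^sup>2 \<partial>M) = (\<integral>t. (\<integral>r. e (t, r) \<partial>?U) \<partial>?U)"
        using FP(2)[of path_diff path_diff Y K 4] YK Bp Bc by (simp add: A_def shift_effect_def e_def power2_eq_square)
      also have "\<dots> = (\<integral>x. e x \<partial>(?U \<Otimes>\<^sub>M ?U))"
        by (rule UU.integral_fst'[OF intb[of e, OF _ e_le]]) measurable
      finally show ?thesis .
    qed
    have dP: "(\<integral>\<omega>. Y \<omega> * (Z \<omega> * A \<omega>) \<partial>M) = (\<integral>x. k x \<partial>(?U \<Otimes>\<^sub>M ?U))"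
    proof -
      have "(\<integral>\<omega>. Y \<omega> * (Z \<omega> * A \<omega>) \<partial>M) = (\<integral>t. (\<integral>r. k (t, r) \<partial>?U) \<partial>?U)"
        using FP(2)[of c path_diff Y K 4] YK Bp Bc by (simp add: A_def shift_effect_def Z_def k_def power2_eq_square)
      also have "\<dots> = (\<integral>x. k x \<partial>(?U \<Otimes>\<^sub>M ?U))"
        by (rule UU.integral_fst'[OF intb[of k, OF _ k_le]]) measurable
      finally show ?thesis .
    qed
    have dQ: "(\<integral>\<omega>. Y \<omega> * (Z \<omega>)\<^sup>2 \<partial>M) = (\<integral>x. q x \<partial>(?U \<Otimes>\<^sub>M ?U))"
    proof -
      have "(\<integral>\<omega>. Y \<omega> * (Z \<omega>)\<^sup>2 \<partial>M) = (\<integral>t. (\<integral>r. q (t, r) \<partial>?U) \<partial>?U)"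
        using FP(2)[of c c Y K 4] YK Bp Bc by (simp add: Z_def q_def power2_eq_square)
      also have "\<dots> = (\<integral>x. q x \<partial>(?U \<Otimes>\<^sub>M ?U))"
        by (rule UU.integral_fst'[OF intb[of q, OF _ q_le]]) measurable
      finally show ?thesis .
    qed
    have iA: "integrable M (\<lambda>\<omega>. Y \<omega> * (A \<omega>)\<^sup>2)"
      using FP(1)[of path_diff path_diff Y K 4] YK Bp by (simp add: A_def shift_effect_def power2_eq_square)
    have iZ: "integrable M (\<lambda>\<omega>. Y \<omega> * (Z \<omega>)\<^sup>2)"
      using FP(1)[of c c Y K 4] YK Bc by (simp add: Z_def power2_eq_square)
    have iZA: "integrable M (\<lambda>\<omega>. Y \<omega> * (Z \<omega> * A \<omega>))"
      using FP(1)[of c path_diff Y K 4] YK Bc Bp by (simp add: Z_def A_def shift_effect_def power2_eq_square)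
    have AEU: "AE t in ?U. u < t \<and> t < v" by (rule AE_lborel_on)
    have const: "(\<integral>t. a \<partial>?U) = a * len" for a :: real
      using uv by (simp add: measure_lborel_on_UNIV len_def mult.commute)
    \<comment> \<open>The square \<open>[u, v]\<^sup>2\<close> is cut into a band around the diagonal and two regions exchanged by symmetry; \<open>D\<close>
      is the part of the band next to \<open>R1\<close>, where \<open>k\<close> need not vanish.\<close>
    define N where "N = {x::real \<times> real. \<bar>snd x - fst x\<bar> \<le> h}"
    define R1 where "R1 = {x::real \<times> real. fst x + h < snd x}"
    define R2 where "R2 = {x::real \<times> real. snd x + h < fst x}"
    define D where "D = {x::real \<times> real. fst x \<le> snd x \<and> snd x \<le> fst x + h}"
    have "{x \<in> space (borel \<Otimes>\<^sub>M borel :: (real \<times> real) measure). \<bar>snd x - fst x\<bar> \<le> h} \<in> sets (borel \<Otimes>\<^sub>M borel :: (real \<times> real) measure)"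
      "{x \<in> space (borel \<Otimes>\<^sub>M borel :: (real \<times> real) measure). fst x + h < snd x} \<in> sets (borel \<Otimes>\<^sub>M borel :: (real \<times> real) measure)"
      "{x \<in> space (borel \<Otimes>\<^sub>M borel :: (real \<times> real) measure). snd x + h < fst x} \<in> sets (borel \<Otimes>\<^sub>M borel :: (real \<times> real) measure)"
      "{x \<in> space (borel \<Otimes>\<^sub>M borel :: (real \<times> real) measure). fst x \<le> snd x \<and> snd x \<le> fst x + h} \<in> sets (borel \<Otimes>\<^sub>M borel :: (real \<times> real) measure)"
      by measurable
    then have [measurable]: "N \<in> sets (borel \<Otimes>\<^sub>M borel)" "R1 \<in> sets (borel \<Otimes>\<^sub>M borel)"
      "R2 \<in> sets (borel \<Otimes>\<^sub>M borel)" "D \<in> sets (borel \<Otimes>\<^sub>M borel)"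
      by (simp_all add: N_def R1_def R2_def D_def space_pair_measure)
    have ind: "\<bar>\<psi> x * indicator S x\<bar> \<le> B" if "\<bar>\<psi> x\<bar> \<le> B" for \<psi> :: "real \<times> real \<Rightarrow> real" and S x B
      using that by (auto simp: indicator_def intro: order_trans[OF abs_ge_zero])
    have near: "\<bar>\<integral>x. \<psi> x * indicator N x \<partial>(?U \<Otimes>\<^sub>M ?U)\<bar> \<le> B * (2 * h) * len"
      if [measurable]: "\<psi> \<in> borel_measurable (borel \<Otimes>\<^sub>M borel)" and B: "\<And>x. \<bar>\<psi> x\<bar> \<le> B" for \<psi> :: "real \<times> real \<Rightarrow> real" and B
    proof -
      have B0: "B \<ge> 0" using B[of undefined] by linarith
      have "\<bar>\<integral>x. \<psi> x * indicator N x \<partial>(?U \<Otimes>\<^sub>M ?U)\<bar> \<le> (\<integral>t. B * (2 * h) \<partial>?U)"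
      proof (rule abs_integral_pair_le[OF fm])
        show "AE t in ?U. \<bar>\<integral>r. \<psi> (t, r) * indicator N (t, r) \<partial>?U\<bar> \<le> B * (2 * h)"
        proof (rule AE_I2)
          fix t
          have "\<bar>\<integral>r. \<psi> (t, r) * indicator N (t, r) \<partial>?U\<bar> \<le> B * measure ?U {t - h..t + h}"
            by (rule abs_integral_le_indicator[OF fm])
               (use B B0 in \<open>auto simp: indicator_def N_def intro!: AE_I2\<close>)
          also have "\<dots> \<le> B * (2 * h)"
            using measure_lborel_on_Icc_le[of "t - h" "t + h" u v] h B0 by (intro mult_left_mono) auto
          finally show "\<bar>\<integral>r. \<psi> (t, r) * indicator N (t, r) \<partial>?U\<bar> \<le> B * (2 * h)" .
        qed
        show "\<bar>\<psi> x * indicator N x\<bar> \<le> B" for x by (rule ind[OF B])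
      qed auto
      then show ?thesis by (simp only: const)
    qed
    have diag: "\<bar>\<integral>x. k x * indicator D x \<partial>(?U \<Otimes>\<^sub>M ?U)\<bar> \<le> 4 * m * h * len"
    proof -
      have "\<bar>\<integral>x. k x * indicator D x \<partial>(?U \<Otimes>\<^sub>M ?U)\<bar> \<le> (\<integral>t. 4 * m * h \<partial>?U)"
      proof (rule abs_integral_pair_le[OF fm])
        show "AE t in ?U. \<bar>\<integral>r. k (t, r) * indicator D (t, r) \<partial>?U\<bar> \<le> 4 * m * h"
        proof (rule AE_I2)
          fix t
          have "\<bar>\<integral>r. k (t, r) * indicator D (t, r) \<partial>?U\<bar> \<le> (4 * m) * measure ?U {t..t + h}"
            by (rule abs_integral_le_indicator[OF fm])
               (use k_le m0 in \<open>auto simp: indicator_def D_def intro!: AE_I2\<close>)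
          also have "\<dots> \<le> 4 * m * h"
            using measure_lborel_on_Icc_le[of "t" "t + h" u v] h m0 by (intro mult_left_mono) auto
          finally show "\<bar>\<integral>r. k (t, r) * indicator D (t, r) \<partial>?U\<bar> \<le> 4 * m * h" .
        qed
        show "\<bar>k x * indicator D x\<bar> \<le> 4 * m" for x by (rule ind[OF k_le])
      qed auto
      then show ?thesis by (simp only: const)
    qed
    have sq: "sqrt len * sqrt len = len" using l by simp
    have far: "\<bar>\<integral>x. (e x + k x) * indicator R1 x \<partial>(?U \<Otimes>\<^sub>M ?U)\<bar> \<le> 16 * h * m * len"
    proof -
      let ?\<beta> = "\<lambda>t. (8 * h * m * sqrt len) * (indicator {u<..} t / sqrt (t - u))"
      have "\<bar>\<integral>x. (e x + k x) * indicator R1 x \<partial>(?U \<Otimes>\<^sub>M ?U)\<bar> \<le> (\<integral>t. ?\<beta> t \<partial>?U)"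
      proof (rule abs_integral_pair_le[OF fm])
        show "AE t in ?U. \<bar>\<integral>r. (e (t, r) + k (t, r)) * indicator R1 (t, r) \<partial>?U\<bar> \<le> ?\<beta> t"
          using AEU
        proof eventually_elim
          case (elim t)
          let ?b = "\<lambda>r. (4 * h * m * (1 / sqrt (t - u))) * (indicator {t<..} r / sqrt (r - t))"
          have tt: "u \<le> t" "t \<le> v" using elim by auto
          have ib: "integrable ?U ?b"
            by (rule integrable_mult_right[OF integrable_lborel_on_inv_sqrt[OF tt]])
          have "\<bar>\<integral>r. (e (t, r) + k (t, r)) * indicator R1 (t, r) \<partial>?U\<bar> \<le> (\<integral>r. \<bar>(e (t, r) + k (t, r)) * indicator R1 (t, r)\<bar> \<partial>?U)"
            by (rule integral_abs_bound)
          also have "\<dots> \<le> (\<integral>r. ?b r \<partial>?U)"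
          proof (rule integral_mono_AE'[OF ib])
            show "AE r in ?U. \<bar>(e (t, r) + k (t, r)) * indicator R1 (t, r)\<bar> \<le> ?b r"
              using AEU
            proof eventually_elim
              case (elim r)
              show ?case
              proof (cases "t + h < r")
                case True
                then show ?thesis using ek[of t r] elim \<open>u < t \<and> t < v\<close> h by (auto simp: R1_def indicator_def)
              next
                case False
                then show ?thesis using h m0 tt by (auto simp: R1_def indicator_def intro!: mult_nonneg_nonneg)
              qed
            qed
            show "AE r in ?U. 0 \<le> ?b r"
              using h m0 tt by (auto simp: indicator_def intro!: AE_I2)
          qed
          also have "\<dots> = (4 * h * m * (1 / sqrt (t - u))) * (\<integral>r. indicator {t<..} r / sqrt (r - t) \<partial>?U)"
            by (rule integral_mult_right_zero)
          also have "\<dots> \<le> (4 * h * m * (1 / sqrt (t - u))) * (2 * sqrt len)"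
            unfolding len_def using h m0 tt by (intro mult_left_mono integral_lborel_on_inv_sqrt) auto
          also have "\<dots> = ?\<beta> t" using elim by simp
          finally show ?case .
        qed
        show "\<bar>(e x + k x) * indicator R1 x\<bar> \<le> 8 * m" for x
          using e_le[of x] k_le[of x] by (intro ind) linarith
        show "integrable ?U ?\<beta>"
          by (rule integrable_mult_right[OF integrable_lborel_on_inv_sqrt]) (use uv in auto)
      qed measurable
      also have "\<dots> = (8 * h * m * sqrt len) * (\<integral>t. indicator {u<..} t / sqrt (t - u) \<partial>?U)"
        by (rule integral_mult_right_zero)
      also have "\<dots> \<le> (8 * h * m * sqrt len) * (2 * sqrt len)"
        unfolding len_def using h m0 uv by (intro mult_left_mono integral_lborel_on_inv_sqrt) auto
      also have "\<dots> = 16 * h * m * (sqrt len * sqrt len)" by simp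
      finally show ?thesis by (simp only: sq)
    qed
    let ?I = "\<lambda>\<psi>. \<integral>x. \<psi> x \<partial>(?U \<Otimes>\<^sub>M ?U)"
    note ib = intb[OF _ ind] 
    have iI: "integrable (?U \<Otimes>\<^sub>M ?U) (\<lambda>x. e x * indicator S x)" "integrable (?U \<Otimes>\<^sub>M ?U) (\<lambda>x. k x * indicator S x)"
      "integrable (?U \<Otimes>\<^sub>M ?U) (\<lambda>x. q x * indicator S x)"
      if [measurable]: "S \<in> sets (borel \<Otimes>\<^sub>M borel)" for S
      by (rule ib[OF _ e_le] ib[OF _ k_le] ib[OF _ q_le]; measurable)+
    have AE2: "AE x in ?U \<Otimes>\<^sub>M ?U. u < fst x \<and> fst x < v \<and> u < snd x \<and> snd x < v"
    proof (rule UU.AE_pair_measure)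
      show "{x \<in> space (?U \<Otimes>\<^sub>M ?U). u < fst x \<and> fst x < v \<and> u < snd x \<and> snd x < v} \<in> sets (?U \<Otimes>\<^sub>M ?U)"
        by measurable
      show "AE x in ?U. AE y in ?U. u < fst (x, y) \<and> fst (x, y) < v \<and> u < snd (x, y) \<and> snd (x, y) < v"
        using AEU by eventually_elim (use AEU in auto)
    qed
    have s1: "?I e = ?I (\<lambda>x. e x * indicator N x) + ?I (\<lambda>x. e x * indicator R1 x) + ?I (\<lambda>x. e x * indicator R2 x)"
    proof -
      have "?I e = ?I (\<lambda>x. e x * indicator N x + e x * indicator R1 x + e x * indicator R2 x)"
        using h by (intro Bochner_Integration.integral_cong) (auto simp: N_def R1_def R2_def indicator_def)
      then show ?thesis using iI by simp
    qed
    have s2: "?I (\<lambda>x. e x * indicator R2 x) = ?I (\<lambda>x. e x * indicator R1 x)"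
    proof -
      have "?I (\<lambda>x. e x * indicator R1 x) = ?I (\<lambda>(t, r). e (r, t) * indicator R1 (r, t))"
        by (rule UU.integral_product_swap[symmetric]) measurable
      also have "\<dots> = ?I (\<lambda>x. e x * indicator R2 x)"
        by (intro Bochner_Integration.integral_cong) (auto simp: e_def R1_def R2_def indicator_def mult_ac split: prod.split)
      finally show ?thesis by simp
    qed
    have s3: "?I (\<lambda>x. e x * indicator R1 x) = ?I (\<lambda>x. (e x + k x) * indicator R1 x) - ?I (\<lambda>x. k x * indicator R1 x)"
      using iI(1,2)[of R1] by (simp add: distrib_right)
    \<comment> \<open>Completing the integral of \<open>k\<close> over \<open>R1\<close> to the whole square turns it into \<open>E (Y * Z * A)\<close>.\<close>
    have s4: "?I (\<lambda>x. k x * indicator R1 x) = ?I k - ?I (\<lambda>x. k x * indicator D x)"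
    proof -
      have "?I (\<lambda>x. k x * indicator R1 x) = ?I (\<lambda>x. k x - k x * indicator D x)"
      proof (rule integral_cong_AE)
        show "AE x in ?U \<Otimes>\<^sub>M ?U. k x * indicator R1 x = k x - k x * indicator D x"
          using AE2
        proof eventually_elim
          case (elim x)
          show ?case
          proof (cases "snd x \<le> fst x")
            case True
            then show ?thesis using k0[of "fst x" "snd x"] elim by simp
          next
            case False
            then show ?thesis using h by (auto simp: R1_def D_def indicator_def)
          qed
        qed
      qed measurable
      moreover have "integrable (?U \<Otimes>\<^sub>M ?U) k"
        by (rule intb[OF _ k_le]) measurable
      moreover have "integrable (?U \<Otimes>\<^sub>M ?U) (\<lambda>x. k x * indicator D x)"
        by (rule iI(2)) measurable
      ultimately show ?thesis by (simp only: Bochner_Integration.integral_diff)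
    qed
    have s5: "?I q = ?I (\<lambda>x. q x * indicator N x)"
    proof (rule integral_cong_AE)
      show "AE x in ?U \<Otimes>\<^sub>M ?U. q x = q x * indicator N x"
        using AE2
      proof eventually_elim
        case (elim x)
        show ?case
        proof (cases "x \<in> N")
          case False
          then consider "fst x + h \<le> snd x" | "snd x + h \<le> fst x"
            unfolding N_def mem_Collect_eq by linarith
          then have "q (fst x, snd x) = 0"
          proof cases
            case 1
            then show ?thesis using elim by (intro q0) auto
          next
            case 2
            then show ?thesis using elim by (intro q0') auto
          qed
          then show ?thesis by simp
        qed simp
      qed
    qed measurable
    have Q: "(\<integral>\<omega>. Y \<omega> * (Z \<omega>)\<^sup>2 \<partial>M) \<le> 4 * h * len * m"
      using near[of q, OF _ q_le] unfolding dQ s5 by (simp add: mult_ac)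
    \<comment> \<open>Half of \<open>E (Y * A\<^sup>2)\<close> on the right will be absorbed by the left-hand side.\<close>
    have P: "2 * \<bar>?I k\<bar> \<le> 2 * (\<integral>\<omega>. Y \<omega> * (Z \<omega>)\<^sup>2 \<partial>M) + (\<integral>\<omega>. Y \<omega> * (A \<omega>)\<^sup>2 \<partial>M) / 2"
    proof -
      have "2 * \<bar>?I k\<bar> \<le> 2 * (\<integral>\<omega>. \<bar>Y \<omega> * (Z \<omega> * A \<omega>)\<bar> \<partial>M)"
        unfolding dP[symmetric] by (intro mult_left_mono integral_abs_bound) auto
      also have "\<dots> = (\<integral>\<omega>. 2 * \<bar>Y \<omega> * (Z \<omega> * A \<omega>)\<bar> \<partial>M)" by simp
      also have "\<dots> \<le> (\<integral>\<omega>. 2 * (Y \<omega> * (Z \<omega>)\<^sup>2) + Y \<omega> * (A \<omega>)\<^sup>2 / 2 \<partial>M)"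
      proof (rule integral_mono)
        fix \<omega>
        have "2 * \<bar>Z \<omega> * A \<omega>\<bar> \<le> 2 * (Z \<omega>)\<^sup>2 + (A \<omega>)\<^sup>2 / 2"
          using sum_squares_bound[of "2 * \<bar>Z \<omega>\<bar>" "\<bar>A \<omega>\<bar>"] by (simp add: abs_mult power_mult_distrib)
        then have "Y \<omega> * (2 * \<bar>Z \<omega> * A \<omega>\<bar>) \<le> Y \<omega> * (2 * (Z \<omega>)\<^sup>2 + (A \<omega>)\<^sup>2 / 2)"
          by (rule mult_left_mono) (rule Y(2))
        then show "2 * \<bar>Y \<omega> * (Z \<omega> * A \<omega>)\<bar> \<le> 2 * (Y \<omega> * (Z \<omega>)\<^sup>2) + Y \<omega> * (A \<omega>)\<^sup>2 / 2"
          using Y(2)[of \<omega>] by (simp add: abs_mult distrib_left mult_ac)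
      qed (use iZA iZ iA in auto)
      also have "\<dots> = 2 * (\<integral>\<omega>. Y \<omega> * (Z \<omega>)\<^sup>2 \<partial>M) + (\<integral>\<omega>. Y \<omega> * (A \<omega>)\<^sup>2 \<partial>M) / 2"
        using iZ iA by simp
      finally show ?thesis .
    qed
    have N': "\<bar>?I (\<lambda>x. e x * indicator N x)\<bar> \<le> 8 * h * len * m"
      using near[of e, OF _ e_le] by (simp add: mult_ac)
    have "(\<integral>\<omega>. Y \<omega> * (A \<omega>)\<^sup>2 \<partial>M) \<le> 112 * (h * len * m)"
    proof -
      define W where "W = h * len * m"
      have "16 * h * m * len = 16 * W" "4 * m * h * len = 4 * W" "8 * h * len * m = 8 * W" "4 * h * len * m = 4 * W"
        by (simp_all add: W_def)
      note eqs = this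
      have arith: "S \<le> 112 * W"
        if "S = e'" "e' = n + x + y" "y = x" "x = w - z" "z = k' - d" "\<bar>w\<bar> \<le> 16 * W" "\<bar>d\<bar> \<le> 4 * W" "\<bar>n\<bar> \<le> 8 * W"
          "2 * \<bar>k'\<bar> \<le> 2 * Q' + S / 2" "Q' \<le> 4 * W" for S e' n x y w z k' d Q' :: real
        using that by linarith
      show ?thesis
        unfolding W_def[symmetric]
        by (rule arith[OF dE s1 s2 s3 s4 far[unfolded eqs] diag[unfolded eqs] N'[unfolded eqs] P Q[unfolded eqs]])
    qed
    then show ?thesis by (simp add: A_def m_def len_def h_def mult_ac)
  qed
qed

end

section \<open>From second moments to exponential tails\<close>

context brownian_shift
begin

text \<open>\<open>K\<close> bounds the conditional \<open>n\<close>-th absolute moments of \<open>A u v\<close>, rescaled by \<open>sqrt (v - u) ^ n\<close>,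
simultaneously on all time intervals.\<close>

definition mom_bound :: "nat \<Rightarrow> real \<Rightarrow> bool" where
  "mom_bound n K \<longleftrightarrow> (\<forall>u v Y B. 0 \<le> u \<and> u < v \<and> v \<le> 1 \<and> Y \<in> borel_measurable (F u) \<and>
      (\<forall>\<omega>\<in>space M. 0 \<le> Y \<omega> \<and> Y \<omega> \<le> B) \<longrightarrow>
      (\<integral>\<omega>. Y \<omega> * \<bar>shift_effect u v \<omega>\<bar> ^ n \<partial>M) \<le> K * sqrt (v - u) ^ n * (\<integral>\<omega>. Y \<omega> \<partial>M))"

lemma mom_boundI:
  assumes "\<And>u v Y B. 0 \<le> u \<Longrightarrow> u < v \<Longrightarrow> v \<le> 1 \<Longrightarrow> Y \<in> borel_measurable (F u) \<Longrightarrow>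
      (\<And>\<omega>. \<omega> \<in> space M \<Longrightarrow> 0 \<le> Y \<omega>) \<Longrightarrow> (\<And>\<omega>. \<omega> \<in> space M \<Longrightarrow> Y \<omega> \<le> B) \<Longrightarrow>
      (\<integral>\<omega>. Y \<omega> * \<bar>shift_effect u v \<omega>\<bar> ^ n \<partial>M) \<le> K * sqrt (v - u) ^ n * (\<integral>\<omega>. Y \<omega> \<partial>M)"
  shows "mom_bound n K"
  unfolding mom_bound_def using assms by blast

lemma mom_boundD:
  assumes "mom_bound n K" "0 \<le> u" "u < v" "v \<le> 1" "Y \<in> borel_measurable (F u)"
    "\<And>\<omega>. \<omega> \<in> space M \<Longrightarrow> 0 \<le> Y \<omega>" "\<And>\<omega>. \<omega> \<in> space M \<Longrightarrow> Y \<omega> \<le> B"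
  shows "(\<integral>\<omega>. Y \<omega> * \<bar>shift_effect u v \<omega>\<bar> ^ n \<partial>M) \<le> K * sqrt (v - u) ^ n * (\<integral>\<omega>. Y \<omega> \<partial>M)"
  using assms unfolding mom_bound_def by blast

lemma integrable_bounded_nonneg:
  assumes "Y \<in> borel_measurable M" "\<And>\<omega>. \<omega> \<in> space M \<Longrightarrow> 0 \<le> Y \<omega>" "\<And>\<omega>. \<omega> \<in> space M \<Longrightarrow> Y \<omega> \<le> (B::real)"
  shows "integrable M Y"
  by (rule integrable_const_bound[of _ B]) (use assms in auto)

lemma shift_effect_pow_le:
  assumes "0 \<le> u" "u < v" "v \<le> 1" "\<omega> \<in> space M"
  shows "\<bar>shift_effect u v \<omega>\<bar> ^ n \<le> 2 ^ n * sqrt (v - u) ^ n" and "\<bar>shift_effect u v \<omega>\<bar> ^ n \<le> 2 ^ n"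
proof -
  have s: "sqrt (v - u) \<le> 1" "0 \<le> sqrt (v - u)" using assms by auto
  have "v - u = sqrt (v - u) * sqrt (v - u)" using assms by simp
  also have "\<dots> \<le> sqrt (v - u) * 1" using s by (intro mult_left_mono) auto
  finally have "2 * (v - u) \<le> 2 * sqrt (v - u)" by simp
  then have "\<bar>shift_effect u v \<omega>\<bar> \<le> 2 * sqrt (v - u)"
    by (rule order_trans[OF shift_effect_le[OF less_imp_le[OF assms(2)] assms(4)]])
  then have "\<bar>shift_effect u v \<omega>\<bar> ^ n \<le> (2 * sqrt (v - u)) ^ n" by (intro power_mono) auto
  then show 1: "\<bar>shift_effect u v \<omega>\<bar> ^ n \<le> 2 ^ n * sqrt (v - u) ^ n" by (simp add: power_mult_distrib)
  have "sqrt (v - u) ^ n \<le> 1" using s by (simp add: power_le_one)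
  then have "2 ^ n * sqrt (v - u) ^ n \<le> (2 ^ n :: real)" using s by (intro mult_left_le) auto
  with 1 show "\<bar>shift_effect u v \<omega>\<bar> ^ n \<le> 2 ^ n" by (rule order_trans)
qed

lemma integrable_Y_pow:
  assumes uv: "0 \<le> u" "u < v" "v \<le> 1" and Y: "Y \<in> borel_measurable M"
    "\<And>\<omega>. \<omega> \<in> space M \<Longrightarrow> 0 \<le> Y \<omega>" "\<And>\<omega>. \<omega> \<in> space M \<Longrightarrow> Y \<omega> \<le> (B::real)"
  shows "integrable M (\<lambda>\<omega>. Y \<omega> * \<bar>shift_effect u v \<omega>\<bar> ^ n)"
proof (rule integrable_bounded_nonneg)
  show "(\<lambda>\<omega>. Y \<omega> * \<bar>shift_effect u v \<omega>\<bar> ^ n) \<in> borel_measurable M" using Y(1) by measurable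
  fix \<omega> assume \<omega>: "\<omega> \<in> space M"
  show "0 \<le> Y \<omega> * \<bar>shift_effect u v \<omega>\<bar> ^ n" using Y \<omega> by simp
  show "Y \<omega> * \<bar>shift_effect u v \<omega>\<bar> ^ n \<le> B * 2 ^ n"
    using Y(2,3)[OF \<omega>] shift_effect_pow_le(2)[OF uv \<omega>, of n] by (intro mult_mono) auto
qed

lemma mom_bound_trivial: "mom_bound n (2 ^ n)"
proof (rule mom_boundI)
  fix u v :: real and Y :: "'a \<Rightarrow> real" and B :: real
  assume uv: "0 \<le> u" "u < v" "v \<le> 1" and Y: "Y \<in> borel_measurable (F u)"
    "\<And>\<omega>. \<omega> \<in> space M \<Longrightarrow> 0 \<le> Y \<omega>" "\<And>\<omega>. \<omega> \<in> space M \<Longrightarrow> Y \<omega> \<le> B"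
  have [measurable]: "Y \<in> borel_measurable M" by (rule borel_measurable_F_M[OF Y(1)])
  have iY: "integrable M Y" by (rule integrable_bounded_nonneg[OF _ Y(2,3)]) measurable
  have "(\<integral>\<omega>. Y \<omega> * \<bar>shift_effect u v \<omega>\<bar> ^ n \<partial>M) \<le> (\<integral>\<omega>. Y \<omega> * (2 ^ n * sqrt (v - u) ^ n) \<partial>M)"
    by (rule integral_mono[OF integrable_Y_pow[OF uv _ Y(2,3)]])
       (use iY Y(2) shift_effect_pow_le(1)[OF uv] in \<open>auto intro!: mult_left_mono\<close>)
  then show "(\<integral>\<omega>. Y \<omega> * \<bar>shift_effect u v \<omega>\<bar> ^ n \<partial>M) \<le> 2 ^ n * sqrt (v - u) ^ n * (\<integral>\<omega>. Y \<omega> \<partial>M)"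
    using iY by (simp add: mult_ac)
qed

lemma mom_bound_2: "mom_bound 2 (112 * R\<^sup>2)"
proof (rule mom_boundI)
  fix u v :: real and Y :: "'a \<Rightarrow> real" and B :: real
  assume uv: "0 \<le> u" "u < v" "v \<le> 1" and Y: "Y \<in> borel_measurable (F u)"
    "\<And>\<omega>. \<omega> \<in> space M \<Longrightarrow> 0 \<le> Y \<omega>" "\<And>\<omega>. \<omega> \<in> space M \<Longrightarrow> Y \<omega> \<le> B"
  obtain \<omega>0 where "\<omega>0 \<in> space M" using not_empty by blast
  then have B0: "0 \<le> B" using order_trans[OF Y(2) Y(3)] by blast
  define Y' where "Y' \<omega> = (if \<omega> \<in> space M then Y \<omega> else 0)" for \<omega>
  have Y': "Y' \<in> borel_measurable (F u)"
    using Y(1) by (rule measurable_cong[THEN iffD1, rotated]) (auto simp: Y'_def space_F)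
  have "(\<integral>\<omega>. Y' \<omega> * (shift_effect u v \<omega>)\<^sup>2 \<partial>M) \<le> 112 * R\<^sup>2 * (v - u) * (\<integral>\<omega>. Y' \<omega> \<partial>M)"
    by (rule second_moment[OF uv Y', of B]) (auto simp: Y'_def Y B0)
  moreover have "(\<integral>\<omega>. Y' \<omega> * (shift_effect u v \<omega>)\<^sup>2 \<partial>M) = (\<integral>\<omega>. Y \<omega> * (shift_effect u v \<omega>)\<^sup>2 \<partial>M)" "(\<integral>\<omega>. Y' \<omega> \<partial>M) = (\<integral>\<omega>. Y \<omega> \<partial>M)"
    by (intro Bochner_Integration.integral_cong; simp add: Y'_def)+
  ultimately show "(\<integral>\<omega>. Y \<omega> * \<bar>shift_effect u v \<omega>\<bar>\<^sup>2 \<partial>M) \<le> 112 * R\<^sup>2 * (sqrt (v - u))\<^sup>2 * (\<integral>\<omega>. Y \<omega> \<partial>M)"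
    using uv by simp
qed

lemma mom_bound_1: "mom_bound 1 (11 * R)"
proof (rule mom_boundI)
  fix u v :: real and Y :: "'a \<Rightarrow> real" and B :: real
  assume uv: "0 \<le> u" "u < v" "v \<le> 1" and Y: "Y \<in> borel_measurable (F u)"
    "\<And>\<omega>. \<omega> \<in> space M \<Longrightarrow> 0 \<le> Y \<omega>" "\<And>\<omega>. \<omega> \<in> space M \<Longrightarrow> Y \<omega> \<le> B"
  have [measurable]: "Y \<in> borel_measurable M" by (rule borel_measurable_F_M[OF Y(1)])
  have iY: "integrable M Y" by (rule integrable_bounded_nonneg[OF _ Y(2,3)]) measurable
  have m0: "0 \<le> (\<integral>\<omega>. Y \<omega> \<partial>M)" using Y(2) by (intro integral_nonneg_AE AE_I2)
  \<comment> \<open>Any \<open>c\<close> with \<open>112 / c + c / 4 \<le> 11\<close> serves in \<open>\<bar>a\<bar> \<le> a\<^sup>2 / (c * s) + c * s / 4\<close>; here \<open>c = 21\<close>.\<close>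
  define s where "s = R * sqrt (v - u)"
  have s: "s > 0" using uv R_pos by (simp add: s_def)
  have ss: "s * s = R\<^sup>2 * (v - u)" using uv by (simp add: s_def power2_eq_square mult_ac)
  have i2: "integrable M (\<lambda>\<omega>. Y \<omega> * \<bar>shift_effect u v \<omega>\<bar>\<^sup>2)" by (rule integrable_Y_pow[OF uv _ Y(2,3)]) measurable
  have "(\<integral>\<omega>. Y \<omega> * \<bar>shift_effect u v \<omega>\<bar> ^ 1 \<partial>M) \<le> (\<integral>\<omega>. Y \<omega> * \<bar>shift_effect u v \<omega>\<bar>\<^sup>2 / (21 * s) + Y \<omega> * (21 * s / 4) \<partial>M)"
  proof (rule integral_mono[OF integrable_Y_pow[OF uv _ Y(2,3)]])
    fix \<omega> assume \<omega>: "\<omega> \<in> space M"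
    let ?a = "\<bar>shift_effect u v \<omega>\<bar>"
    have "0 \<le> (?a - 21 * s / 2)\<^sup>2" by simp
    then have "?a * (21 * s) \<le> ?a\<^sup>2 + (21 * s / 4) * (21 * s)"
      by (simp add: power2_diff power2_eq_square algebra_simps)
    then have "?a \<le> (?a\<^sup>2 + (21 * s / 4) * (21 * s)) / (21 * s)"
      using s by (subst pos_le_divide_eq) auto
    also have "\<dots> = ?a\<^sup>2 / (21 * s) + 21 * s / 4" using s by (simp add: add_divide_distrib)
    finally have "Y \<omega> * ?a \<le> Y \<omega> * (?a\<^sup>2 / (21 * s) + 21 * s / 4)"
      using Y(2)[OF \<omega>] by (intro mult_left_mono)
    then show "Y \<omega> * ?a ^ 1 \<le> Y \<omega> * ?a\<^sup>2 / (21 * s) + Y \<omega> * (21 * s / 4)"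
      by (simp add: distrib_left)
  qed (use iY i2 in auto)
  also have "\<dots> = (\<integral>\<omega>. Y \<omega> * \<bar>shift_effect u v \<omega>\<bar>\<^sup>2 \<partial>M) / (21 * s) + (\<integral>\<omega>. Y \<omega> \<partial>M) * (21 * s / 4)"
    using iY i2 by simp
  also have "\<dots> \<le> 112 * (s * s) * (\<integral>\<omega>. Y \<omega> \<partial>M) / (21 * s) + (\<integral>\<omega>. Y \<omega> \<partial>M) * (21 * s / 4)"
    using mom_boundD[OF mom_bound_2 uv Y] uv s ss by (intro add_right_mono divide_right_mono) (auto simp: mult_ac)
  also have "\<dots> = (112 / 21 + 21 / 4) * (s * (\<integral>\<omega>. Y \<omega> \<partial>M))" using s by (simp add: field_simps)
  also have "\<dots> \<le> 11 * (s * (\<integral>\<omega>. Y \<omega> \<partial>M))" using s m0 by (intro mult_right_mono) auto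
  finally show "(\<integral>\<omega>. Y \<omega> * \<bar>shift_effect u v \<omega>\<bar> ^ 1 \<partial>M) \<le> 11 * R * sqrt (v - u) ^ 1 * (\<integral>\<omega>. Y \<omega> \<partial>M)"
    by (simp add: s_def mult_ac)
qed

lemma shift_effect_split:
  assumes "u \<le> w" "w \<le> v" and \<omega>[measurable]: "\<omega> \<in> space M"
  shows "shift_effect u v \<omega> = shift_effect u w \<omega> + shift_effect w v \<omega>"
proof -
  have eq: "shift_effect a b \<omega> = (\<integral>t. indicator {a..b} t * path_diff t \<omega> \<partial>lborel)" for a b
    unfolding shift_effect_def lborel_on_def by (subst integral_density) auto
  have i: "integrable lborel (\<lambda>t. indicator {a..b} t * path_diff t \<omega>)" for a b
    using integrable_path_diff[OF \<omega>, of a b] unfolding lborel_on_def by (subst (asm) integrable_density) auto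
  have "shift_effect u v \<omega> = (\<integral>t. indicator {u..w} t * path_diff t \<omega> + indicator {w..v} t * path_diff t \<omega> \<partial>lborel)"
    unfolding eq
  proof (rule integral_cong_AE)
    show "AE t in lborel. indicator {u..v} t * path_diff t \<omega> = indicator {u..w} t * path_diff t \<omega> + indicator {w..v} t * path_diff t \<omega>"
      using AE_lborel_singleton[of w] by eventually_elim (use assms in \<open>auto simp: indicator_def\<close>)
  qed measurable
  then show ?thesis using i by (simp add: eq)
qed

text \<open>Expanding \<open>\<bar>A u w + A w v\<bar> ^ n\<close> at the midpoint \<open>w\<close>: the bound \<open>K\<close> itself reappears with the factor
\<open>2 / sqrt 2 ^ n\<close>, from the two extreme terms, and all other terms involve lower moments only.\<close>

lemma mom_bound_bisect:
  assumes n: "n \<ge> 1" and \<kappa>: "\<And>k. k < n \<Longrightarrow> 0 < k \<Longrightarrow> mom_bound k (\<kappa> k)" and K: "mom_bound n K"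
    and \<kappa>0: "\<And>k. 0 \<le> \<kappa> k" and K0: "0 \<le> K"
  shows "mom_bound n ((2 * K + (\<Sum>k\<in>{0<..<n}. real (n choose k) * \<kappa> k * \<kappa> (n - k))) / sqrt 2 ^ n)"
proof (rule mom_boundI)
  fix u v :: real and Y :: "'a \<Rightarrow> real" and B :: real
  assume uv: "0 \<le> u" "u < v" "v \<le> 1" and Y: "Y \<in> borel_measurable (F u)"
    "\<And>\<omega>. \<omega> \<in> space M \<Longrightarrow> 0 \<le> Y \<omega>" "\<And>\<omega>. \<omega> \<in> space M \<Longrightarrow> Y \<omega> \<le> B"
  define \<nu> where "\<nu> k = (if k = 0 then 1 else if k = n then K else \<kappa> k)" for k
  have \<nu>: "mom_bound k (\<nu> k)" if "k \<le> n" for k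
    using that \<kappa>[of k] K mom_bound_trivial[of 0] by (auto simp: \<nu>_def)
  have \<nu>0: "0 \<le> \<nu> k" for k using \<kappa>0 K0 by (simp add: \<nu>_def)
  have [measurable]: "Y \<in> borel_measurable M" by (rule borel_measurable_F_M[OF Y(1)])
  define w where "w = (u + v) / 2"
  have w: "0 \<le> w" "u < w" "w < v" "w \<le> 1" using uv by (auto simp: w_def)
  define s where "s = sqrt (v - u) / sqrt 2"
  have "w - u = (v - u) / 2" "v - w = (v - u) / 2" by (simp_all add: w_def field_simps)
  then have s: "sqrt (w - u) = s" "sqrt (v - w) = s" by (simp_all only: s_def real_sqrt_divide)
  have s0: "s \<ge> 0" using uv by (simp add: s_def)
  let ?m = "\<integral>\<omega>. Y \<omega> \<partial>M"
  let ?D1 = "\<lambda>\<omega>. \<bar>shift_effect u w \<omega>\<bar>" and ?D2 = "\<lambda>\<omega>. \<bar>shift_effect w v \<omega>\<bar>"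
  have YD: "(\<lambda>\<omega>. Y \<omega> * ?D1 \<omega> ^ k) \<in> borel_measurable (F w)" "\<And>\<omega>. \<omega> \<in> space M \<Longrightarrow> 0 \<le> Y \<omega> * ?D1 \<omega> ^ k"
    "\<And>\<omega>. \<omega> \<in> space M \<Longrightarrow> Y \<omega> * ?D1 \<omega> ^ k \<le> B * 2 ^ k" for k
  proof -
    have "Y \<in> borel_measurable (F w)" by (rule borel_measurable_F_mono[OF Y(1)]) (use w in auto)
    then show "(\<lambda>\<omega>. Y \<omega> * ?D1 \<omega> ^ k) \<in> borel_measurable (F w)"
      using shift_effect_adapted[OF uv(1) less_imp_le[OF w(2)] w(4)] by measurable
    fix \<omega> assume \<omega>: "\<omega> \<in> space M"
    show "0 \<le> Y \<omega> * ?D1 \<omega> ^ k" using Y(2)[OF \<omega>] by simp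
    show "Y \<omega> * ?D1 \<omega> ^ k \<le> B * 2 ^ k"
      using Y(2,3)[OF \<omega>] shift_effect_pow_le(2)[OF uv(1) w(2,4) \<omega>, of k] by (intro mult_mono) auto
  qed
  have YDM[measurable]: "(\<lambda>\<omega>. Y \<omega> * ?D1 \<omega> ^ k) \<in> borel_measurable M" for k by measurable
  have i: "integrable M (\<lambda>\<omega>. Y \<omega> * ?D1 \<omega> ^ k * ?D2 \<omega> ^ l)" for k l
    by (rule integrable_Y_pow[OF w(1,3) uv(3) YDM YD(2,3)])
  have summand: "(\<integral>\<omega>. Y \<omega> * ?D1 \<omega> ^ k * ?D2 \<omega> ^ (n - k) \<partial>M) \<le> \<nu> k * \<nu> (n - k) * s ^ n * ?m" if "k \<le> n" for k
  proof -
    have "(\<integral>\<omega>. Y \<omega> * ?D1 \<omega> ^ k * ?D2 \<omega> ^ (n - k) \<partial>M) \<le> \<nu> (n - k) * s ^ (n - k) * (\<integral>\<omega>. Y \<omega> * ?D1 \<omega> ^ k \<partial>M)"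
      using mom_boundD[OF \<nu>[of "n - k"] w(1,3) uv(3) YD] by (simp add: s)
    also have "\<dots> \<le> \<nu> (n - k) * s ^ (n - k) * (\<nu> k * s ^ k * ?m)"
      using mom_boundD[OF \<nu>[OF that] uv(1) w(2,4) Y] \<nu>0 s0 by (intro mult_left_mono) (auto simp: s)
    also have "\<dots> = \<nu> k * \<nu> (n - k) * (s ^ (n - k) * s ^ k) * ?m" by simp
    also have "s ^ (n - k) * s ^ k = s ^ n" using that by (simp add: power_add[symmetric])
    finally show ?thesis .
  qed
  have "(\<integral>\<omega>. Y \<omega> * \<bar>shift_effect u v \<omega>\<bar> ^ n \<partial>M) \<le> (\<integral>\<omega>. (\<Sum>k\<le>n. real (n choose k) * (Y \<omega> * ?D1 \<omega> ^ k * ?D2 \<omega> ^ (n - k))) \<partial>M)"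
  proof (rule integral_mono[OF integrable_Y_pow[OF uv _ Y(2,3)]])
    fix \<omega> assume \<omega>: "\<omega> \<in> space M"
    have "\<bar>shift_effect u v \<omega>\<bar> \<le> ?D1 \<omega> + ?D2 \<omega>" using shift_effect_split[of u w v \<omega>] w \<omega> by simp
    then have "\<bar>shift_effect u v \<omega>\<bar> ^ n \<le> (?D1 \<omega> + ?D2 \<omega>) ^ n" by (intro power_mono) auto
    also have "\<dots> = (\<Sum>k\<le>n. real (n choose k) * ?D1 \<omega> ^ k * ?D2 \<omega> ^ (n - k))" by (rule binomial_ring)
    finally have "Y \<omega> * \<bar>shift_effect u v \<omega>\<bar> ^ n \<le> Y \<omega> * (\<Sum>k\<le>n. real (n choose k) * ?D1 \<omega> ^ k * ?D2 \<omega> ^ (n - k))"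
      using Y(2)[OF \<omega>] by (intro mult_left_mono)
    then show "Y \<omega> * \<bar>shift_effect u v \<omega>\<bar> ^ n \<le> (\<Sum>k\<le>n. real (n choose k) * (Y \<omega> * ?D1 \<omega> ^ k * ?D2 \<omega> ^ (n - k)))"
      by (simp add: sum_distrib_left mult_ac)
  qed (use i in auto)
  also have "\<dots> = (\<Sum>k\<le>n. real (n choose k) * (\<integral>\<omega>. Y \<omega> * ?D1 \<omega> ^ k * ?D2 \<omega> ^ (n - k) \<partial>M))"
    using i by (simp add: Bochner_Integration.integral_sum)
  also have "\<dots> \<le> (\<Sum>k\<le>n. real (n choose k) * (\<nu> k * \<nu> (n - k) * s ^ n * ?m))"
    using summand by (intro sum_mono mult_left_mono) auto
  also have "\<dots> = (\<Sum>k\<le>n. real (n choose k) * \<nu> k * \<nu> (n - k)) * (s ^ n * ?m)"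
    unfolding sum_distrib_right by (intro sum.cong) (simp_all add: mult_ac)
  also have "(\<Sum>k\<le>n. real (n choose k) * \<nu> k * \<nu> (n - k)) = 2 * K + (\<Sum>k\<in>{0<..<n}. real (n choose k) * \<nu> k * \<nu> (n - k))"
  proof -
    have "{..n} = insert 0 (insert n {0<..<n})" using n by auto
    then have "(\<Sum>k\<le>n. real (n choose k) * \<nu> k * \<nu> (n - k)) = real (n choose 0) * \<nu> 0 * \<nu> n + (real (n choose n) * \<nu> n * \<nu> 0 + (\<Sum>k\<in>{0<..<n}. real (n choose k) * \<nu> k * \<nu> (n - k)))"
      using n by (simp add: sum.insert)
    then show ?thesis using n by (simp add: \<nu>_def)
  qed
  also have "(\<Sum>k\<in>{0<..<n}. real (n choose k) * \<nu> k * \<nu> (n - k)) = (\<Sum>k\<in>{0<..<n}. real (n choose k) * \<kappa> k * \<kappa> (n - k))"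
    by (intro sum.cong) (auto simp: \<nu>_def)
  finally show "(\<integral>\<omega>. Y \<omega> * \<bar>shift_effect u v \<omega>\<bar> ^ n \<partial>M) \<le> (2 * K + (\<Sum>k\<in>{0<..<n}. real (n choose k) * \<kappa> k * \<kappa> (n - k))) / sqrt 2 ^ n * sqrt (v - u) ^ n * ?m"
    by (simp add: s_def power_divide)
qed

lemma mom_bound_mono: "mom_bound n K \<Longrightarrow> K \<le> K' \<Longrightarrow> mom_bound n K'"
proof (rule mom_boundI)
  fix u v :: real and Y :: "'a \<Rightarrow> real" and B :: real
  assume K: "mom_bound n K" "K \<le> K'" and uv: "0 \<le> u" "u < v" "v \<le> 1" and Y: "Y \<in> borel_measurable (F u)"
    "\<And>\<omega>. \<omega> \<in> space M \<Longrightarrow> 0 \<le> Y \<omega>" "\<And>\<omega>. \<omega> \<in> space M \<Longrightarrow> Y \<omega> \<le> B"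
  have m0: "0 \<le> (\<integral>\<omega>. Y \<omega> \<partial>M)" using Y(2) by (intro integral_nonneg_AE AE_I2)
  have "K * sqrt (v - u) ^ n * (\<integral>\<omega>. Y \<omega> \<partial>M) \<le> K' * sqrt (v - u) ^ n * (\<integral>\<omega>. Y \<omega> \<partial>M)"
    using K m0 uv by (intro mult_right_mono) auto
  with mom_boundD[OF K(1) uv Y] show "(\<integral>\<omega>. Y \<omega> * \<bar>shift_effect u v \<omega>\<bar> ^ n \<partial>M) \<le> K' * sqrt (v - u) ^ n * (\<integral>\<omega>. Y \<omega> \<partial>M)" by linarith
qed

text \<open>For \<open>n \<ge> 3\<close> the factor \<open>2 / sqrt 2 ^ n\<close> is less than \<open>1\<close>, so iterating the bisection from the trivial
bound \<open>2 ^ n\<close> leads to the fixed point.\<close>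

lemma mom_bound_contract:
  fixes q b :: real
  assumes q: "q > 2" and b: "0 \<le> b" and step: "\<And>K. 0 \<le> K \<Longrightarrow> mom_bound n K \<Longrightarrow> mom_bound n ((2 * K + b) / q)"
  shows "mom_bound n (b / (q - 2))"
proof (rule mom_boundI)
  fix u v :: real and Y :: "'a \<Rightarrow> real" and B :: real
  assume uv: "0 \<le> u" "u < v" "v \<le> 1" and Y: "Y \<in> borel_measurable (F u)"
    "\<And>\<omega>. \<omega> \<in> space M \<Longrightarrow> 0 \<le> Y \<omega>" "\<And>\<omega>. \<omega> \<in> space M \<Longrightarrow> Y \<omega> \<le> B"
  define Kf where "Kf = b / (q - 2)"
  define k where "k j = Kf + (2 / q) ^ j * 2 ^ n" for j :: nat
  have Kf0: "Kf \<ge> 0" using q b by (simp add: Kf_def)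
  have k0: "k j \<ge> 0" for j unfolding k_def using Kf0 q by (intro add_nonneg_nonneg mult_nonneg_nonneg) auto
  have fixp: "(2 * Kf + b) / q = Kf" using q by (simp add: Kf_def field_simps)
  have "mom_bound n (k j)" for j
  proof (induction j)
    case 0
    then show ?case using mom_bound_mono[OF mom_bound_trivial, of n "k 0"] Kf0 by (simp add: k_def)
  next
    case (Suc j)
    have "(2 * k j + b) / q = (2 * Kf + b) / q + 2 / q * ((2 / q) ^ j * 2 ^ n)"
      by (simp add: k_def add_divide_distrib distrib_left)
    also have "\<dots> = k (Suc j)" by (simp add: fixp k_def mult.assoc)
    finally show ?case using step[OF k0 Suc] by simp
  qed
  then have "(\<integral>\<omega>. Y \<omega> * \<bar>shift_effect u v \<omega>\<bar> ^ n \<partial>M) \<le> k j * sqrt (v - u) ^ n * (\<integral>\<omega>. Y \<omega> \<partial>M)" for j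
    by (rule mom_boundD[OF _ uv Y])
  moreover have "(\<lambda>j. k j * sqrt (v - u) ^ n * (\<integral>\<omega>. Y \<omega> \<partial>M)) \<longlonglongrightarrow> (Kf + 0 * 2 ^ n) * sqrt (v - u) ^ n * (\<integral>\<omega>. Y \<omega> \<partial>M)"
    unfolding k_def using q by (intro tendsto_intros LIMSEQ_power_zero) auto
  ultimately show "(\<integral>\<omega>. Y \<omega> * \<bar>shift_effect u v \<omega>\<bar> ^ n \<partial>M) \<le> b / (q - 2) * sqrt (v - u) ^ n * (\<integral>\<omega>. Y \<omega> \<partial>M)"
    by (intro LIMSEQ_le_const) (auto simp: Kf_def)
qed

text \<open>This is what makes the factor \<open>1 / 3\<close> in the next lemma propagate; without that factor the induction
step fails for \<open>n = 3\<close>.\<close>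

lemma sqrt_2_power_ge: "n \<ge> 3 \<Longrightarrow> real (n - 1) \<le> 3 * (sqrt 2 ^ n - 2)"
proof (induction n rule: nat_induct_at_least)
  case base
  have "(14/10::real) \<le> sqrt 2" by (rule real_le_rsqrt) (simp add: power2_eq_square)
  then show ?case by (simp add: power3_eq_cube)
next
  case (Suc n)
  have "(14/10::real) \<le> sqrt 2" by (rule real_le_rsqrt) (simp add: power2_eq_square)
  then have 1: "14/10 * sqrt 2 ^ n \<le> sqrt 2 ^ Suc n" unfolding power_Suc by (intro mult_right_mono) auto
  have 2: "real (n - 1) + 6 \<le> 3 * sqrt 2 ^ n" using Suc.IH by simp
  have "a + 1 \<le> 3 * (p - 2)" if "14/10 * q \<le> p" "a + 6 \<le> 3 * q" "0 \<le> a" for a p q :: real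
    using that by auto
  from this[OF 1 2 of_nat_0_le_iff] have "real (n - 1) + 1 \<le> 3 * (sqrt 2 ^ Suc n - 2)" .
  moreover have "real (Suc n - 1) = real (n - 1) + 1" using Suc.hyps by simp
  ultimately show ?case by (simp only:)
qed

lemma mom_bound_all:
  assumes "n \<ge> 1"
  shows "mom_bound n (fact n * (33 * R) ^ n / 3)"
  using assms
proof (induction n rule: less_induct)
  case (less n)
  consider "n = 1" | "n = 2" | "n \<ge> 3" using less.prems by linarith
  then show ?case
  proof cases
    case 1
    then show ?thesis using mom_bound_1 by simp
  next
    case 2
    have "112 * R\<^sup>2 \<le> fact 2 * (33 * R)\<^sup>2 / 3" by (simp add: power_mult_distrib)
    from mom_bound_mono[OF mom_bound_2 this] show ?thesis using 2 by simp
  next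
    case 3
    define \<kappa> where "\<kappa> k = fact k * (33 * R) ^ k / 3" for k
    have \<kappa>0: "0 \<le> \<kappa> k" for k using R_pos by (simp add: \<kappa>_def)
    let ?b = "\<Sum>k\<in>{0<..<n}. real (n choose k) * \<kappa> k * \<kappa> (n - k)"
    have b: "?b = real (n - 1) * (fact n * (33 * R) ^ n / 9)"
    proof -
      have "real (n choose k) * \<kappa> k * \<kappa> (n - k) = fact n * (33 * R) ^ n / 9" if "k \<in> {0<..<n}" for k
      proof -
        have "fact k * fact (n - k) * (n choose k) = (fact n :: nat)" using that by (intro binomial_fact_lemma) auto
        then have f: "fact k * fact (n - k) * real (n choose k) = fact n"
          by (metis of_nat_fact of_nat_mult)
        have "(33 * R) ^ k * (33 * R) ^ (n - k) = (33 * R) ^ n" using that by (simp only: power_add[symmetric]) simp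
        then have "real (n choose k) * \<kappa> k * \<kappa> (n - k) = (fact k * fact (n - k) * real (n choose k)) * ((33 * R) ^ n) / 9"
          unfolding \<kappa>_def by (simp del: power_mult_distrib)
        then show ?thesis by (simp add: f)
      qed
      then have "?b = (\<Sum>k\<in>{0<..<n}. fact n * (33 * R) ^ n / 9)" by (intro sum.cong) auto
      then show ?thesis by simp
    qed
    have b0: "0 \<le> ?b" using \<kappa>0 by (intro sum_nonneg) auto
    have q: "sqrt 2 ^ n > 2" using sqrt_2_power_ge[OF 3] 3 by auto
    have "mom_bound n (?b / (sqrt 2 ^ n - 2))"
    proof (rule mom_bound_contract[OF q b0])
      fix K assume "0 \<le> K" "mom_bound n K"
      then show "mom_bound n ((2 * K + ?b) / sqrt 2 ^ n)"
        by (intro mom_bound_bisect) (use 3 less.IH \<kappa>0 in \<open>auto simp: \<kappa>_def\<close>)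
    qed
    moreover have "?b / (sqrt 2 ^ n - 2) \<le> fact n * (33 * R) ^ n / 3"
    proof -
      have "real (n - 1) * (fact n * (33 * R) ^ n / 9) \<le> 3 * (sqrt 2 ^ n - 2) * (fact n * (33 * R) ^ n / 9)"
        using sqrt_2_power_ge[OF 3] R_pos by (intro mult_right_mono) auto
      then show ?thesis using q unfolding b by (subst pos_divide_le_eq) (auto simp: field_simps)
    qed
    ultimately show ?thesis by (rule mom_bound_mono)
  qed
qed

text \<open>With this \<open>\<mu>\<close> the exponential series is dominated by the geometric series with ratio \<open>1 / 2\<close>.\<close>

lemma exp_moment:
  assumes uv: "0 \<le> u" "u < v" "v \<le> 1" and Y: "Y \<in> borel_measurable (F u)"
    "\<And>\<omega>. \<omega> \<in> space M \<Longrightarrow> 0 \<le> Y \<omega>" "\<And>\<omega>. \<omega> \<in> space M \<Longrightarrow> Y \<omega> \<le> B"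
    and \<mu>: "\<mu> = 1 / (66 * R * sqrt (v - u))"
  shows "(\<integral>\<omega>. Y \<omega> * exp (\<mu> * \<bar>shift_effect u v \<omega>\<bar>) \<partial>M) \<le> 2 * (\<integral>\<omega>. Y \<omega> \<partial>M)"
proof -
  have [measurable]: "Y \<in> borel_measurable M" by (rule borel_measurable_F_M[OF Y(1)])
  have m0: "0 \<le> (\<integral>\<omega>. Y \<omega> \<partial>M)" using Y(2) by (intro integral_nonneg_AE AE_I2)
  have iY: "integrable M Y" by (rule integrable_bounded_nonneg[OF _ Y(2,3)]) measurable
  have \<mu>0: "\<mu> > 0" using R_pos uv \<mu> by simp
  let ?t = "\<lambda>k \<omega>. \<mu> ^ k / fact k * (Y \<omega> * \<bar>shift_effect u v \<omega>\<bar> ^ k)"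
  have t0: "0 \<le> ?t k \<omega>" if "\<omega> \<in> space M" for k \<omega> using Y(2)[OF that] \<mu>0 by simp
  have it: "integrable M (?t k)" for k
    by (intro integrable_mult_right integrable_Y_pow[OF uv _ Y(2,3)]) measurable
  have tk: "(\<integral>\<omega>. ?t k \<omega> \<partial>M) \<le> (1/2) ^ k * (\<integral>\<omega>. Y \<omega> \<partial>M)" for k
  proof (cases "k = 0")
    case False
    have "(\<integral>\<omega>. ?t k \<omega> \<partial>M) = \<mu> ^ k / fact k * (\<integral>\<omega>. Y \<omega> * \<bar>shift_effect u v \<omega>\<bar> ^ k \<partial>M)" by simp
    also have "\<dots> \<le> \<mu> ^ k / fact k * (fact k * (33 * R) ^ k / 3 * sqrt (v - u) ^ k * (\<integral>\<omega>. Y \<omega> \<partial>M))"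
      using False \<mu>0 by (intro mult_left_mono mom_boundD[OF mom_bound_all uv Y]) auto
    also have "\<dots> = (\<mu> * (33 * R) * sqrt (v - u)) ^ k * (\<integral>\<omega>. Y \<omega> \<partial>M) / 3"
      by (simp add: power_mult_distrib)
    also have "\<mu> * (33 * R) * sqrt (v - u) = 1 / 2" using R_pos uv by (simp add: \<mu> field_simps)
    also have "(1 / 2) ^ k * (\<integral>\<omega>. Y \<omega> \<partial>M) / 3 \<le> (1/2) ^ k * (\<integral>\<omega>. Y \<omega> \<partial>M)" using m0 by simp
    finally show ?thesis .
  qed simp
  have "(\<integral>\<^sup>+\<omega>. ennreal (Y \<omega> * exp (\<mu> * \<bar>shift_effect u v \<omega>\<bar>)) \<partial>M) = (\<integral>\<^sup>+\<omega>. (\<Sum>k. ennreal (?t k \<omega>)) \<partial>M)"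
  proof (rule nn_integral_cong)
    fix \<omega> assume \<omega>: "\<omega> \<in> space M"
    have "(\<lambda>k. Y \<omega> * ((\<mu> * \<bar>shift_effect u v \<omega>\<bar>) ^ k /\<^sub>R fact k)) sums (Y \<omega> * exp (\<mu> * \<bar>shift_effect u v \<omega>\<bar>))"
      by (intro sums_mult exp_converges)
    also have "(\<lambda>k. Y \<omega> * ((\<mu> * \<bar>shift_effect u v \<omega>\<bar>) ^ k /\<^sub>R fact k)) = (\<lambda>k. ?t k \<omega>)"
      by (simp add: fun_eq_iff power_mult_distrib field_simps)
    finally have s: "(\<lambda>k. ?t k \<omega>) sums (Y \<omega> * exp (\<mu> * \<bar>shift_effect u v \<omega>\<bar>))" .
    then show "ennreal (Y \<omega> * exp (\<mu> * \<bar>shift_effect u v \<omega>\<bar>)) = (\<Sum>k. ennreal (?t k \<omega>))"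
      using t0[OF \<omega>] by (subst suminf_ennreal2) (auto simp: sums_iff)
  qed
  also have "\<dots> = (\<Sum>k. (\<integral>\<^sup>+\<omega>. ennreal (?t k \<omega>) \<partial>M))"
    by (rule nn_integral_suminf) measurable
  also have "\<dots> = (\<Sum>k. ennreal (\<integral>\<omega>. ?t k \<omega> \<partial>M))"
    using it t0 by (subst nn_integral_eq_integral) (auto intro!: AE_I2)
  also have "\<dots> \<le> (\<Sum>k. ennreal ((1/2) ^ k * (\<integral>\<omega>. Y \<omega> \<partial>M)))"
    by (intro suminf_le ennreal_leI tk) auto
  also have "\<dots> = ennreal (\<Sum>k. (1/2) ^ k * (\<integral>\<omega>. Y \<omega> \<partial>M))"
    using m0 by (intro suminf_ennreal2) (auto intro!: summable_mult2 summable_geometric)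
  also have "(\<Sum>k. (1/2) ^ k * (\<integral>\<omega>. Y \<omega> \<partial>M)) = 2 * (\<integral>\<omega>. Y \<omega> \<partial>M)"
    by (subst suminf_mult2[symmetric]) (auto simp: suminf_geometric intro!: summable_geometric)
  finally have nn: "(\<integral>\<^sup>+\<omega>. ennreal (Y \<omega> * exp (\<mu> * \<bar>shift_effect u v \<omega>\<bar>)) \<partial>M) \<le> ennreal (2 * (\<integral>\<omega>. Y \<omega> \<partial>M))" .
  have "(\<integral>\<omega>. Y \<omega> * exp (\<mu> * \<bar>shift_effect u v \<omega>\<bar>) \<partial>M) = enn2real (\<integral>\<^sup>+\<omega>. ennreal (Y \<omega> * exp (\<mu> * \<bar>shift_effect u v \<omega>\<bar>)) \<partial>M)"
    using Y(2) by (intro integral_eq_nn_integral) (auto intro!: AE_I2)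
  also have "\<dots> \<le> 2 * (\<integral>\<omega>. Y \<omega> \<partial>M)" using nn m0 by (intro enn2real_leI) auto
  finally show ?thesis .
qed

lemma exp_shift_effect_bounded:
  assumes "u \<le> v" "\<omega> \<in> space M" "\<mu> \<ge> 0"
  shows "exp (\<mu> * \<bar>shift_effect u v \<omega>\<bar>) \<le> exp (\<mu> * (2 * (v - u)))"
  using shift_effect_le[OF assms(1,2)] assms(3) by (simp add: mult_left_mono)

lemma exp_moment_pieces:
  assumes u: "0 \<le> u" and d: "d > 0" and j: "u + real j * d \<le> 1" and \<mu>: "\<mu> = 1 / (66 * R * sqrt d)"
  shows "(\<integral>\<omega>. exp (\<mu> * \<bar>shift_effect u (u + real j * d) \<omega>\<bar>) \<partial>M) \<le> 2 ^ j"
  using j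
proof (induction j)
  case 0
  have "shift_effect u u \<omega> = 0" if "\<omega> \<in> space M" for \<omega> using shift_effect_split[of u u u \<omega>] that by simp
  then have "(\<integral>\<omega>. exp (\<mu> * \<bar>shift_effect u (u + real 0 * d) \<omega>\<bar>) \<partial>M) = (\<integral>\<omega>. 1 \<partial>M)"
    by (intro Bochner_Integration.integral_cong) auto
  then show ?case by (simp add: prob_space)
next
  case (Suc j)
  define w where "w = u + real j * d"
  have wd: "u + real (Suc j) * d = w + d" by (simp add: w_def algebra_simps)
  have w: "u \<le> w" "w < w + d" "w + d \<le> 1" "0 \<le> w" "w \<le> 1"
    using u d Suc.prems by (auto simp: w_def algebra_simps)
  have \<mu>0: "\<mu> \<ge> 0" using \<mu> R_pos d by simp
  let ?Y = "\<lambda>\<omega>. exp (\<mu> * \<bar>shift_effect u w \<omega>\<bar>)"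
  have "(\<integral>\<omega>. exp (\<mu> * \<bar>shift_effect u (w + d) \<omega>\<bar>) \<partial>M) \<le> (\<integral>\<omega>. ?Y \<omega> * exp (\<mu> * \<bar>shift_effect w (w + d) \<omega>\<bar>) \<partial>M)"
  proof (rule integral_mono)
    show "integrable M (\<lambda>\<omega>. exp (\<mu> * \<bar>shift_effect u (w + d) \<omega>\<bar>))"
      by (rule integrable_bounded_nonneg[OF _ _ exp_shift_effect_bounded]) (use w \<mu>0 in auto)
    show "integrable M (\<lambda>\<omega>. ?Y \<omega> * exp (\<mu> * \<bar>shift_effect w (w + d) \<omega>\<bar>))"
      by (rule integrable_bounded_nonneg[OF _ _ mult_mono[OF exp_shift_effect_bounded exp_shift_effect_bounded]]) (use w \<mu>0 in auto)
    fix \<omega> assume \<omega>: "\<omega> \<in> space M"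
    have "\<mu> * \<bar>shift_effect u (w + d) \<omega>\<bar> \<le> \<mu> * (\<bar>shift_effect u w \<omega>\<bar> + \<bar>shift_effect w (w + d) \<omega>\<bar>)"
      using shift_effect_split[of u w "w + d" \<omega>] w \<omega> \<mu>0 by (intro mult_left_mono) auto
    then show "exp (\<mu> * \<bar>shift_effect u (w + d) \<omega>\<bar>) \<le> ?Y \<omega> * exp (\<mu> * \<bar>shift_effect w (w + d) \<omega>\<bar>)"
      by (simp add: exp_add[symmetric] distrib_left)
  qed
  also have "\<dots> \<le> 2 * (\<integral>\<omega>. ?Y \<omega> \<partial>M)"
  proof (rule exp_moment[OF w(4,2,3)])
    show "?Y \<in> borel_measurable (F w)"
      using shift_effect_adapted[OF u w(1,5)] by measurable
    show "?Y \<omega> \<le> exp (\<mu> * (2 * (w - u)))" if "\<omega> \<in> space M" for \<omega> by (rule exp_shift_effect_bounded[OF w(1) that \<mu>0])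
  qed (auto simp: \<mu>)
  also have "\<dots> \<le> 2 * 2 ^ j" using Suc.IH w by (auto simp: w_def)
  finally show ?case by (simp only: wd power_Suc)
qed

text \<open>The number \<open>N\<close> of pieces is free. A choice of order \<open>x\<^sup>2 / (R\<^sup>2 * (v - u))\<close> turns the bound into a
Gaussian one.\<close>

lemma shift_effect_tail:
  assumes uv: "0 \<le> u" "u < v" "v \<le> 1" and N: "N \<ge> 1"
  shows "prob {\<omega>\<in>space M. x \<le> \<bar>shift_effect u v \<omega>\<bar>} \<le> 2 ^ N * exp (- (x * sqrt (real N) / (66 * R * sqrt (v - u))))"
proof -
  define d where "d = (v - u) / real N"
  define \<mu> where "\<mu> = 1 / (66 * R * sqrt d)"
  have d: "d > 0" "u + real N * d = v" using uv N by (auto simp: d_def)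
  have \<mu>0: "\<mu> > 0" using R_pos d by (simp add: \<mu>_def)
  let ?E = "\<lambda>\<omega>. exp (\<mu> * \<bar>shift_effect u v \<omega>\<bar>)"
  have E: "(\<integral>\<omega>. ?E \<omega> \<partial>M) \<le> 2 ^ N"
    using exp_moment_pieces[OF uv(1) d(1), of N \<mu>] d uv by (simp add: \<mu>_def)
  have iE: "integrable M ?E"
    by (rule integrable_bounded_nonneg[OF _ _ exp_shift_effect_bounded]) (use uv \<mu>0 in auto)
  have "prob {\<omega>\<in>space M. x \<le> \<bar>shift_effect u v \<omega>\<bar>} = prob {\<omega>\<in>space M. exp (\<mu> * x) \<le> ?E \<omega>}"
    using \<mu>0 by simp
  also have "\<dots> \<le> (\<integral>\<omega>. ?E \<omega> \<partial>M) / exp (\<mu> * x)"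
    by (rule integral_Markov_inequality_measure[OF iE, where A="{}"]) auto
  also have "\<dots> \<le> 2 ^ N / exp (\<mu> * x)" using E by (intro divide_right_mono) auto
  also have "\<dots> = 2 ^ N * exp (- (\<mu> * x))" by (simp add: exp_minus divide_inverse)
  also have "\<mu> * x = x * sqrt (real N) / (66 * R * sqrt (v - u))"
    using N by (simp add: \<mu>_def d_def real_sqrt_divide)
  finally show ?thesis .
qed

end

section \<open>Independence of uncorrelated Gaussian variables\<close>

context prob_space
begin

lemma integrable_complex_bounded:
  fixes w :: "'a \<Rightarrow> complex"
  assumes "w \<in> borel_measurable M" "\<And>\<omega>. norm (w \<omega>) \<le> K"
  shows "integrable M w"
  by (rule integrable_const_bound[of _ K]) (use assms in auto)

lemma integrable_iexp_real:
  assumes [measurable]: "h \<in> borel_measurable M"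
  shows "integrable M (\<lambda>\<omega>. iexp (h \<omega>))"
  by (rule integrable_complex_bounded[of _ 1]) auto

text \<open>A finite signed measure on the line is determined by its Fourier transform; here the measure is the image
of \<open>w\<close> under \<open>Y\<close>.\<close>

lemma char_zero_imp_zero_real:
  fixes w :: "'a \<Rightarrow> real"
  assumes [measurable]: "w \<in> borel_measurable M" "Y \<in> borel_measurable M" "B \<in> sets borel"
    and K: "\<And>\<omega>. \<bar>w \<omega>\<bar> \<le> K"
    and z: "\<And>t::real. (\<integral>\<omega>. of_real (w \<omega>) * iexp (t * Y \<omega>) \<partial>M) = 0"
  shows "(\<integral>\<omega>. w \<omega> * indicator B (Y \<omega>) \<partial>M) = 0"
proof -
  define L where "L = \<bar>K\<bar> + 1"
  have L: "L > 0" "\<And>\<omega>. \<bar>w \<omega>\<bar> \<le> L" using order_trans[OF K, of "\<bar>K\<bar> + 1"] by (auto simp: L_def)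
  \<comment> \<open>The uniqueness theorem is applied to the laws of \<open>Y\<close> under \<open>M\<close> and under the probability density \<open>1 + w / L\<close>.\<close>
  define D where "D \<omega> = 1 + w \<omega> / L" for \<omega>
  have [measurable]: "D \<in> borel_measurable M" unfolding D_def by measurable
  have D0: "0 \<le> D \<omega>" for \<omega>
  proof -
    have "- L \<le> w \<omega>" using L(2)[of \<omega>] by linarith
    then have "- 1 \<le> w \<omega> / L" using L(1) by (simp add: pos_le_divide_eq)
    then show ?thesis by (simp add: D_def)
  qed
  have iw: "integrable M w" by (rule integrable_const_bound[of _ K]) (use K in auto)
  have w0: "(\<integral>\<omega>. w \<omega> \<partial>M) = 0"
    using z[of 0] by (simp add: of_real_eq_0_iff[symmetric, where 'a=complex] del: of_real_eq_0_iff)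
  have iD: "integrable M D" unfolding D_def using iw by simp
  have ED: "(\<integral>\<omega>. D \<omega> \<partial>M) = 1" unfolding D_def using iw w0 by (simp add: prob_space)
  let ?M1 = "density M (\<lambda>\<omega>. ennreal (D \<omega>))"
  interpret M1: prob_space ?M1
  proof (rule prob_spaceI)
    have "emeasure ?M1 (space ?M1) = (\<integral>\<^sup>+\<omega>. ennreal (D \<omega>) \<partial>M)"
      by (simp add: emeasure_density cong: nn_integral_cong)
    also have "\<dots> = 1" using iD D0 ED by (subst nn_integral_eq_integral) auto
    finally show "emeasure ?M1 (space ?M1) = 1" .
  qed
  have "distr ?M1 borel Y = distr M borel Y"
  proof (rule Levy_uniqueness)
    show "real_distribution (distr ?M1 borel Y)" by (rule M1.real_distribution_distr) simp
    show "real_distribution (distr M borel Y)" by (rule real_distribution_distr) simp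
    show "char (distr ?M1 borel Y) = char (distr M borel Y)"
    proof
      fix t
      have i1: "integrable M (\<lambda>\<omega>. iexp (t * Y \<omega>))"
        by (rule integrable_complex_bounded[of _ 1]) auto
      have i2: "integrable M (\<lambda>\<omega>. of_real (w \<omega>) * iexp (t * Y \<omega>))"
        by (rule integrable_complex_bounded[of _ K]) (use K in \<open>auto simp: norm_mult\<close>)
      have "char (distr ?M1 borel Y) t = (\<integral>\<omega>. D \<omega> *\<^sub>R iexp (t * Y \<omega>) \<partial>M)"
        unfolding char_def by (subst integral_distr, simp, simp, subst integral_density) (use D0 in auto)
      also have "\<dots> = (\<integral>\<omega>. iexp (t * Y \<omega>) + (of_real (w \<omega>) * iexp (t * Y \<omega>)) / of_real L \<partial>M)"
        by (intro Bochner_Integration.integral_cong) (auto simp: D_def scaleR_conv_of_real field_simps)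
      also have "\<dots> = (\<integral>\<omega>. iexp (t * Y \<omega>) \<partial>M)" using i1 i2 z[of t] by simp
      also have "\<dots> = char (distr M borel Y) t" unfolding char_def by (subst integral_distr) auto
      finally show "char (distr ?M1 borel Y) t = char (distr M borel Y) t" .
    qed
  qed
  then have "(\<integral>y. indicator B y \<partial>distr ?M1 borel Y) = (\<integral>y. indicator B y \<partial>distr M borel Y :: real)" by simp
  then have eq: "(\<integral>\<omega>. D \<omega> * indicator B (Y \<omega>) \<partial>M) = (\<integral>\<omega>. indicator B (Y \<omega>) \<partial>M)"
    by (subst (asm) integral_distr, simp, simp, subst (asm) integral_distr, simp, simp, subst (asm) integral_density)
       (use D0 in auto)
  have i1: "integrable M (\<lambda>\<omega>. indicator B (Y \<omega>) :: real)"
    by (rule integrable_const_bound[of _ 1]) (auto simp: indicator_def)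
  have i2: "integrable M (\<lambda>\<omega>. w \<omega> * indicator B (Y \<omega>))"
    by (rule integrable_const_bound[of _ L]) (use L in \<open>auto simp: indicator_def\<close>)
  note i3 = i1 i2
  have "(\<integral>\<omega>. D \<omega> * indicator B (Y \<omega>) \<partial>M) = (\<integral>\<omega>. indicator B (Y \<omega>) + w \<omega> * indicator B (Y \<omega>) / L \<partial>M)"
    by (intro Bochner_Integration.integral_cong) (auto simp: D_def field_simps)
  then show ?thesis using eq i3 L by simp
qed

lemma char_zero_imp_zero:
  fixes w :: "'a \<Rightarrow> complex"
  assumes [measurable]: "w \<in> borel_measurable M" "Y \<in> borel_measurable M" "B \<in> sets borel"
    and K: "\<And>\<omega>. norm (w \<omega>) \<le> K"
    and z: "\<And>t::real. (\<integral>\<omega>. w \<omega> * iexp (t * Y \<omega>) \<partial>M) = 0"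
  shows "(\<integral>\<omega>. w \<omega> * indicator B (Y \<omega>) \<partial>M) = 0"
proof -
  have [measurable]: "(\<lambda>\<omega>. cnj (w \<omega>)) \<in> borel_measurable M"
    by (rule measurable_compose[OF assms(1)]) (intro borel_measurable_continuous_onI continuous_intros)
  have i: "integrable M (\<lambda>\<omega>. w \<omega> * iexp (t * Y \<omega>))" "integrable M (\<lambda>\<omega>. cnj (w \<omega>) * iexp (t * Y \<omega>))" for t
    by (rule integrable_complex_bounded[of _ K]; use K in \<open>auto simp: norm_mult\<close>)+
  have z': "(\<integral>\<omega>. cnj (w \<omega>) * iexp (t * Y \<omega>) \<partial>M) = 0" for t
  proof -
    have "(\<integral>\<omega>. cnj (w \<omega>) * iexp (t * Y \<omega>) \<partial>M) = (\<integral>\<omega>. cnj (w \<omega> * iexp (- t * Y \<omega>)) \<partial>M)"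
      by (intro Bochner_Integration.integral_cong) (auto simp: exp_cnj)
    also have "\<dots> = cnj (\<integral>\<omega>. w \<omega> * iexp (- t * Y \<omega>) \<partial>M)" by (rule integral_bounded_linear[OF bounded_linear_cnj i(1)])
    finally show ?thesis using z[of "- t"] by simp
  qed
  have re: "(\<integral>\<omega>. of_real (Re (w \<omega>)) * iexp (t * Y \<omega>) \<partial>M) = 0" for t
  proof -
    have "of_real (Re (w \<omega>)) * iexp (t * Y \<omega>) = (w \<omega> * iexp (t * Y \<omega>) + cnj (w \<omega>) * iexp (t * Y \<omega>)) / 2" for \<omega>
      using complex_add_cnj[of "w \<omega>"] by (simp add: distrib_right[symmetric])
    then have "(\<integral>\<omega>. of_real (Re (w \<omega>)) * iexp (t * Y \<omega>) \<partial>M) = (\<integral>\<omega>. w \<omega> * iexp (t * Y \<omega>) + cnj (w \<omega>) * iexp (t * Y \<omega>) \<partial>M) / 2"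
      by (simp only: integral_divide_zero)
    also have "\<dots> = 0" using Bochner_Integration.integral_add[OF i(1)[of t] i(2)[of t]] z[of t] z'[of t] by (simp only: add_0 diff_self div_0)
    finally show ?thesis .
  qed
  have im: "(\<integral>\<omega>. of_real (Im (w \<omega>)) * iexp (t * Y \<omega>) \<partial>M) = 0" for t
  proof -
    have "of_real (Im (w \<omega>)) * iexp (t * Y \<omega>) = (w \<omega> * iexp (t * Y \<omega>) - cnj (w \<omega>) * iexp (t * Y \<omega>)) / (2 * \<i>)" for \<omega>
    proof -
        have "of_real (Im (w \<omega>)) = (w \<omega> - cnj (w \<omega>)) / (2 * \<i>)" by (simp add: complex_eq_iff)
        then show ?thesis by (simp only: left_diff_distrib times_divide_eq_left)
      qed
    then have "(\<integral>\<omega>. of_real (Im (w \<omega>)) * iexp (t * Y \<omega>) \<partial>M) = (\<integral>\<omega>. w \<omega> * iexp (t * Y \<omega>) - cnj (w \<omega>) * iexp (t * Y \<omega>) \<partial>M) / (2 * \<i>)"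
      by (simp only: integral_divide_zero)
    also have "\<dots> = 0" using Bochner_Integration.integral_diff[OF i(1)[of t] i(2)[of t]] z[of t] z'[of t] by (simp only: add_0 diff_self div_0)
    finally show ?thesis .
  qed
  have "(\<integral>\<omega>. Re (w \<omega>) * indicator B (Y \<omega>) \<partial>M) = 0"
    by (rule char_zero_imp_zero_real[of _ _ _ K]) (use re K in \<open>auto intro: order_trans[OF abs_Re_le_cmod]\<close>)
  moreover have "(\<integral>\<omega>. Im (w \<omega>) * indicator B (Y \<omega>) \<partial>M) = 0"
    by (rule char_zero_imp_zero_real[of _ _ _ K]) (use im K in \<open>auto intro: order_trans[OF abs_Im_le_cmod]\<close>)
  moreover have i2: "integrable M (\<lambda>\<omega>. w \<omega> * indicator B (Y \<omega>))"
    by (rule integrable_complex_bounded[of _ K]) (use K order_trans[OF norm_ge_zero K] in \<open>auto simp: norm_mult indicator_def\<close>)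
  moreover have "Re (w \<omega> * indicator B (Y \<omega>)) = Re (w \<omega>) * indicator B (Y \<omega>)"
    "Im (w \<omega> * indicator B (Y \<omega>)) = Im (w \<omega>) * indicator B (Y \<omega>)" for \<omega>
    by (auto simp: indicator_def)
  ultimately have "Re (\<integral>\<omega>. w \<omega> * indicator B (Y \<omega>) \<partial>M) = 0" "Im (\<integral>\<omega>. w \<omega> * indicator B (Y \<omega>) \<partial>M) = 0"
    using integral_bounded_linear[OF bounded_linear_Re i2] integral_bounded_linear[OF bounded_linear_Im i2]
    by (simp_all only:)
  then show ?thesis by (simp add: complex_eq_iff)
qed

text \<open>If the joint characteristic function splits, then \<open>Z\<close> is independent of the vector of the \<open>V i\<close>. The
exponentials of the \<open>V i\<close> are replaced by indicators one at a time, and that of \<open>Z\<close> last.\<close>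

lemma prob_split_of_char:
  fixes Z :: "'a \<Rightarrow> real" and V :: "'i \<Rightarrow> 'a \<Rightarrow> real"
  assumes I: "finite I" and Z[measurable]: "Z \<in> borel_measurable M" and V: "\<And>i. i \<in> I \<Longrightarrow> V i \<in> borel_measurable M"
    and B[measurable]: "B \<in> sets borel" and Bi: "\<And>i. i \<in> I \<Longrightarrow> Bi i \<in> sets borel"
    and char: "\<And>\<theta> c. (\<integral>\<omega>. iexp (\<theta> * Z \<omega> + (\<Sum>i\<in>I. c i * V i \<omega>)) \<partial>M) =
      (\<integral>\<omega>. iexp (\<theta> * Z \<omega>) \<partial>M) * (\<integral>\<omega>. iexp (\<Sum>i\<in>I. c i * V i \<omega>) \<partial>M)"
  shows "prob {\<omega>\<in>space M. (\<forall>i\<in>I. V i \<omega> \<in> Bi i) \<and> Z \<omega> \<in> B} = prob {\<omega>\<in>space M. \<forall>i\<in>I. V i \<omega> \<in> Bi i} * prob {\<omega>\<in>space M. Z \<omega> \<in> B}"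
proof -
  have ind[measurable]: "i \<in> I \<Longrightarrow> (\<lambda>\<omega>. indicator (Bi i) (V i \<omega>) :: complex) \<in> borel_measurable M" for i
    using V[of i] Bi[of i] by measurable
  have lin[measurable]: "J \<subseteq> I \<Longrightarrow> (\<lambda>\<omega>. \<Sum>i\<in>J. c i * V i \<omega>) \<in> borel_measurable M" for J c
    using V by (intro borel_measurable_sum borel_measurable_times) auto
  define p where "p J \<omega> = (\<Prod>i\<in>J. indicator (Bi i) (V i \<omega>) :: complex)" for J \<omega>
  have pm[measurable]: "J \<subseteq> I \<Longrightarrow> p J \<in> borel_measurable M" for J
    unfolding p_def using ind by (intro borel_measurable_prod) auto
  have p1: "norm (p J \<omega>) \<le> 1" for J \<omega>
    unfolding p_def prod_norm[symmetric] by (rule prod_le_1) (auto simp: indicator_def)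
  let ?A = "{\<omega>\<in>space M. \<forall>i\<in>I. V i \<omega> \<in> Bi i}"
  have A[measurable]: "?A \<in> sets M"
  proof -
    have "{\<omega>\<in>space M. V i \<omega> \<in> Bi i} \<in> sets M" if "i \<in> I" for i
      using measurable_sets[OF V[OF that] Bi[OF that]] by (simp add: vimage_def Int_def conj_commute)
    then show ?thesis using I by (intro sets.sets_Collect_finite_All) auto
  qed
  have pI: "p I \<omega> = indicator ?A \<omega>" if \<omega>: "\<omega> \<in> space M" for \<omega>
  proof (cases "\<omega> \<in> ?A")
    case False
    then obtain i where i: "i \<in> I" "V i \<omega> \<notin> Bi i" using \<omega> by auto
    have "p I \<omega> = 0" unfolding p_def by (rule prod_zero[OF I], rule bexI[OF _ i(1)]) (simp add: i(2))
    then show ?thesis using False by simp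
  qed (auto simp: p_def)
  have fact: "(\<integral>\<omega>. iexp (\<theta> * Z \<omega>) * indicator ?A \<omega> \<partial>M) = (\<integral>\<omega>. iexp (\<theta> * Z \<omega>) \<partial>M) * of_real (prob ?A)" for \<theta>
  proof -
    define e where "e = (\<integral>\<omega>. iexp (\<theta> * Z \<omega>) \<partial>M)"
    define w where "w \<omega> = iexp (\<theta> * Z \<omega>) - e" for \<omega>
    have [measurable]: "w \<in> borel_measurable M" unfolding w_def by measurable
    have wK: "norm (w \<omega>) \<le> 1 + norm e" for \<omega>
      unfolding w_def by (rule order_trans[OF norm_triangle_ineq4]) simp
    have "(\<integral>\<omega>. w \<omega> * p J \<omega> * iexp (\<Sum>i\<in>I - J. c i * V i \<omega>) \<partial>M) = 0" if "J \<subseteq> I" for J c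
      using finite_subset[OF that I] that
    proof (induction J arbitrary: c rule: finite_induct)
      case empty
      have i1: "integrable M (\<lambda>\<omega>. iexp (\<theta> * Z \<omega> + (\<Sum>i\<in>I. c i * V i \<omega>)))"
        by (intro integrable_iexp_real borel_measurable_add lin) auto
      have i2: "integrable M (\<lambda>\<omega>. e * iexp (\<Sum>i\<in>I. c i * V i \<omega>))"
        by (intro integrable_mult_right integrable_iexp_real lin) auto
      note i = i1 i2
      have "(\<integral>\<omega>. w \<omega> * p {} \<omega> * iexp (\<Sum>i\<in>I - {}. c i * V i \<omega>) \<partial>M) =
        (\<integral>\<omega>. iexp (\<theta> * Z \<omega> + (\<Sum>i\<in>I. c i * V i \<omega>)) - e * iexp (\<Sum>i\<in>I. c i * V i \<omega>) \<partial>M)"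
        by (intro Bochner_Integration.integral_cong) (simp_all only: w_def p_def prod.empty mult_1_right Diff_empty left_diff_distrib of_real_add distrib_left exp_add)
      also have "\<dots> = (\<integral>\<omega>. iexp (\<theta> * Z \<omega> + (\<Sum>i\<in>I. c i * V i \<omega>)) \<partial>M) - e * (\<integral>\<omega>. iexp (\<Sum>i\<in>I. c i * V i \<omega>) \<partial>M)"
        using Bochner_Integration.integral_diff[OF i] by (simp only: integral_mult_right_zero)
      also have "\<dots> = 0" unfolding char e_def by simp
      finally show ?case .
    next
      case (insert j J)
      then have j: "j \<in> I" and J: "J \<subseteq> I" by auto
      have IJ: "I - J = insert j (I - insert j J)" "finite (I - insert j J)" "I - insert j J \<subseteq> I" using insert j I by auto
      note [measurable] = V[OF j] Bi[OF j]
      have "(\<integral>\<omega>. (w \<omega> * p J \<omega> * iexp (\<Sum>i\<in>I - insert j J. c i * V i \<omega>)) * indicator (Bi j) (V j \<omega>) \<partial>M) = 0"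
      proof (rule char_zero_imp_zero)
        show "(\<lambda>\<omega>. w \<omega> * p J \<omega> * iexp (\<Sum>i\<in>I - insert j J. c i * V i \<omega>)) \<in> borel_measurable M"
          using pm[OF J] lin[OF IJ(3), of c] by measurable
        show "norm (w \<omega> * p J \<omega> * iexp (\<Sum>i\<in>I - insert j J. c i * V i \<omega>)) \<le> (1 + norm e) * 1" for \<omega>
          unfolding norm_mult using mult_mono[OF wK[of \<omega>] p1[of J \<omega>]] by simp
        fix t :: real
        let ?c = "c(j := t)"
        have "(\<Sum>i\<in>I - J. ?c i * V i \<omega>) = t * V j \<omega> + (\<Sum>i\<in>I - insert j J. c i * V i \<omega>)" for \<omega>
          unfolding IJ(1) using IJ(2) by (subst sum.insert) (auto intro!: sum.cong)
        then have "w \<omega> * p J \<omega> * iexp (\<Sum>i\<in>I - J. ?c i * V i \<omega>) =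
            w \<omega> * p J \<omega> * iexp (\<Sum>i\<in>I - insert j J. c i * V i \<omega>) * iexp (t * V j \<omega>)" for \<omega>
          by (simp only: of_real_add distrib_left exp_add) (simp only: mult_ac)
        then show "(\<integral>\<omega>. (w \<omega> * p J \<omega> * iexp (\<Sum>i\<in>I - insert j J. c i * V i \<omega>)) * iexp (t * V j \<omega>) \<partial>M) = 0"
          using insert.IH[OF J, of ?c] by (simp only:)
      qed measurable
      moreover have "p (insert j J) \<omega> = indicator (Bi j) (V j \<omega>) * p J \<omega>" for \<omega>
        unfolding p_def using insert by simp
      ultimately show ?case by (simp only: mult_ac)
    qed
    from this[of I "\<lambda>_. 0"] have w0: "(\<integral>\<omega>. w \<omega> * p I \<omega> \<partial>M) = 0" by simp
    have i1: "integrable M (\<lambda>\<omega>. iexp (\<theta> * Z \<omega>) * indicator ?A \<omega>)"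
      by (rule integrable_complex_bounded[of _ 1]) (auto simp: indicator_def norm_mult)
    have i2: "integrable M (\<lambda>\<omega>. e * indicator ?A \<omega>)"
      by (rule integrable_complex_bounded[of _ "norm e"]) (auto simp: indicator_def norm_mult)
    note i = i1 i2
    have "(\<integral>\<omega>. w \<omega> * p I \<omega> \<partial>M) = (\<integral>\<omega>. iexp (\<theta> * Z \<omega>) * indicator ?A \<omega> - e * indicator ?A \<omega> \<partial>M)"
      by (intro Bochner_Integration.integral_cong) (simp_all only: pI w_def left_diff_distrib)
    also have "\<dots> = (\<integral>\<omega>. iexp (\<theta> * Z \<omega>) * indicator ?A \<omega> \<partial>M) - e * (\<integral>\<omega>. indicator ?A \<omega> \<partial>M)"
      using Bochner_Integration.integral_diff[OF i] by (simp only: integral_mult_right_zero)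
    also have "(\<integral>\<omega>. indicator ?A \<omega> \<partial>M) = complex_of_real (prob ?A)"
    proof -
      have "(\<integral>\<omega>. indicator ?A \<omega> \<partial>M) = (\<integral>\<omega>. complex_of_real (indicator ?A \<omega>) \<partial>M)"
        by (intro Bochner_Integration.integral_cong) (auto simp: indicator_def)
      also have "\<dots> = complex_of_real (\<integral>\<omega>. indicator ?A \<omega> \<partial>M)"
        by (rule integral_complex_of_real)
      finally show ?thesis by simp
    qed
    finally show ?thesis using w0 unfolding e_def by simp
  qed
  define a where "a = prob ?A"
  have "(\<integral>\<omega>. (indicator ?A \<omega> - a) * indicator B (Z \<omega>) \<partial>M) = 0"
  proof (rule char_zero_imp_zero_real)
    show "\<bar>indicator ?A \<omega> - a\<bar> \<le> 1" for \<omega>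
      unfolding a_def using prob_le_1[of ?A] measure_nonneg[of M ?A] by (auto simp: indicator_def)
    fix t :: real
    have i1: "integrable M (\<lambda>\<omega>. iexp (t * Z \<omega>) * indicator ?A \<omega>)"
      by (rule integrable_complex_bounded[of _ 1]) (auto simp: indicator_def norm_mult)
    have i2: "integrable M (\<lambda>\<omega>. iexp (t * Z \<omega>) * of_real a)"
      by (rule integrable_complex_bounded[of _ "\<bar>a\<bar>"]) (auto simp: norm_mult)
    note i = i1 i2
    have "(\<integral>\<omega>. of_real (indicator ?A \<omega> - a) * iexp (t * Z \<omega>) \<partial>M) = (\<integral>\<omega>. iexp (t * Z \<omega>) * indicator ?A \<omega> - iexp (t * Z \<omega>) * of_real a \<partial>M)"
      by (intro Bochner_Integration.integral_cong) (auto simp: indicator_def algebra_simps)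
    also have "\<dots> = (\<integral>\<omega>. iexp (t * Z \<omega>) * indicator ?A \<omega> \<partial>M) - (\<integral>\<omega>. iexp (t * Z \<omega>) \<partial>M) * of_real a"
      using Bochner_Integration.integral_diff[OF i] by (simp only: integral_mult_left_zero)
    also have "\<dots> = 0" unfolding fact a_def by simp
    finally show "(\<integral>\<omega>. of_real (indicator ?A \<omega> - a) * iexp (t * Z \<omega>) \<partial>M) = 0" .
  qed measurable
  moreover have "(\<integral>\<omega>. (indicator ?A \<omega> - a) * indicator B (Z \<omega>) \<partial>M) =
      (\<integral>\<omega>. indicator {\<omega>\<in>space M. (\<forall>i\<in>I. V i \<omega> \<in> Bi i) \<and> Z \<omega> \<in> B} \<omega> - a * indicator {\<omega>\<in>space M. Z \<omega> \<in> B} \<omega> \<partial>M)"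
    by (intro Bochner_Integration.integral_cong) (auto simp: indicator_def)
  moreover have S: "{\<omega>\<in>space M. (\<forall>i\<in>I. V i \<omega> \<in> Bi i) \<and> Z \<omega> \<in> B} \<in> sets M"
  proof -
    have "{\<omega>\<in>space M. (\<forall>i\<in>I. V i \<omega> \<in> Bi i) \<and> Z \<omega> \<in> B} = ?A \<inter> (Z -` B \<inter> space M)" by auto
    then show ?thesis by simp
  qed
  moreover have "{\<omega>\<in>space M. Z \<omega> \<in> B} \<in> sets M" by measurable
  ultimately show ?thesis
    by (simp add: a_def emeasure_eq_measure)
qed

end

text \<open>The sigma-algebra generated by a set of real random variables, presented by the
  pi-system of its finite-dimensional cylinders.\<close>

definition gen_alg :: "'a measure \<Rightarrow> ('a \<Rightarrow> real) set \<Rightarrow> 'a measure" where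
  "gen_alg M \<V> = sigma (space M)
     {{\<omega>\<in>space M. \<forall>V\<in>I. V \<omega> \<in> Bi V} |I Bi. finite I \<and> I \<subseteq> \<V> \<and> (\<forall>V. Bi V \<in> sets borel)}"

lemma gen_alg_subset: "{{\<omega>\<in>space M. \<forall>V\<in>I. V \<omega> \<in> Bi V} |I Bi. finite I \<and> I \<subseteq> \<V> \<and> (\<forall>V. Bi V \<in> sets borel)} \<subseteq> Pow (space M)"
  by auto

lemma space_gen_alg [simp]: "space (gen_alg M \<V>) = space M"
  unfolding gen_alg_def by (rule space_measure_of[OF gen_alg_subset])

lemma sets_gen_alg: "sets (gen_alg M \<V>) = sigma_sets (space M)
     {{\<omega>\<in>space M. \<forall>V\<in>I. V \<omega> \<in> Bi V} |I Bi. finite I \<and> I \<subseteq> \<V> \<and> (\<forall>V. Bi V \<in> sets borel)}"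
  unfolding gen_alg_def by (rule sets_measure_of[OF gen_alg_subset])

lemma sets_gen_alg_mono: "\<V> \<subseteq> \<V>' \<Longrightarrow> sets (gen_alg M \<V>) \<subseteq> sets (gen_alg M \<V>')"
  unfolding sets_gen_alg by (rule sigma_sets_mono') blast

lemma measurable_gen_alg: "V \<in> \<V> \<Longrightarrow> V \<in> borel_measurable (gen_alg M \<V>)"
proof (rule measurableI)
  fix B :: "real set" assume V: "V \<in> \<V>" and B: "B \<in> sets borel"
  have "V -` B \<inter> space (gen_alg M \<V>) = {\<omega>\<in>space M. \<forall>V'\<in>{V}. V' \<omega> \<in> (\<lambda>_. B) V'}" by auto
  also have "\<dots> \<in> sets (gen_alg M \<V>)"
    unfolding sets_gen_alg using V B by (intro sigma_sets.Basic CollectI exI[of _ "{V}"] exI[of _ "\<lambda>_. B"]) auto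
  finally show "V -` B \<inter> space (gen_alg M \<V>) \<in> sets (gen_alg M \<V>)" .
qed simp

lemma cylinder_in_sets:
  assumes "finite I" "\<And>V. V \<in> I \<Longrightarrow> V \<in> borel_measurable M" "\<And>V. Bi V \<in> sets borel"
  shows "{\<omega>\<in>space M. \<forall>V\<in>I. V \<omega> \<in> Bi V} \<in> sets M"
proof -
  have "{\<omega>\<in>space M. V \<omega> \<in> Bi V} \<in> sets M" if "V \<in> I" for V
    using measurable_sets[OF assms(2)[OF that] assms(3)[of V]] by (simp add: vimage_def Int_def conj_commute)
  then show ?thesis using assms(1) by (intro sets.sets_Collect_finite_All) auto
qed

lemma sets_gen_alg_subset: "\<V> \<subseteq> borel_measurable M \<Longrightarrow> sets (gen_alg M \<V>) \<subseteq> sets M"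
  unfolding sets_gen_alg by (rule sets.sigma_sets_subset) (auto intro!: cylinder_in_sets)

lemma (in prob_space) gen_alg_indep:
  assumes \<V>: "\<V> \<subseteq> borel_measurable M" and Z[measurable]: "Z \<in> borel_measurable M"
    and char: "\<And>I \<theta> c. finite I \<Longrightarrow> I \<subseteq> \<V> \<Longrightarrow> (\<integral>\<omega>. iexp (\<theta> * Z \<omega> + (\<Sum>V\<in>I. c V * V \<omega>)) \<partial>M) =
      (\<integral>\<omega>. iexp (\<theta> * Z \<omega>) \<partial>M) * (\<integral>\<omega>. iexp (\<Sum>V\<in>I. c V * V \<omega>) \<partial>M)"
    and A: "A \<in> sets (gen_alg M \<V>)" and B: "B \<in> sets borel"
  shows "prob (A \<inter> Z -` B) = prob A * prob (Z -` B \<inter> space M)"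
proof -
  let ?P = "{{\<omega>\<in>space M. \<forall>V\<in>I. V \<omega> \<in> Bi V} |I Bi. finite I \<and> I \<subseteq> \<V> \<and> (\<forall>V. Bi V \<in> sets borel)}"
  let ?Q = "{Z -` B \<inter> space M |B. B \<in> sets borel}"
  have "indep_set (sigma_sets (space M) ?P) (sigma_sets (space M) ?Q)"
  proof (rule indep_set_sigma_sets)
    show "indep_set ?P ?Q"
      unfolding indep_sets2_eq
    proof (intro conjI ballI)
      show "?P \<subseteq> events" using \<V> by (auto intro!: cylinder_in_sets)
      show "?Q \<subseteq> events" by auto
      fix a b assume "a \<in> ?P" "b \<in> ?Q"
      then obtain I Bi B' where a: "a = {\<omega>\<in>space M. \<forall>V\<in>I. V \<omega> \<in> Bi V}" "finite I" "I \<subseteq> \<V>" "\<And>V. Bi V \<in> sets borel"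
        and b: "b = Z -` B' \<inter> space M" "B' \<in> sets borel" by blast
      have "prob {\<omega>\<in>space M. (\<forall>V\<in>I. (\<lambda>V. V) V \<omega> \<in> Bi V) \<and> Z \<omega> \<in> B'} = prob {\<omega>\<in>space M. \<forall>V\<in>I. (\<lambda>V. V) V \<omega> \<in> Bi V} * prob {\<omega>\<in>space M. Z \<omega> \<in> B'}"
        by (rule prob_split_of_char) (use a b \<V> char[of I] in auto)
      moreover have "{\<omega>\<in>space M. (\<forall>V\<in>I. V \<omega> \<in> Bi V) \<and> Z \<omega> \<in> B'} = a \<inter> b" "{\<omega>\<in>space M. Z \<omega> \<in> B'} = b"
        unfolding a(1) b(1) by auto
      ultimately show "prob (a \<inter> b) = prob a * prob b" by (simp add: a(1))
    qed
    show "Int_stable ?P"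
    proof (rule Int_stableI)
      fix a b assume "a \<in> ?P" "b \<in> ?P"
      then obtain I Bi J Bj where a: "a = {\<omega>\<in>space M. \<forall>V\<in>I. V \<omega> \<in> Bi V}" "finite I" "I \<subseteq> \<V>" "\<And>V. Bi V \<in> sets borel"
        and b: "b = {\<omega>\<in>space M. \<forall>V\<in>J. V \<omega> \<in> Bj V}" "finite J" "J \<subseteq> \<V>" "\<And>V. Bj V \<in> sets borel" by blast
      let ?C = "\<lambda>V. (if V \<in> I then Bi V else UNIV) \<inter> (if V \<in> J then Bj V else UNIV)"
      have "a \<inter> b = {\<omega>\<in>space M. \<forall>V\<in>I \<union> J. V \<omega> \<in> ?C V}" unfolding a(1) b(1) by auto
      moreover have "?C V \<in> sets borel" for V using a b by auto
      ultimately show "a \<inter> b \<in> ?P" using a(2,3) b(2,3)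
        by (intro CollectI exI[of _ "I \<union> J"] exI[of _ ?C]) auto
    qed
    show "Int_stable ?Q"
    proof (rule Int_stableI)
      fix a b assume "a \<in> ?Q" "b \<in> ?Q"
      then obtain B1 B2 where "a = Z -` B1 \<inter> space M" "B1 \<in> sets borel" "b = Z -` B2 \<inter> space M" "B2 \<in> sets borel" by auto
      then show "a \<inter> b \<in> ?Q" by (intro CollectI exI[of _ "B1 \<inter> B2"]) auto
    qed
  qed
  then have "prob (A \<inter> (Z -` B \<inter> space M)) = prob A * prob (Z -` B \<inter> space M)"
    using A B unfolding indep_sets2_eq sets_gen_alg by blast
  moreover have "A \<subseteq> space M" using sets.sets_into_space[OF A] by simp
  then have "A \<inter> (Z -` B \<inter> space M) = A \<inter> Z -` B" by auto
  ultimately show ?thesis by simp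
qed

section \<open>Gaussian tails and the supremum of a Brownian path\<close>

context prob_space
begin

text \<open>Both cases of the definition of a Gaussian variable, the degenerate one included, obey the same formula for
the characteristic function.\<close>

lemma gaussian_rv_centered:
  assumes X: "gaussian_rv M X" and m: "(\<integral>\<omega>. X \<omega> \<partial>M) = 0"
  shows "X \<in> borel_measurable M" "integrable M X" "integrable M (\<lambda>\<omega>. (X \<omega>)\<^sup>2)"
    and "(\<integral>\<omega>. iexp (X \<omega>) \<partial>M) = of_real (exp (- (\<integral>\<omega>. (X \<omega>)\<^sup>2 \<partial>M) / 2))"
    and "(\<integral>\<omega>. (X \<omega>)\<^sup>2 \<partial>M) = v \<Longrightarrow> v > 0 \<Longrightarrow> distr M borel X = normal_law v"
    and "(\<integral>\<omega>. (X \<omega>)\<^sup>2 \<partial>M) = 0 \<Longrightarrow> AE \<omega> in M. X \<omega> = 0"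
proof -
  show Xm[measurable]: "X \<in> borel_measurable M" using X by (simp add: gaussian_rv_def)
  have "integrable M X \<and> integrable M (\<lambda>\<omega>. (X \<omega>)\<^sup>2) \<and>
    (\<integral>\<omega>. iexp (X \<omega>) \<partial>M) = of_real (exp (- (\<integral>\<omega>. (X \<omega>)\<^sup>2 \<partial>M) / 2)) \<and>
    ((\<integral>\<omega>. (X \<omega>)\<^sup>2 \<partial>M) = v \<longrightarrow> v > 0 \<longrightarrow> distr M borel X = normal_law v) \<and>
    ((\<integral>\<omega>. (X \<omega>)\<^sup>2 \<partial>M) = 0 \<longrightarrow> (AE \<omega> in M. X \<omega> = 0))"
    using X unfolding gaussian_rv_def
  proof (elim conjE disjE exE)
    fix \<mu> \<sigma> :: real
    assume s: "\<sigma> > 0" and D: "distributed M lborel X (normal_density \<mu> \<sigma>)"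
    have "\<mu> = 0" using normal_distributed_expectation[OF s D] m by simp
    note D = D[unfolded this]
    have V: "(\<integral>\<omega>. (X \<omega>)\<^sup>2 \<partial>M) = \<sigma>\<^sup>2" using normal_distributed_variance[OF s D] m by simp
    have dd: "distr M lborel X = density lborel (normal_density 0 \<sigma>)"
      by (rule distributed_distr_eq_density[OF D])
    have dd': "distr M borel X = density lborel (normal_density 0 \<sigma>)"
      using dd by (simp add: distr_cong[OF refl sets_lborel])
    have i1: "integrable M X"
      using integrable_normal_moment[OF s, of 0 1] by (subst distributed_integrable[OF D, symmetric]) auto
    have i2: "integrable M (\<lambda>\<omega>. (X \<omega>)\<^sup>2)"
      using integrable_normal_moment[OF s, of 0 2] by (subst distributed_integrable[OF D, symmetric]) auto
    have "distributed M lborel (\<lambda>\<omega>. (X \<omega> - 0) / \<sigma>) std_normal_density"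
      using D normal_standard_normal_convert[OF s, of X 0] by blast
    then have "distr M lborel (\<lambda>\<omega>. (X \<omega> - 0) / \<sigma>) = std_normal_distribution"
      by (rule distributed_distr_eq_density)
    then have ds: "distr M borel (\<lambda>\<omega>. X \<omega> / \<sigma>) = std_normal_distribution"
      by (simp add: distr_cong[OF refl sets_lborel])
    have "(\<integral>\<omega>. iexp (X \<omega>) \<partial>M) = char (distr M borel (\<lambda>\<omega>. X \<omega> / \<sigma>)) \<sigma>"
      unfolding char_def using s by (subst integral_distr) auto
    also have "\<dots> = of_real (exp (- \<sigma>\<^sup>2 / 2))"
      unfolding ds char_std_normal_distribution by simp
    finally have c: "(\<integral>\<omega>. iexp (X \<omega>) \<partial>M) = of_real (exp (- (\<integral>\<omega>. (X \<omega>)\<^sup>2 \<partial>M) / 2))" by (simp add: V)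
    have "\<sigma>\<^sup>2 = v \<longrightarrow> v > 0 \<longrightarrow> distr M borel X = normal_law v"
      using s by (auto simp: dd' normal_law_def)
    then show ?thesis using i1 i2 c V s by simp
  next
    fix \<mu> assume ae: "AE \<omega> in M. X \<omega> = \<mu>"
    have "(\<integral>\<omega>. X \<omega> \<partial>M) = (\<integral>\<omega>. \<mu> \<partial>M)" by (rule integral_cong_AE) (use ae in auto)
    then have "\<mu> = 0" using m by (simp add: prob_space)
    note ae = ae[unfolded this]
    have V: "(\<integral>\<omega>. (X \<omega>)\<^sup>2 \<partial>M) = (\<integral>\<omega>. 0 \<partial>M)" by (rule integral_cong_AE) (use ae in auto)
    have c: "(\<integral>\<omega>. iexp (X \<omega>) \<partial>M) = (\<integral>\<omega>. 1 \<partial>M)" by (rule integral_cong_AE) (use ae in auto)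
    have "integrable M X \<longleftrightarrow> integrable M (\<lambda>_. 0::real)" "integrable M (\<lambda>\<omega>. (X \<omega>)\<^sup>2) \<longleftrightarrow> integrable M (\<lambda>_. 0::real)"
      by (rule integrable_cong_AE; use ae in auto)+
    then show ?thesis using V c ae by (simp add: prob_space)
  qed
  then show "integrable M X" "integrable M (\<lambda>\<omega>. (X \<omega>)\<^sup>2)"
    "(\<integral>\<omega>. iexp (X \<omega>) \<partial>M) = of_real (exp (- (\<integral>\<omega>. (X \<omega>)\<^sup>2 \<partial>M) / 2))"
    "(\<integral>\<omega>. (X \<omega>)\<^sup>2 \<partial>M) = v \<Longrightarrow> v > 0 \<Longrightarrow> distr M borel X = normal_law v"
    "(\<integral>\<omega>. (X \<omega>)\<^sup>2 \<partial>M) = 0 \<Longrightarrow> AE \<omega> in M. X \<omega> = 0"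
    by blast+
qed

end

text \<open>Markov's inequality for the Cameron--Martin weights with \<open>c = l\<close> and \<open>c = - l\<close>, whose mean is \<open>1\<close>.\<close>

lemma normal_law_tail:
  assumes v: "v > 0" and l: "l > 0"
  shows "measure (normal_law v) {w. l < \<bar>w\<bar>} \<le> 2 * exp (- (l\<^sup>2 / (2 * v)))"
proof -
  interpret N: prob_space "normal_law v" by (rule prob_space_normal_law[OF v])
  have *: "measure (normal_law v) {w. l\<^sup>2 < c * w} \<le> exp (- (l\<^sup>2 / (2 * v)))" if c: "c\<^sup>2 = l\<^sup>2" for c
  proof -
    have "measure (normal_law v) {w. l\<^sup>2 < c * w} \<le> measure (normal_law v) {w\<in>space (normal_law v). exp (l\<^sup>2 / (2 * v)) \<le> cm_weight v c w}"
    proof (rule N.finite_measure_mono)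
      show "{w. l\<^sup>2 < c * w} \<subseteq> {w \<in> space (normal_law v). exp (l\<^sup>2 / (2 * v)) \<le> cm_weight v c w}"
      proof safe
        fix w assume "l\<^sup>2 < c * w"
        then have "l\<^sup>2 / v \<le> c * w / v" using v by (intro divide_right_mono) auto
        moreover have "l\<^sup>2 / v = l\<^sup>2 / (2 * v) + l\<^sup>2 / (2 * v)" by simp
        ultimately have "l\<^sup>2 / (2 * v) \<le> c * w / v - l\<^sup>2 / (2 * v)" by linarith
        then show "exp (l\<^sup>2 / (2 * v)) \<le> cm_weight v c w" by (simp add: cm_weight_def c)
      qed simp
    qed measurable
    also have "\<dots> \<le> (\<integral>w. cm_weight v c w \<partial>normal_law v) / exp (l\<^sup>2 / (2 * v))"
      by (rule integral_Markov_inequality_measure[OF integrable_cm[OF v], where A="{}"])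
         (auto simp: less_imp_le[OF cm_pos])
    also have "\<dots> = exp (- (l\<^sup>2 / (2 * v)))"
      by (simp add: integral_cm[OF v] exp_minus[symmetric] inverse_eq_divide[symmetric])
    finally show ?thesis .
  qed
  have "{w. l < \<bar>w\<bar>} \<subseteq> {w. l\<^sup>2 < l * w} \<union> {w. l\<^sup>2 < (- l) * w}"
  proof
    fix w assume "w \<in> {w. l < \<bar>w\<bar>}"
    then consider "l < w" | "l < - w" by (auto simp: abs_if split: if_splits)
    then show "w \<in> {w. l\<^sup>2 < l * w} \<union> {w. l\<^sup>2 < (- l) * w}"
    proof cases
      case 1
      then have "l * l < l * w" using l by (rule mult_strict_left_mono)
      then show ?thesis by (simp add: power2_eq_square)
    next
      case 2
      then have "l * l < l * (- w)" using l by (rule mult_strict_left_mono)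
      then show ?thesis by (simp add: power2_eq_square)
    qed
  qed
  then have "measure (normal_law v) {w. l < \<bar>w\<bar>} \<le> measure (normal_law v) ({w. l\<^sup>2 < l * w} \<union> {w. l\<^sup>2 < (- l) * w})"
    by (rule N.finite_measure_mono) measurable
  also have "\<dots> \<le> measure (normal_law v) {w. l\<^sup>2 < l * w} + measure (normal_law v) {w. l\<^sup>2 < (- l) * w}"
    by (rule measure_Un_le) measurable
  also have "\<dots> \<le> 2 * exp (- (l\<^sup>2 / (2 * v)))" using *[of l] *[of "- l"] by simp
  finally show ?thesis .
qed

lemma dyadic_approx:
  fixes t :: real
  assumes "0 \<le> t" "t \<le> 1"
  shows "(\<lambda>k. of_int \<lfloor>2 ^ k * t\<rfloor> / 2 ^ k) \<longlonglongrightarrow> t"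
proof (rule tendsto_sandwich)
  have "(\<lambda>k. t - (1/2) ^ k) \<longlonglongrightarrow> t - 0" by (intro tendsto_intros LIMSEQ_power_zero) auto
  then show "(\<lambda>k. t - (1/2) ^ k) \<longlonglongrightarrow> t" by simp
  have "t - (1/2) ^ k \<le> of_int \<lfloor>2 ^ k * t\<rfloor> / 2 ^ k" for k
  proof -
    have "2 ^ k * t - 1 \<le> of_int \<lfloor>2 ^ k * t\<rfloor>" by linarith
    then have "(2 ^ k * t - 1) / 2 ^ k \<le> of_int \<lfloor>2 ^ k * t\<rfloor> / 2 ^ k" by (intro divide_right_mono) auto
    then show ?thesis by (simp add: diff_divide_distrib power_one_over)
  qed
  then show "\<forall>\<^sub>F k in sequentially. t - (1/2) ^ k \<le> of_int \<lfloor>2 ^ k * t\<rfloor> / 2 ^ k" by simp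
  have "of_int \<lfloor>2 ^ k * t\<rfloor> / 2 ^ k \<le> t" for k
    by (simp add: pos_divide_le_eq mult.commute)
  then show "\<forall>\<^sub>F k in sequentially. of_int \<lfloor>2 ^ k * t\<rfloor> / 2 ^ k \<le> t" by simp
qed simp

text \<open>The weights \<open>(3/4) ^ k / 4\<close> sum to \<open>1\<close>, while \<open>(3/4) ^ k\<close> exceeds the typical size \<open>2 powr (- k / 2)\<close> of an
increment of level \<open>k\<close> by an exponential factor.\<close>

lemma chaining_pathwise:
  fixes b :: "real \<Rightarrow> real"
  assumes cont: "continuous_on {0..1} b" and b0: "b 0 = 0"
    and inc: "\<And>k j. j < 2 ^ k \<Longrightarrow> \<bar>b (real (Suc j) / 2 ^ k) - b (real j / 2 ^ k)\<bar> \<le> a * (3/4) ^ k / 4"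
    and t: "t \<in> {0..1}" and a: "a \<ge> 0"
  shows "\<bar>b t\<bar> \<le> a"
proof -
  have dy: "\<bar>b (real j / 2 ^ k)\<bar> \<le> (\<Sum>l\<le>k. a * (3/4) ^ l / 4)" if "j \<le> 2 ^ k" for j k
    using that
  proof (induction k arbitrary: j)
    case 0
    then consider "j = 0" | "j = 1" by (metis le_less less_one power_0)
    then show ?case using b0 inc[of 0 0] a by cases auto
  next
    case (Suc k)
    have half: "real (2 * i) / 2 ^ Suc k = real i / 2 ^ k" for i by simp
    have le: "(\<Sum>l\<le>Suc k. a * (3/4) ^ l / 4) = (\<Sum>l\<le>k. a * (3/4) ^ l / 4) + a * (3/4) ^ Suc k / 4" by simp
    show ?case
    proof (cases "even j")
      case True
      then obtain i where "j = 2 * i" by blast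
      with Suc have "\<bar>b (real j / 2 ^ Suc k)\<bar> \<le> (\<Sum>l\<le>k. a * (3/4) ^ l / 4)"
        using half[of i] by simp
      moreover have "0 \<le> a * (3/4) ^ Suc k / 4" using a by simp
      ultimately show ?thesis unfolding le by linarith
    next
      case False
      then obtain i where j: "j = Suc (2 * i)" by (metis oddE Suc_eq_plus1)
      have i: "i \<le> 2 ^ k" "2 * i < 2 ^ Suc k" using Suc.prems j by auto
      have 1: "\<bar>b (real (2 * i) / 2 ^ Suc k)\<bar> \<le> (\<Sum>l\<le>k. a * (3/4) ^ l / 4)"
        unfolding half by (rule Suc.IH[OF i(1)])
      have 2: "\<bar>b (real j / 2 ^ Suc k) - b (real (2 * i) / 2 ^ Suc k)\<bar> \<le> a * (3/4) ^ Suc k / 4"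
        unfolding j by (rule inc[OF i(2)])
      have tri: "\<bar>x\<bar> \<le> p + q" if "\<bar>y\<bar> \<le> p" "\<bar>x - y\<bar> \<le> q" for x y p q :: real using that by linarith
      show ?thesis unfolding le by (rule tri[OF 1 2])
    qed
  qed
  have sum: "(\<Sum>l\<le>k. a * (3/4) ^ l / 4) \<le> a" for k
  proof -
    have "(\<Sum>l\<le>k. a * (3/4) ^ l / 4) = a / 4 * (\<Sum>l\<le>k. (3/4) ^ l)" by (simp add: sum_distrib_left)
    also have "(\<Sum>l\<le>k. (3/4::real) ^ l) = (1 - (3/4) ^ Suc k) / (1 - 3/4)" by (subst sum_gp0) auto
    also have "a / 4 * \<dots> = a * (1 - (3/4) ^ Suc k)" by simp
    also have "\<dots> \<le> a * 1" using a by (intro mult_left_mono) auto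
    finally show ?thesis by simp
  qed
  let ?t = "\<lambda>k. of_int \<lfloor>2 ^ k * t\<rfloor> / 2 ^ k :: real"
  have tk: "?t k = real (nat \<lfloor>2 ^ k * t\<rfloor>) / 2 ^ k" "nat \<lfloor>2 ^ k * t\<rfloor> \<le> 2 ^ k" for k
  proof -
    have "0 \<le> \<lfloor>2 ^ k * t\<rfloor>" using t by simp
    then show "?t k = real (nat \<lfloor>2 ^ k * t\<rfloor>) / 2 ^ k" by simp
    have "2 ^ k * t \<le> 2 ^ k" using t by (simp add: mult_left_le)
    then have "\<lfloor>2 ^ k * t\<rfloor> \<le> 2 ^ k" by (metis floor_mono floor_of_int of_int_numeral of_int_power)
    then show "nat \<lfloor>2 ^ k * t\<rfloor> \<le> 2 ^ k" by (simp add: nat_le_iff)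
  qed
  have mem: "?t k \<in> {0..1}" for k
  proof -
    have "real (nat \<lfloor>2 ^ k * t\<rfloor>) \<le> 2 ^ k" using tk(2)[of k] by (metis of_nat_le_iff of_nat_numeral of_nat_power)
    then show ?thesis unfolding tk(1) by (simp add: divide_le_eq_1)
  qed
  have "(\<lambda>k. b (?t k)) \<longlonglongrightarrow> b t"
  proof (rule continuous_on_tendsto_compose[OF cont dyadic_approx t])
    show "\<forall>\<^sub>F k in sequentially. ?t k \<in> {0..1}" using mem by (rule always_eventually[OF allI])
  qed (use t in auto)
  then have "(\<lambda>k. \<bar>b (?t k)\<bar>) \<longlonglongrightarrow> \<bar>b t\<bar>" by (rule tendsto_rabs)
  moreover have "\<bar>b (?t k)\<bar> \<le> a" for k
    unfolding tk(1) by (rule order_trans[OF dy[OF tk(2)] sum])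
  ultimately show ?thesis by (intro LIMSEQ_le_const2) auto
qed

lemma (in prob_space) brownian_sup_tail:
  fixes B :: "real \<Rightarrow> 'a \<Rightarrow> real"
  assumes Bm[measurable]: "\<And>t. t \<in> {0..1} \<Longrightarrow> B t \<in> borel_measurable M"
    and cont: "\<And>\<omega>. \<omega> \<in> space M \<Longrightarrow> continuous_on {0..1} (\<lambda>t. B t \<omega>)"
    and B0: "AE \<omega> in M. B 0 \<omega> = 0"
    and inc: "\<And>u t. 0 \<le> u \<Longrightarrow> u < t \<Longrightarrow> t \<le> 1 \<Longrightarrow> distr M borel (\<lambda>\<omega>. B t \<omega> - B u \<omega>) = normal_law (\<sigma>\<^sup>2 * (t - u))"
    and \<sigma>: "\<sigma> > 0" and \<eta>: "\<eta> \<ge> 512"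
  shows "\<exists>E\<in>sets M. prob E \<le> 4 * exp (- \<eta> / 32) \<and> (\<forall>\<omega>\<in>space M - E. \<forall>t\<in>{0..1}. \<bar>B t \<omega>\<bar> \<le> sqrt \<eta> * \<sigma>)"
proof -
  let ?a = "\<lambda>k. (sqrt \<eta> * \<sigma>) * (3/4) ^ k / 4"
  let ?D = "\<lambda>k j \<omega>. B (real (Suc j) / 2 ^ k) \<omega> - B (real j / 2 ^ k) \<omega>"
  have mem: "real (Suc j) / 2 ^ k \<in> {0..1}" "real j / 2 ^ k \<in> {0..1}" if "j < 2 ^ k" for j k
  proof -
    have "real (Suc j) \<le> 2 ^ k" using that by (metis Suc_leI of_nat_le_iff of_nat_numeral of_nat_power)
    moreover have "j \<le> 2 ^ k" using that by simp
    ultimately show "real (Suc j) / 2 ^ k \<in> {0..1}" "real j / 2 ^ k \<in> {0..1}" by (auto simp: divide_le_eq_1)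
  qed
  have Dm: "?D k j \<in> borel_measurable M" if "j < 2 ^ k" for k j
    using Bm[OF mem(1)[OF that]] Bm[OF mem(2)[OF that]] by measurable
  define Ek where "Ek k j = {\<omega>\<in>space M. ?a k < \<bar>?D k j \<omega>\<bar>}" for k j
  have Ekm: "Ek k j \<in> sets M" if "j < 2 ^ k" for k j
    unfolding Ek_def using Dm[OF that] by measurable
  have Ekp: "prob (Ek k j) \<le> 2 * exp (- \<eta> / 32) * exp (- 2) ^ k" if j: "j < 2 ^ k" for k j
  proof -
    let ?v = "\<sigma>\<^sup>2 * (real (Suc j) / 2 ^ k - real j / 2 ^ k)"
    have vk: "?v = \<sigma>\<^sup>2 / 2 ^ k" by (simp add: diff_divide_distrib[symmetric])
    have v0: "?v > 0" unfolding vk using \<sigma> by simp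
    have a0: "?a k > 0" using \<sigma> \<eta> by simp
    have d: "distr M borel (?D k j) = normal_law ?v"
      by (rule inc) (use mem[OF j] in \<open>auto simp: divide_strict_right_mono\<close>)
    have "prob (Ek k j) = measure (distr M borel (?D k j)) {w. ?a k < \<bar>w\<bar>}"
      unfolding Ek_def using Dm[OF j] by (subst measure_distr) (auto intro!: arg_cong[where f=prob])
    also have "\<dots> \<le> 2 * exp (- ((?a k)\<^sup>2 / (2 * ?v)))"
      unfolding d by (rule normal_law_tail[OF v0 a0])
    also have "(?a k)\<^sup>2 / (2 * ?v) = \<eta> / 32 * (9/8) ^ k"
    proof -
      have e: "((3/4::real) ^ k)\<^sup>2 * 2 ^ k = (9/8) ^ k"
        by (simp add: power_mult[symmetric] power2_eq_square power_mult_distrib[symmetric])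
      have "(?a k)\<^sup>2 = \<eta> * \<sigma>\<^sup>2 * ((3/4) ^ k)\<^sup>2 / 16"
        using \<eta> by (simp add: power_mult_distrib power_divide)
      then have "(?a k)\<^sup>2 / (2 * ?v) = \<eta> / 32 * (((3/4) ^ k)\<^sup>2 * 2 ^ k)"
        unfolding vk using \<sigma> by (simp add: field_simps)
      then show ?thesis by (simp only: e)
    qed
    finally have "prob (Ek k j) \<le> 2 * exp (- (\<eta> / 32 * (9/8) ^ k))" .
    moreover have "exp (- (\<eta> / 32 * (9/8) ^ k)) \<le> exp (- \<eta> / 32 + real k * (- 2))"
    proof -
      \<comment> \<open>A geometric decay in \<open>k\<close> is kept to beat the \<open>2 ^ k\<close> increments of level \<open>k\<close>; this uses \<open>\<eta> \<ge> 512\<close>.\<close>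
      have "1 + real k * (1/8) \<le> (1 + 1/8) ^ k" by (rule Bernoulli_inequality) simp
      then have "\<eta> / 32 * (1 + real k * (1/8)) \<le> \<eta> / 32 * (9/8) ^ k"
        using \<eta> by (intro mult_left_mono) auto
      moreover have "real k * 2 \<le> \<eta> / 32 * (real k * (1/8))"
        using \<eta> mult_right_mono[of 512 \<eta> "real k"] by simp
      ultimately have "\<eta> / 32 + real k * 2 \<le> \<eta> / 32 * (9/8) ^ k"
        by (simp add: distrib_left)
      then show ?thesis by simp
    qed
    moreover have "exp (- \<eta> / 32 + real k * (- 2)) = exp (- \<eta> / 32) * exp (- 2) ^ k"
      by (simp only: exp_add exp_of_nat_mult)
    moreover have "p \<le> 2 * c * d" if "p \<le> 2 * a" "a \<le> b" "b = c * d" for a b c d p :: real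
      using that by simp
    ultimately show ?thesis by blast
  qed
  have e4: "exp (- 2 :: real) \<le> 1 / 4"
  proof -
    have "2 \<le> exp (1::real)" using exp_ge_add_one_self[of 1] by simp
    then have "2 * 2 \<le> exp (1::real) * exp 1" by (intro mult_mono) auto
    then show ?thesis by (simp add: exp_minus mult_exp_exp field_simps)
  qed
  define El where "El k = (\<Union>j<2 ^ k. Ek k j)" for k :: nat
  have Elm: "El k \<in> sets M" for k unfolding El_def using Ekm by auto
  have Elp: "prob (El k) \<le> 2 * exp (- \<eta> / 32) * (1/2) ^ k" for k
  proof -
    have "prob (El k) \<le> (\<Sum>j<2 ^ k. prob (Ek k j))"
      unfolding El_def by (rule finite_measure_subadditive_finite) (use Ekm in auto)
    also have "\<dots> \<le> (\<Sum>j<(2::nat) ^ k. 2 * exp (- \<eta> / 32) * exp (- 2) ^ k)"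
      by (rule sum_mono) (use Ekp in auto)
    also have "\<dots> = 2 * exp (- \<eta> / 32) * (2 * exp (- 2)) ^ k" by (simp add: power_mult_distrib)
    also have "\<dots> \<le> 2 * exp (- \<eta> / 32) * (1/2) ^ k"
      using e4 by (intro mult_left_mono power_mono) auto
    finally show ?thesis .
  qed
  define E where "E = (\<Union>k. El k) \<union> {\<omega>\<in>space M. B 0 \<omega> \<noteq> 0}"
  have s: "summable (\<lambda>k. 2 * exp (- \<eta> / 32) * (1/2) ^ k)"
    by (intro summable_mult summable_geometric) simp
  have sE: "summable (\<lambda>k. prob (El k))"
    by (rule summable_comparison_test'[OF s, of 0]) (use Elp in auto)
  have Z: "{\<omega>\<in>space M. B 0 \<omega> \<noteq> 0} \<in> sets M" using Bm[of 0] by measurable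
  have Z0: "prob {\<omega>\<in>space M. B 0 \<omega> \<noteq> 0} = 0"
    using B0 Z by (subst prob_eq_0) auto
  have Em: "E \<in> sets M" unfolding E_def using Elm Z by auto
  have "prob E \<le> prob (\<Union>k. El k) + prob {\<omega>\<in>space M. B 0 \<omega> \<noteq> 0}"
    unfolding E_def by (rule measure_Un_le) (use Elm Z in auto)
  also have "\<dots> \<le> (\<Sum>k. prob (El k))"
    unfolding Z0 using finite_measure_subadditive_countably[OF _ sE] Elm by auto
  also have "\<dots> \<le> (\<Sum>k. 2 * exp (- \<eta> / 32) * (1/2) ^ k)"
    by (rule suminf_le[OF Elp sE s])
  also have "\<dots> = 4 * exp (- \<eta> / 32)"
    by (subst suminf_mult) (auto simp: suminf_geometric intro!: summable_geometric)
  finally have Ep: "prob E \<le> 4 * exp (- \<eta> / 32)" .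
  have "\<bar>B t \<omega>\<bar> \<le> sqrt \<eta> * \<sigma>" if \<omega>: "\<omega> \<in> space M - E" and t: "t \<in> {0..1}" for \<omega> t
  proof (rule chaining_pathwise[OF _ _ _ t])
    show "continuous_on {0..1} (\<lambda>t. B t \<omega>)" using cont \<omega> by auto
    show "B 0 \<omega> = 0" using \<omega> by (auto simp: E_def)
    show "\<bar>?D k j \<omega>\<bar> \<le> ?a k" if "j < 2 ^ k" for k j
      using \<omega> that by (auto simp: E_def El_def Ek_def not_less)
    show "0 \<le> sqrt \<eta> * \<sigma>" using \<sigma> \<eta> by simp
  qed
  with Em Ep show ?thesis by blast
qed

section \<open>The Gaussian space of a Brownian sheet\<close>

lemma char_normal_law:
  assumes v: "v > 0"
  shows "char (normal_law v) t = of_real (exp (- (t\<^sup>2 * v) / 2))"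
proof -
  let ?S = "std_normal_distribution"
  interpret S: prob_space ?S by (rule prob_space_normal_density) simp
  have "distributed ?S lborel (\<lambda>x. x) std_normal_density"
    unfolding distributed_def by (auto simp: distr_id2 intro!: distr_id2)
  from S.normal_density_affine[OF this, of "sqrt v" 0] v
  have "distributed ?S lborel (\<lambda>x. sqrt v * x) (normal_density 0 (sqrt v))" by simp
  then have "distr ?S lborel (\<lambda>x. sqrt v * x) = normal_law v"
    unfolding normal_law_def by (rule distributed_distr_eq_density)
  then have "distr ?S borel (\<lambda>x. sqrt v * x) = normal_law v"
    by (simp add: distr_cong[OF refl sets_lborel])
  then have "char (normal_law v) t = char (distr ?S borel (\<lambda>x. sqrt v * x)) t" by simp
  also have "\<dots> = (\<integral>x. iexp (t * (sqrt v * x)) \<partial>?S)"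
    unfolding char_def by (subst integral_distr) auto
  also have "\<dots> = char ?S (t * sqrt v)" unfolding char_def by (simp add: mult_ac)
  also have "\<dots> = of_real (exp (- (t\<^sup>2 * v) / 2))"
    using v by (simp add: char_std_normal_distribution power_mult_distrib)
  finally show ?thesis .
qed

text \<open>A Brownian sheet whose parameter set contains the unit square.\<close>

locale sheet = prob_space M for M :: "'a measure" +
  fixes T :: "(real \<times> real) set" and W :: "real \<times> real \<Rightarrow> 'a \<Rightarrow> real ^ 'd"
  assumes unit_T: "{0..1} \<times> {0..1} \<subseteq> T" and sheet: "brownian_sheet_on M T W"
begin

text \<open>Linear combinations of values of one component; the linear space \<open>gspan\<close> spanned by all values of all
components; and the inner product of \<open>L\<^sup>2\<close> on it, which is the covariance because all means vanish.\<close>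

definition comb :: "'d \<Rightarrow> (real \<times> real \<Rightarrow> real) \<Rightarrow> (real \<times> real) set \<Rightarrow> 'a \<Rightarrow> real" where
  "comb j c S \<omega> = (\<Sum>z\<in>S. c z * W z \<omega> $ j)"

definition gspan :: "('a \<Rightarrow> real) set" where
  "gspan = {(\<lambda>\<omega>. \<Sum>j\<in>UNIV. comb j (c j) S \<omega>) |c S. finite S \<and> S \<subseteq> T}"

definition ip :: "('a \<Rightarrow> real) \<Rightarrow> ('a \<Rightarrow> real) \<Rightarrow> real" where
  "ip U V = (\<integral>\<omega>. U \<omega> * V \<omega> \<partial>M)"

lemma comp: "brownian_sheet1_on M T (\<lambda>z \<omega>. W z \<omega> $ j)"
  using sheet by (simp add: brownian_sheet_on_def)

lemma W_centered: "z \<in> T \<Longrightarrow> (\<integral>\<omega>. W z \<omega> $ j \<partial>M) = 0"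
  using comp[of j] by (auto simp: brownian_sheet1_on_def)

lemma gaussian_comb: "finite S \<Longrightarrow> S \<subseteq> T \<Longrightarrow> gaussian_rv M (comb j c S)"
  using comp[of j] unfolding brownian_sheet1_on_def gaussian_process_on_def comb_def[abs_def] by blast

lemma gaussian_W: "z \<in> T \<Longrightarrow> gaussian_rv M (\<lambda>\<omega>. W z \<omega> $ j)"
  using gaussian_comb[of "{z}" j "\<lambda>_. 1"] by (simp add: comb_def[abs_def])

lemma W_meas: "z \<in> T \<Longrightarrow> (\<lambda>\<omega>. W z \<omega> $ j) \<in> borel_measurable M"
  by (rule gaussian_rv_centered(1)[OF gaussian_W W_centered])

lemma W_integrable: "z \<in> T \<Longrightarrow> integrable M (\<lambda>\<omega>. W z \<omega> $ j)"
  by (rule gaussian_rv_centered(2)[OF gaussian_W W_centered])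

lemma comb_centered: "finite S \<Longrightarrow> S \<subseteq> T \<Longrightarrow> (\<integral>\<omega>. comb j c S \<omega> \<partial>M) = 0"
  unfolding comb_def using W_integrable W_centered
  by (subst Bochner_Integration.integral_sum) (auto intro!: sum.neutral)

lemma indep_comb:
  assumes "finite S" "S \<subseteq> T"
  shows "indep_vars (\<lambda>_. borel) (\<lambda>j. comb j (c j) S) UNIV"
proof -
  have "indep_vars (\<lambda>i. PiM T (\<lambda>_. borel)) (\<lambda>i \<omega>. \<lambda>z\<in>T. W z \<omega> $ i) UNIV"
    using sheet by (simp add: brownian_sheet_on_def)
  then have "indep_vars (\<lambda>_. borel) (\<lambda>i \<omega>. \<Sum>z\<in>S. c i z * (\<lambda>z\<in>T. W z \<omega> $ i) z) UNIV"
  proof (rule indep_vars_compose2)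
    show "(\<lambda>p. \<Sum>z\<in>S. c i z * p z) \<in> borel_measurable (PiM T (\<lambda>_. borel))" for i
      using assms by (intro borel_measurable_sum borel_measurable_times measurable_component_singleton) auto
  qed
  also have "(\<lambda>i \<omega>. \<Sum>z\<in>S. c i z * (\<lambda>z\<in>T. W z \<omega> $ i) z) = (\<lambda>j. comb j (c j) S)"
    using assms by (auto simp: fun_eq_iff comb_def intro!: sum.cong)
  finally show ?thesis .
qed

lemma integrable_mult_squares:
  fixes U V :: "'a \<Rightarrow> real"
  assumes "U \<in> borel_measurable M" "V \<in> borel_measurable M"
    "integrable M (\<lambda>\<omega>. (U \<omega>)\<^sup>2)" "integrable M (\<lambda>\<omega>. (V \<omega>)\<^sup>2)"
  shows "integrable M (\<lambda>\<omega>. U \<omega> * V \<omega>)"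
proof (rule Bochner_Integration.integrable_bound[OF Bochner_Integration.integrable_add[OF assms(3,4)]])
  show "AE \<omega> in M. norm (U \<omega> * V \<omega>) \<le> norm ((U \<omega>)\<^sup>2 + (V \<omega>)\<^sup>2)"
  proof (rule AE_I2)
    fix \<omega>
    have "2 * (\<bar>U \<omega>\<bar> * \<bar>V \<omega>\<bar>) \<le> (U \<omega>)\<^sup>2 + (V \<omega>)\<^sup>2"
      using sum_squares_bound[of "\<bar>U \<omega>\<bar>" "\<bar>V \<omega>\<bar>"] by (simp add: mult.assoc)
    moreover have "0 \<le> \<bar>U \<omega>\<bar> * \<bar>V \<omega>\<bar>" by simp
    ultimately show "norm (U \<omega> * V \<omega>) \<le> norm ((U \<omega>)\<^sup>2 + (V \<omega>)\<^sup>2)"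
      unfolding real_norm_def abs_mult by linarith
  qed
qed (use assms(1,2) in measurable)

lemma comb_cross:
  assumes S: "finite S" "S \<subseteq> T" and jk: "j \<noteq> k"
  shows "(\<integral>\<omega>. comb j (c j) S \<omega> * comb k (c k) S \<omega> \<partial>M) = 0"
proof -
  have "indep_vars (\<lambda>_. borel) (\<lambda>j. comb j (c j) S) {j, k}"
    by (rule indep_vars_subset[OF indep_comb[OF S]]) simp
  then have "(\<integral>\<omega>. (\<Prod>i\<in>{j, k}. comb i (c i) S \<omega>) \<partial>M) = (\<Prod>i\<in>{j, k}. \<integral>\<omega>. comb i (c i) S \<omega> \<partial>M)"
    using gaussian_rv_centered(2)[OF gaussian_comb[OF S] comb_centered[OF S]]
    by (intro indep_vars_lebesgue_integral) auto
  then show ?thesis using jk comb_centered[OF S] by simp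
qed

text \<open>Independence of the components makes every element of the span Gaussian.\<close>

lemma gspan_facts:
  assumes "V \<in> gspan"
  shows gspan_meas: "V \<in> borel_measurable M" and gspan_square: "integrable M (\<lambda>\<omega>. (V \<omega>)\<^sup>2)"
    and gspan_char: "(\<integral>\<omega>. iexp (V \<omega>) \<partial>M) = of_real (exp (- ip V V / 2))"
proof -
  obtain c S where V: "V = (\<lambda>\<omega>. \<Sum>j\<in>UNIV. comb j (c j) S \<omega>)" and S: "finite S" "S \<subseteq> T"
    using assms unfolding gspan_def by blast
  note G = gaussian_rv_centered[OF gaussian_comb[OF S] comb_centered[OF S]]
  note [measurable] = G(1)
  show "V \<in> borel_measurable M" unfolding V by measurable
  have sq: "(V \<omega>)\<^sup>2 = (\<Sum>j\<in>UNIV. \<Sum>k\<in>UNIV. comb j (c j) S \<omega> * comb k (c k) S \<omega>)" for \<omega>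
    unfolding V by (simp add: power2_eq_square sum_product)
  have i: "integrable M (\<lambda>\<omega>. comb j (c j) S \<omega> * comb k (c k) S \<omega>)" for j k
    by (rule integrable_mult_squares) (use G(1,3) in auto)
  show "integrable M (\<lambda>\<omega>. (V \<omega>)\<^sup>2)" unfolding sq using i by auto
  have "ip V V = (\<integral>\<omega>. (\<Sum>j\<in>UNIV. \<Sum>k\<in>UNIV. comb j (c j) S \<omega> * comb k (c k) S \<omega>) \<partial>M)"
    unfolding ip_def sq[symmetric] by (simp add: power2_eq_square)
  also have "\<dots> = (\<Sum>j\<in>UNIV. \<Sum>k\<in>UNIV. \<integral>\<omega>. comb j (c j) S \<omega> * comb k (c k) S \<omega> \<partial>M)"
    using i by (simp add: Bochner_Integration.integral_sum)
  also have "\<dots> = (\<Sum>j\<in>UNIV. \<Sum>k\<in>UNIV. if k = j then \<integral>\<omega>. (comb j (c j) S \<omega>)\<^sup>2 \<partial>M else 0)"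
    using comb_cross[OF S, of _ _ c] by (intro sum.cong refl) (auto simp: power2_eq_square)
  also have "\<dots> = (\<Sum>j\<in>UNIV. \<integral>\<omega>. (comb j (c j) S \<omega>)\<^sup>2 \<partial>M)" by simp
  finally have ipV: "ip V V = (\<Sum>j\<in>UNIV. \<integral>\<omega>. (comb j (c j) S \<omega>)\<^sup>2 \<partial>M)" .
  have "(\<integral>\<omega>. iexp (V \<omega>) \<partial>M) = (\<integral>\<omega>. (\<Prod>j\<in>UNIV. iexp (comb j (c j) S \<omega>)) \<partial>M)"
    unfolding V by (simp add: exp_sum[symmetric] sum_distrib_left)
  also have "\<dots> = (\<Prod>j\<in>UNIV. \<integral>\<omega>. iexp (comb j (c j) S \<omega>) \<partial>M)"
  proof (rule indep_vars_lebesgue_integral)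
    show "indep_vars (\<lambda>_. borel) (\<lambda>j \<omega>. iexp (comb j (c j) S \<omega>)) UNIV"
      by (rule indep_vars_compose2[OF indep_comb[OF S, of c], of "\<lambda>_ x. iexp x"]) measurable
    show "integrable M (\<lambda>\<omega>. iexp (comb j (c j) S \<omega>))" for j
      by (rule integrable_iexp_real) measurable
  qed simp
  also have "\<dots> = (\<Prod>j\<in>UNIV. of_real (exp (- (\<integral>\<omega>. (comb j (c j) S \<omega>)\<^sup>2 \<partial>M) / 2)))"
    by (simp only: G(4))
  also have "\<dots> = of_real (exp (\<Sum>j\<in>UNIV. - (\<integral>\<omega>. (comb j (c j) S \<omega>)\<^sup>2 \<partial>M) / 2))"
    by (simp add: exp_sum)
  also have "(\<Sum>j\<in>UNIV. - (\<integral>\<omega>. (comb j (c j) S \<omega>)\<^sup>2 \<partial>M) / 2) = - ip V V / 2"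
    by (simp add: ipV sum_divide_distrib sum_negf)
  finally show "(\<integral>\<omega>. iexp (V \<omega>) \<partial>M) = of_real (exp (- ip V V / 2))" .
qed

lemma gspan_add:
  assumes "U \<in> gspan" "V \<in> gspan"
  shows "(\<lambda>\<omega>. U \<omega> + V \<omega>) \<in> gspan"
proof -
  obtain c S where U: "U = (\<lambda>\<omega>. \<Sum>j\<in>UNIV. comb j (c j) S \<omega>)" "finite S" "S \<subseteq> T"
    using assms unfolding gspan_def by blast
  obtain c' S' where V: "V = (\<lambda>\<omega>. \<Sum>j\<in>UNIV. comb j (c' j) S' \<omega>)" "finite S'" "S' \<subseteq> T"
    using assms unfolding gspan_def by blast
  let ?e = "\<lambda>j z. (if z \<in> S then c j z else 0) + (if z \<in> S' then c' j z else 0)"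
  have extend: "comb j d A \<omega> = (\<Sum>z\<in>S \<union> S'. (if z \<in> A then d z else 0) * W z \<omega> $ j)" if "A \<subseteq> S \<union> S'" for j d A \<omega>
    unfolding comb_def using that U(2) V(2)
    by (intro sum.mono_neutral_cong_left) auto
  have "(\<lambda>\<omega>. U \<omega> + V \<omega>) = (\<lambda>\<omega>. \<Sum>j\<in>UNIV. comb j (?e j) (S \<union> S') \<omega>)"
    unfolding U(1) V(1) by (rule ext)
      (simp add: extend[of S] extend[of S'] comb_def[of _ _ "S \<union> S'"] sum.distrib[symmetric] distrib_right)
  then show ?thesis unfolding gspan_def using U V
    by (intro CollectI exI[of _ ?e] exI[of _ "S \<union> S'"]) auto
qed

lemma gspan_scale:
  assumes "U \<in> gspan"
  shows "(\<lambda>\<omega>. a * U \<omega>) \<in> gspan"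
proof -
  obtain c S where U: "U = (\<lambda>\<omega>. \<Sum>j\<in>UNIV. comb j (c j) S \<omega>)" "finite S" "S \<subseteq> T"
    using assms unfolding gspan_def by blast
  have "(\<lambda>\<omega>. a * U \<omega>) = (\<lambda>\<omega>. \<Sum>j\<in>UNIV. comb j (\<lambda>z. a * c j z) S \<omega>)"
    unfolding U(1) by (simp add: comb_def sum_distrib_left mult.assoc)
  then show ?thesis unfolding gspan_def using U
    by (intro CollectI exI[of _ "\<lambda>j z. a * c j z"] exI[of _ S]) auto
qed

lemma gspan_diff: "U \<in> gspan \<Longrightarrow> V \<in> gspan \<Longrightarrow> (\<lambda>\<omega>. U \<omega> - V \<omega>) \<in> gspan"
  using gspan_add[of U "\<lambda>\<omega>. - 1 * V \<omega>"] gspan_scale[of V "- 1"] by simp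

lemma gspan_zero: "(\<lambda>_. 0) \<in> gspan"
  unfolding gspan_def by (intro CollectI exI[of _ "\<lambda>_ _. 0"] exI[of _ "{}"]) (auto simp: comb_def)

lemma gspan_sum: "finite I \<Longrightarrow> (\<And>V. V \<in> I \<Longrightarrow> h V \<in> gspan) \<Longrightarrow> (\<lambda>\<omega>. \<Sum>V\<in>I. h V \<omega>) \<in> gspan"
  by (induction I rule: finite_induct) (auto intro: gspan_zero gspan_add)

lemma W_gspan: "z \<in> T \<Longrightarrow> (\<lambda>\<omega>. W z \<omega> $ j) \<in> gspan"
proof -
  assume z: "z \<in> T"
  have "(\<lambda>\<omega>. W z \<omega> $ j) = (\<lambda>\<omega>. \<Sum>k\<in>UNIV. comb k (\<lambda>_. if k = j then 1 else 0) {z} \<omega>)"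
    by (simp add: comb_def if_distrib[of "\<lambda>a. a * _"] cong: if_cong)
  then show ?thesis unfolding gspan_def using z
    by (intro CollectI exI[of _ "\<lambda>k _. if k = j then 1 else 0"] exI[of _ "{z}"]) auto
qed

lemma gspan_ip_integrable: "U \<in> gspan \<Longrightarrow> V \<in> gspan \<Longrightarrow> integrable M (\<lambda>\<omega>. U \<omega> * V \<omega>)"
  by (rule integrable_mult_squares) (auto intro: gspan_meas gspan_square)

lemma ip_diff_left: "U \<in> gspan \<Longrightarrow> U' \<in> gspan \<Longrightarrow> V \<in> gspan \<Longrightarrow> ip (\<lambda>\<omega>. U \<omega> - U' \<omega>) V = ip U V - ip U' V"
  unfolding ip_def left_diff_distrib using gspan_ip_integrable by simp

lemma ip_diff_right: "U \<in> gspan \<Longrightarrow> V \<in> gspan \<Longrightarrow> V' \<in> gspan \<Longrightarrow> ip U (\<lambda>\<omega>. V \<omega> - V' \<omega>) = ip U V - ip U V'"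
  unfolding ip_def right_diff_distrib using gspan_ip_integrable by simp

lemma ip_scale_left: "ip (\<lambda>\<omega>. a * U \<omega>) V = a * ip U V"
  unfolding ip_def by (simp add: mult.assoc)

lemma ip_scale_right: "ip U (\<lambda>\<omega>. a * V \<omega>) = a * ip U V"
  unfolding ip_def by (simp add: mult.left_commute)

lemma ip_W:
  assumes "z \<in> T" "z' \<in> T"
  shows "ip (\<lambda>\<omega>. W z \<omega> $ j) (\<lambda>\<omega>. W z' \<omega> $ k) = (if j = k then min (fst z) (fst z') * min (snd z) (snd z') else 0)"
proof (cases "j = k")
  case True
  obtain s t s' t' where z: "z = (s, t)" "z' = (s', t')" by (meson surj_pair)
  have "covariance M (\<lambda>\<omega>. W (s, t) \<omega> $ j) (\<lambda>\<omega>. W (s', t') \<omega> $ j) = min s s' * min t t'"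
    using comp[of j] assms unfolding brownian_sheet1_on_def z by blast
  then show ?thesis using True assms W_centered by (simp add: covariance_def ip_def z)
next
  case False
  let ?S = "{z, z'}" and ?c = "\<lambda>i y. if i = j then (if y = z then 1 else 0) else (if y = z' then 1 else 0)"
  have "(\<integral>\<omega>. comb j (?c j) ?S \<omega> * comb k (?c k) ?S \<omega> \<partial>M) = 0"
    by (rule comb_cross) (use assms False in auto)
  moreover have "comb j (?c j) ?S \<omega> = W z \<omega> $ j" "comb k (?c k) ?S \<omega> = W z' \<omega> $ k" for \<omega>
    using False by (auto simp: comb_def if_distrib[of "\<lambda>a. a * _"] cong: if_cong)
  ultimately show ?thesis using False by (simp add: ip_def)
qed

lemma gspan_distr:
  assumes V: "V \<in> gspan" and v: "ip V V = v" "v > 0"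
  shows "distr M borel V = normal_law v"
proof (rule Levy_uniqueness)
  note [measurable] = gspan_meas[OF V]
  interpret N: prob_space "normal_law v" by (rule prob_space_normal_law[OF v(2)])
  show "real_distribution (distr M borel V)" by (rule real_distribution_distr) measurable
  show "real_distribution (normal_law v)"
    unfolding real_distribution_def real_distribution_axioms_def using N.prob_space_axioms by simp
  show "char (distr M borel V) = char (normal_law v)"
  proof
    fix t
    have "char (distr M borel V) t = (\<integral>\<omega>. iexp (t * V \<omega>) \<partial>M)"
      unfolding char_def by (subst integral_distr) auto
    also have "\<dots> = of_real (exp (- ip (\<lambda>\<omega>. t * V \<omega>) (\<lambda>\<omega>. t * V \<omega>) / 2))"
      by (rule gspan_char[OF gspan_scale[OF V]])
    also have "\<dots> = char (normal_law v) t"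
      unfolding ip_scale_left ip_scale_right v(1) char_normal_law[OF v(2)] by (simp add: power2_eq_square mult_ac)
    finally show "char (distr M borel V) t = char (normal_law v) t" .
  qed
qed

lemma gspan_indep:
  assumes Z: "Z \<in> gspan" and \<V>: "\<V> \<subseteq> gspan" and orth: "\<And>V. V \<in> \<V> \<Longrightarrow> ip Z V = 0"
    and v: "ip Z Z = v" "v > 0"
    and A: "A \<in> sets (gen_alg M \<V>)" and B: "B \<in> sets borel"
  shows "prob (A \<inter> Z -` B) = prob A * measure (normal_law v) B"
proof -
  have "prob (A \<inter> Z -` B) = prob A * prob (Z -` B \<inter> space M)"
  proof (rule gen_alg_indep[OF _ gspan_meas[OF Z] _ A B])
    show "\<V> \<subseteq> borel_measurable M" using \<V> gspan_meas by blast
    fix I \<theta> and c :: "('a \<Rightarrow> real) \<Rightarrow> real" assume I: "finite I" "I \<subseteq> \<V>"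
    let ?S = "\<lambda>\<omega>. \<Sum>V\<in>I. c V * V \<omega>" and ?Z = "\<lambda>\<omega>. \<theta> * Z \<omega>"
    have S: "?S \<in> gspan" using I \<V> by (intro gspan_sum gspan_scale) auto
    have Z': "?Z \<in> gspan" by (rule gspan_scale[OF Z])
    have "ip Z ?S = (\<Sum>V\<in>I. c V * ip Z V)"
    proof -
      have "ip Z ?S = (\<integral>\<omega>. (\<Sum>V\<in>I. c V * (Z \<omega> * V \<omega>)) \<partial>M)"
        unfolding ip_def by (simp add: sum_distrib_left mult.left_commute)
      also have "\<dots> = (\<Sum>V\<in>I. c V * ip Z V)"
        unfolding ip_def using I \<V> gspan_ip_integrable[OF Z]
        by (subst Bochner_Integration.integral_sum) auto
      finally show ?thesis .
    qed
    then have ZS: "ip Z ?S = 0" using orth I by (auto intro!: sum.neutral)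
    have "ip (\<lambda>\<omega>. ?Z \<omega> + ?S \<omega>) (\<lambda>\<omega>. ?Z \<omega> + ?S \<omega>) = ip ?Z ?Z + 2 * ip ?Z ?S + ip ?S ?S"
    proof -
      have square: "(a + b) * (a + b) = a * a + 2 * (a * b) + b * b" for a b :: real by (simp add: algebra_simps)
      have "ip (\<lambda>\<omega>. ?Z \<omega> + ?S \<omega>) (\<lambda>\<omega>. ?Z \<omega> + ?S \<omega>) = (\<integral>\<omega>. ?Z \<omega> * ?Z \<omega> + 2 * (?Z \<omega> * ?S \<omega>) + ?S \<omega> * ?S \<omega> \<partial>M)"
        unfolding ip_def by (intro Bochner_Integration.integral_cong refl square)
      also have "\<dots> = ip ?Z ?Z + 2 * ip ?Z ?S + ip ?S ?S"
        unfolding ip_def using gspan_ip_integrable[OF Z' Z'] gspan_ip_integrable[OF Z' S] gspan_ip_integrable[OF S S]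
        by simp
      finally show ?thesis .
    qed
    also have "ip ?Z ?S = 0" unfolding ip_scale_left ZS by simp
    finally have e: "ip (\<lambda>\<omega>. ?Z \<omega> + ?S \<omega>) (\<lambda>\<omega>. ?Z \<omega> + ?S \<omega>) = ip ?Z ?Z + ip ?S ?S" by simp
    have "- (ip ?Z ?Z + ip ?S ?S) / 2 = - ip ?Z ?Z / 2 + - ip ?S ?S / 2" by simp
    then show "(\<integral>\<omega>. iexp (\<theta> * Z \<omega> + (\<Sum>V\<in>I. c V * V \<omega>)) \<partial>M) = (\<integral>\<omega>. iexp (\<theta> * Z \<omega>) \<partial>M) * (\<integral>\<omega>. iexp (\<Sum>V\<in>I. c V * V \<omega>) \<partial>M)"
      unfolding gspan_char[OF gspan_add[OF Z' S]] gspan_char[OF Z'] gspan_char[OF S] e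
      by (simp only: exp_add of_real_mult)
  qed
  also have "prob (Z -` B \<inter> space M) = measure (distr M borel Z) B"
    using B gspan_meas[OF Z] by (simp add: measure_distr)
  finally show ?thesis by (simp only: gspan_distr[OF Z v])
qed

end

text \<open>Up to time \<open>m\<close>, a continuous family is jointly measurable with respect to any sigma-algebra that
makes the variables up to time \<open>m\<close> measurable, because dyadic times approximate from below.\<close>

lemma continuous_process_measurable:
  fixes P :: "real \<Rightarrow> 'a \<Rightarrow> real"
  assumes m: "0 \<le> m" "m \<le> 1" and P: "\<And>t. t \<in> {0..m} \<Longrightarrow> P t \<in> borel_measurable N"
    and cont: "\<And>\<omega>. \<omega> \<in> space N \<Longrightarrow> continuous_on {0..m} (\<lambda>t. P t \<omega>)"
  shows "(\<lambda>(t, \<omega>). P (max 0 (min m t)) \<omega>) \<in> borel_measurable (borel \<Otimes>\<^sub>M N)"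
proof -
  let ?c = "\<lambda>t. max 0 (min m t)"
  define Q where "Q k i \<omega> = (if of_int i / 2 ^ k \<in> {0..m} then P (of_int i / 2 ^ k) \<omega> else 0)" for k :: nat and i :: int and \<omega>
  let ?g = "\<lambda>k x. \<lfloor>2 ^ k * ?c (fst x)\<rfloor>"
  have Qm: "(\<lambda>x. Q k i (snd x)) \<in> borel_measurable (borel \<Otimes>\<^sub>M N)" for k i
    unfolding Q_def using P by (cases "of_int i / 2 ^ k \<in> {0..m}") auto
  have gm: "?g k \<in> measurable (borel \<Otimes>\<^sub>M N) (count_space UNIV)" for k
    by measurable
  have "(\<lambda>x. Q k (?g k x) (snd x)) \<in> borel_measurable (borel \<Otimes>\<^sub>M N)" for k
    by (rule measurable_compose_countable[OF Qm gm])
  then have "(\<lambda>x. P (?c (fst x)) (snd x)) \<in> borel_measurable (borel \<Otimes>\<^sub>M N)"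
  proof (rule borel_measurable_LIMSEQ_real[rotated])
    fix x :: "real \<times> 'a" assume x: "x \<in> space (borel \<Otimes>\<^sub>M N)"
    then have \<omega>: "snd x \<in> space N" by (auto simp: space_pair_measure)
    let ?s = "?c (fst x)"
    have s: "?s \<in> {0..m}" "0 \<le> ?s" "?s \<le> 1" using m by auto
    have mem: "of_int (?g k x) / 2 ^ k \<in> {0..m}" for k
    proof -
      have "of_int (?g k x) \<le> 2 ^ k * ?s" by (rule of_int_floor_le)
      then have "of_int (?g k x) / 2 ^ k \<le> ?s" by (simp add: pos_divide_le_eq mult.commute)
      moreover have "0 \<le> ?g k x" using s by simp
      then have "0 \<le> real_of_int (?g k x) / 2 ^ k" by simp
      ultimately show ?thesis using s by auto
    qed
    have "(\<lambda>k. P (of_int (?g k x) / 2 ^ k) (snd x)) \<longlonglongrightarrow> P ?s (snd x)"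
    proof (rule continuous_on_tendsto_compose[OF cont[OF \<omega>] dyadic_approx[OF s(2,3)] s(1)])
      show "\<forall>\<^sub>F k in sequentially. of_int (?g k x) / 2 ^ k \<in> {0..m}" using mem by (rule always_eventually[OF allI])
    qed
    then show "(\<lambda>k. Q k (?g k x) (snd x)) \<longlonglongrightarrow> P ?s (snd x)"
      unfolding Q_def using mem by simp
  qed
  then show ?thesis by (simp add: case_prod_beta)
qed

section \<open>Changing one coordinate of the path at a time\<close>

lemma borel_measurable_vec_lambda:
  fixes h :: "'d::finite \<Rightarrow> 'b \<Rightarrow> real"
  assumes "\<And>j. h j \<in> borel_measurable N"
  shows "(\<lambda>x. (\<chi> j. h j x) :: real ^ 'd) \<in> borel_measurable N"
proof (subst borel_measurable_euclidean_space, intro ballI)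
  fix e :: "real ^ 'd" assume "e \<in> Basis"
  then obtain j where "e = axis j 1" by (auto simp: Basis_vec_def)
  then show "(\<lambda>x. (\<chi> j. h j x) \<bullet> e) \<in> borel_measurable N"
    using assms[of j] by (simp add: inner_axis)
qed

context sheet
begin

text \<open>Times are clamped to \<open>[0, 1]\<close>, where the sheet is known to be defined and continuous.\<close>

definition unit_clamp :: "real \<Rightarrow> real" where "unit_clamp t = max 0 (min 1 t)"

lemma unit_clamp_mem [simp]: "unit_clamp t \<in> {0..1}" "0 \<le> unit_clamp t" "unit_clamp t \<le> 1"
  by (auto simp: unit_clamp_def)

lemma unit_clamp_id: "t \<in> {0..1} \<Longrightarrow> unit_clamp t = t"
  by (auto simp: unit_clamp_def)

lemma in_T: "s \<in> {0..1} \<Longrightarrow> t \<in> {0..1} \<Longrightarrow> (s, t) \<in> T"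
  using unit_T by auto

lemma W_cont:
  assumes "\<omega> \<in> space M" "s \<in> {0..1}" "m \<le> 1"
  shows "continuous_on {0..m} (\<lambda>t. W (s, t) \<omega> $ j)"
proof -
  have "continuous_on T (\<lambda>z. W z \<omega> $ j)"
    using comp[of j] assms(1) by (auto simp: brownian_sheet1_on_def)
  moreover have "continuous_on {0..m} (\<lambda>t. (s, t))" by (intro continuous_intros)
  moreover have "(\<lambda>t. (s, t)) ` {0..m} \<subseteq> T" using assms by (auto intro: in_T)
  ultimately show ?thesis using continuous_on_compose2[of T "\<lambda>z. W z \<omega> $ j" "{0..m}" "\<lambda>t. (s, t)"] by simp
qed

text \<open>Generators of the sigma-algebra at time \<open>m\<close> for component \<open>i\<close>: all other components, the difference
\<open>W (s', _) $ i - W (s, _) $ i\<close> at all times, and \<open>W (s, _) $ i\<close> up to time \<open>m\<close>. Increments of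
\<open>W (s, _) $ i\<close> after \<open>m\<close> are orthogonal to all of them.\<close>

definition gens :: "'d \<Rightarrow> real \<Rightarrow> real \<Rightarrow> real \<Rightarrow> ('a \<Rightarrow> real) set" where
  "gens i s s' m = {(\<lambda>\<omega>. W z \<omega> $ j) |j z. j \<noteq> i \<and> z \<in> {0..1} \<times> {0..1}}
     \<union> {(\<lambda>\<omega>. W (s', r) \<omega> $ i - W (s, r) \<omega> $ i) |r. r \<in> {0..1}}
     \<union> {(\<lambda>\<omega>. W (s, r) \<omega> $ i) |r. r \<in> {0..m}}"

lemma gens_other: "j \<noteq> i \<Longrightarrow> z \<in> {0..1} \<times> {0..1} \<Longrightarrow> (\<lambda>\<omega>. W z \<omega> $ j) \<in> gens i s s' m"
  unfolding gens_def by blast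

lemma gens_diff: "r \<in> {0..1} \<Longrightarrow> (\<lambda>\<omega>. W (s', r) \<omega> $ i - W (s, r) \<omega> $ i) \<in> gens i s s' m"
  unfolding gens_def by blast

lemma gens_past: "r \<in> {0..m} \<Longrightarrow> (\<lambda>\<omega>. W (s, r) \<omega> $ i) \<in> gens i s s' m"
  unfolding gens_def by blast

lemma gens_mono: "m \<le> m' \<Longrightarrow> gens i s s' m \<subseteq> gens i s s' m'"
  unfolding gens_def by (intro Un_mono subset_refl) (auto intro: order_trans)

lemma gens_gspan:
  assumes "s \<in> {0..1}" "s' \<in> {0..1}" "m \<le> 1"
  shows "gens i s s' m \<subseteq> gspan"
  unfolding gens_def using assms unit_T
  by (auto intro!: gspan_diff W_gspan in_T)

lemma gens_measurable: "s \<in> {0..1} \<Longrightarrow> s' \<in> {0..1} \<Longrightarrow> m \<le> 1 \<Longrightarrow> gens i s s' m \<subseteq> borel_measurable M"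
  using gens_gspan gspan_meas by blast

lemma incr_indep:
  assumes s: "0 < s" "s \<le> s'" "s' \<le> 1" and ut: "0 \<le> u" "u < t" "t \<le> 1"
    and A: "A \<in> sets (gen_alg M (gens i s s' u))" and B: "B \<in> sets borel"
  shows "prob (A \<inter> (\<lambda>\<omega>. W (s, t) \<omega> $ i / sqrt s - W (s, u) \<omega> $ i / sqrt s) -` B) = prob A * measure (normal_law (t - u)) B"
proof -
  define D where "D \<omega> = W (s, t) \<omega> $ i - W (s, u) \<omega> $ i" for \<omega>
  have mem: "(s, t) \<in> T" "(s, u) \<in> T" "\<And>r. r \<in> {0..1} \<Longrightarrow> (s, r) \<in> T" "\<And>r. r \<in> {0..1} \<Longrightarrow> (s', r) \<in> T"
    using s ut by (auto intro!: in_T)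
  note Wg = W_gspan[OF mem(1)] W_gspan[OF mem(2)]
  have Dg: "D \<in> gspan" unfolding D_def[abs_def] by (rule gspan_diff[OF Wg])
  have ipD: "ip D V = ip (\<lambda>\<omega>. W (s, t) \<omega> $ i) V - ip (\<lambda>\<omega>. W (s, u) \<omega> $ i) V" if "V \<in> gspan" for V
    unfolding D_def[abs_def] by (rule ip_diff_left[OF Wg that])
  have DD: "ip D D = s * (t - u)"
    unfolding ipD[OF Dg] unfolding D_def[abs_def] ip_diff_right[OF Wg(1) Wg] ip_diff_right[OF Wg(2) Wg]
    using ut by (simp add: ip_W mem algebra_simps)
  have DV: "ip D V = 0" if V: "V \<in> gens i s s' u" for V
  proof -
    from V consider (1) j z where "V = (\<lambda>\<omega>. W z \<omega> $ j)" "j \<noteq> i" "z \<in> {0..1} \<times> {0..1}"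
      | (2) r where "V = (\<lambda>\<omega>. W (s', r) \<omega> $ i - W (s, r) \<omega> $ i)" "r \<in> {0..1}"
      | (3) r where "V = (\<lambda>\<omega>. W (s, r) \<omega> $ i)" "r \<in> {0..u}"
      unfolding gens_def by blast
    then show ?thesis
    proof cases
      case 1
      then have "z \<in> T" using unit_T by auto
      with 1 show ?thesis by (simp add: ipD W_gspan ip_W mem)
    next
      case 2
      note Wr = W_gspan[OF mem(4)[OF 2(2)], of i] W_gspan[OF mem(3)[OF 2(2)], of i]
      have "ip D V = (ip (\<lambda>\<omega>. W (s, t) \<omega> $ i) (\<lambda>\<omega>. W (s', r) \<omega> $ i) - ip (\<lambda>\<omega>. W (s, t) \<omega> $ i) (\<lambda>\<omega>. W (s, r) \<omega> $ i))
         - (ip (\<lambda>\<omega>. W (s, u) \<omega> $ i) (\<lambda>\<omega>. W (s', r) \<omega> $ i) - ip (\<lambda>\<omega>. W (s, u) \<omega> $ i) (\<lambda>\<omega>. W (s, r) \<omega> $ i))"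
        unfolding 2(1) ipD[OF gspan_diff[OF Wr]] ip_diff_right[OF Wg(1) Wr] ip_diff_right[OF Wg(2) Wr] ..
      also have "\<dots> = 0" using s 2(2) by (simp add: ip_W mem)
      finally show ?thesis .
    next
      case 3
      then have "r \<in> {0..1}" using ut by auto
      with 3 show ?thesis using ut by (simp add: ipD W_gspan ip_W mem)
    qed
  qed
  define Z where "Z \<omega> = 1 / sqrt s * D \<omega>" for \<omega>
  have Z: "Z \<in> gspan" unfolding Z_def[abs_def] by (rule gspan_scale[OF Dg])
  have "ip Z Z = t - u"
    unfolding Z_def[abs_def] ip_scale_left ip_scale_right DD using s by simp
  moreover have "ip Z V = 0" if "V \<in> gens i s s' u" for V
    unfolding Z_def[abs_def] ip_scale_left DV[OF that] by simp
  moreover have "(\<lambda>\<omega>. W (s, t) \<omega> $ i / sqrt s - W (s, u) \<omega> $ i / sqrt s) = Z"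
    by (simp add: Z_def[abs_def] D_def diff_divide_distrib)
  ultimately show ?thesis
    using gspan_indep[OF Z gens_gspan _ _ _ A B, of "t - u"] s ut by simp
qed

text \<open>Truncation to \<open>[- R, R]\<close>.\<close>

definition clip :: "real \<Rightarrow> real \<Rightarrow> real" where
  "clip R a = max (- R) (min R a)"

text \<open>The path that follows \<open>x' + W (s', _)\<close> in the coordinates \<open>J\<close> and \<open>x + W (s, _)\<close> in the others.\<close>

definition mixed :: "'d set \<Rightarrow> real \<Rightarrow> real \<Rightarrow> real ^ 'd \<Rightarrow> real ^ 'd \<Rightarrow> real \<Rightarrow> 'a \<Rightarrow> real ^ 'd" where
  "mixed J s s' x x' t \<omega> = (\<chi> j. if j \<in> J then x' $ j + W (s', unit_clamp t) \<omega> $ j else x $ j + W (s, unit_clamp t) \<omega> $ j)"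

lemma clip_id: "\<bar>a\<bar> \<le> R \<Longrightarrow> clip R a = a"
  by (auto simp: clip_def)

lemma W_joint_measurable:
  assumes "s \<in> {0..1}"
  shows "(\<lambda>x. W (s, unit_clamp (fst x)) (snd x) $ j) \<in> borel_measurable (borel \<Otimes>\<^sub>M M)"
proof -
  have "(\<lambda>(t, \<omega>). W (s, max 0 (min 1 t)) \<omega> $ j) \<in> borel_measurable (borel \<Otimes>\<^sub>M M)"
    by (rule continuous_process_measurable) (use assms in \<open>auto intro!: W_meas in_T W_cont\<close>)
  then show ?thesis by (simp add: case_prod_beta unit_clamp_def)
qed

lemma mixed_measurable:
  assumes "s \<in> {0..1}" "s' \<in> {0..1}"
  shows "(\<lambda>z. mixed J s s' x x' (fst z) (snd z)) \<in> borel_measurable (borel \<Otimes>\<^sub>M M)"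
  unfolding mixed_def using W_joint_measurable[OF assms(1)] W_joint_measurable[OF assms(2)]
  by (intro borel_measurable_vec_lambda) auto

text \<open>One component of the sheet at level \<open>s\<close>, rescaled to a standard Brownian motion, with everything else that
enters the mixed paths as environment.\<close>

lemma sheet_brownian_shift:
  fixes bb :: "real \<times> (real ^ 'd) \<Rightarrow> real"
  assumes bb[measurable]: "bb \<in> borel_measurable borel" "\<And>p. \<bar>bb p\<bar> \<le> 1"
    and s: "0 < s" "s \<le> s'" "s' \<le> 1" and R: "R > 0"
  shows "brownian_shift M (\<lambda>m. gen_alg M (gens i s s' (min m 1))) (\<lambda>t \<omega>. W (s, unit_clamp t) \<omega> $ i / sqrt s)
    (\<lambda>t y \<omega>. bb (t, \<chi> j. if j = i then x $ i + sqrt s * y else mixed J s s' x x' t \<omega> $ j))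
    (\<lambda>t \<omega>. clip R ((x' $ i - x $ i + W (s', unit_clamp t) \<omega> $ i - W (s, unit_clamp t) \<omega> $ i) / sqrt s)) R"
proof
  let ?F = "\<lambda>m. gen_alg M (gens i s s' (min m 1))"
  have s01: "s \<in> {0..1}" "s' \<in> {0..1}" using s by auto
  show "space (?F m) = space M" for m by simp
  show "sets (?F m) \<subseteq> sets M" for m
    by (rule sets_gen_alg_subset[OF gens_measurable[OF s01]]) simp
  show "sets (?F m) \<subseteq> sets (?F m')" if "m \<le> m'" for m m'
    by (rule sets_gen_alg_mono, rule gens_mono) (use that in simp)
  show "(\<lambda>\<omega>. W (s, unit_clamp (min t 1)) \<omega> $ i / sqrt s) = (\<lambda>\<omega>. W (s, unit_clamp t) \<omega> $ i / sqrt s)" for t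
    by (simp add: unit_clamp_def min.commute)
  show "(\<lambda>(t, \<omega>). W (s, unit_clamp (min t m)) \<omega> $ i / sqrt s) \<in> borel_measurable (borel \<Otimes>\<^sub>M ?F m)" if m: "0 \<le> m" "m \<le> 1" for m
  proof -
    have "(\<lambda>(t, \<omega>). W (s, max 0 (min m t)) \<omega> $ i) \<in> borel_measurable (borel \<Otimes>\<^sub>M ?F m)"
    proof (rule continuous_process_measurable[OF m])
      show "(\<lambda>\<omega>. W (s, t) \<omega> $ i) \<in> borel_measurable (?F m)" if "t \<in> {0..m}" for t
        by (rule measurable_gen_alg) (rule gens_past, use that m in auto)
      show "continuous_on {0..m} (\<lambda>t. W (s, t) \<omega> $ i)" if "\<omega> \<in> space (?F m)" for \<omega>
        by (rule W_cont) (use that s01 m in auto)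
    qed
    moreover have "unit_clamp (min t m) = max 0 (min m t)" for t using m by (auto simp: unit_clamp_def)
    ultimately show ?thesis by (simp add: case_prod_beta)
  qed
  show "prob (A \<inter> (\<lambda>\<omega>. W (s, unit_clamp t) \<omega> $ i / sqrt s - W (s, unit_clamp u) \<omega> $ i / sqrt s) -` B) = prob A * measure (normal_law (t - u)) B"
    if ut: "0 \<le> u" "u < t" "t \<le> 1" and A: "A \<in> sets (?F u)" and B: "B \<in> sets borel" for u t A B
  proof -
    have "unit_clamp t = t" "unit_clamp u = u" "min u 1 = u" using ut by (auto simp: unit_clamp_def)
    then show ?thesis using incr_indep[OF s ut _ B, of A i] A by simp
  qed
  have WF: "(\<lambda>z. W (r, unit_clamp (fst z)) (snd z) $ j) \<in> borel_measurable (borel \<Otimes>\<^sub>M ?F 0)" if "r \<in> {0..1}" "j \<noteq> i" for r j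
  proof -
    have "(\<lambda>(t, \<omega>). W (r, max 0 (min 1 t)) \<omega> $ j) \<in> borel_measurable (borel \<Otimes>\<^sub>M ?F 0)"
    proof (rule continuous_process_measurable)
      show "(\<lambda>\<omega>. W (r, t) \<omega> $ j) \<in> borel_measurable (?F 0)" if "t \<in> {0..1}" for t
        by (rule measurable_gen_alg) (rule gens_other, use that \<open>r \<in> _\<close> \<open>j \<noteq> i\<close> in auto)
      show "continuous_on {0..1} (\<lambda>t. W (r, t) \<omega> $ j)" if "\<omega> \<in> space (?F 0)" for \<omega>
        by (rule W_cont) (use that \<open>r \<in> _\<close> in auto)
    qed auto
    then show ?thesis by (simp add: case_prod_beta unit_clamp_def)
  qed
  have DF: "(\<lambda>z. W (s', unit_clamp (fst z)) (snd z) $ i - W (s, unit_clamp (fst z)) (snd z) $ i) \<in> borel_measurable (borel \<Otimes>\<^sub>M ?F 0)"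
  proof -
    have "(\<lambda>(t, \<omega>). W (s', max 0 (min 1 t)) \<omega> $ i - W (s, max 0 (min 1 t)) \<omega> $ i) \<in> borel_measurable (borel \<Otimes>\<^sub>M ?F 0)"
    proof (rule continuous_process_measurable)
      show "(\<lambda>\<omega>. W (s', t) \<omega> $ i - W (s, t) \<omega> $ i) \<in> borel_measurable (?F 0)" if "t \<in> {0..1}" for t
        by (rule measurable_gen_alg) (rule gens_diff[OF that])
      show "continuous_on {0..1} (\<lambda>t. W (s', t) \<omega> $ i - W (s, t) \<omega> $ i)" if "\<omega> \<in> space (?F 0)" for \<omega>
        by (intro continuous_on_diff W_cont) (use that s01 in auto)
    qed auto
    then show ?thesis by (simp add: case_prod_beta unit_clamp_def)
  qed
  show "(\<lambda>(t, y, \<omega>). bb (t, \<chi> j. if j = i then x $ i + sqrt s * y else mixed J s s' x x' t \<omega> $ j)) \<in> borel_measurable (borel \<Otimes>\<^sub>M borel \<Otimes>\<^sub>M ?F 0)"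
  proof -
    have pr: "(\<lambda>z. (fst z, snd (snd z))) \<in> measurable (borel \<Otimes>\<^sub>M borel \<Otimes>\<^sub>M ?F 0) (borel \<Otimes>\<^sub>M ?F 0)"
      by measurable
    have "(\<lambda>z. (\<chi> j. if j = i then x $ i + sqrt s * fst (snd z) else mixed J s s' x x' (fst z) (snd (snd z)) $ j) :: real ^ 'd)
        \<in> borel_measurable (borel \<Otimes>\<^sub>M borel \<Otimes>\<^sub>M ?F 0)"
    proof (rule borel_measurable_vec_lambda)
      fix j
      show "(\<lambda>z. if j = i then x $ i + sqrt s * fst (snd z) else mixed J s s' x x' (fst z) (snd (snd z)) $ j)
        \<in> borel_measurable (borel \<Otimes>\<^sub>M borel \<Otimes>\<^sub>M ?F 0)"
      proof (cases "j = i")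
        case False
        note [measurable] = measurable_compose[OF pr WF[OF s01(1) False], simplified] measurable_compose[OF pr WF[OF s01(2) False], simplified]
        show ?thesis using False by (cases "j \<in> J") (simp_all add: mixed_def)
      qed simp
    qed
    then have "(\<lambda>z. (fst z, (\<chi> j. if j = i then x $ i + sqrt s * fst (snd z) else mixed J s s' x x' (fst z) (snd (snd z)) $ j) :: real ^ 'd))
        \<in> borel_measurable (borel \<Otimes>\<^sub>M borel \<Otimes>\<^sub>M ?F 0)"
      by (intro borel_measurable_Pair) measurable
    from measurable_compose[OF this bb(1)] show ?thesis by (simp add: case_prod_beta)
  qed
  show "\<bar>bb p\<bar> \<le> 1" for p by (rule bb(2))
  show "(\<lambda>(t, \<omega>). clip R ((x' $ i - x $ i + W (s', unit_clamp t) \<omega> $ i - W (s, unit_clamp t) \<omega> $ i) / sqrt s)) \<in> borel_measurable (borel \<Otimes>\<^sub>M ?F 0)"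
  proof -
    have "(\<lambda>z. clip R ((x' $ i - x $ i + (W (s', unit_clamp (fst z)) (snd z) $ i - W (s, unit_clamp (fst z)) (snd z) $ i)) / sqrt s)) \<in> borel_measurable (borel \<Otimes>\<^sub>M ?F 0)"
      unfolding clip_def using DF by measurable
    then show ?thesis by (simp add: case_prod_beta algebra_simps)
  qed
  show "\<bar>clip R a\<bar> \<le> R" for a using R by (auto simp: clip_def)
  show "R > 0" by fact
qed

text \<open>The integral of \<open>bb\<close> over \<open>[a, a']\<close> along a mixed path.\<close>

definition mixed_integral :: "(real \<times> (real ^ 'd) \<Rightarrow> real) \<Rightarrow> real \<Rightarrow> real \<Rightarrow> 'd set \<Rightarrow> real \<Rightarrow> real \<Rightarrow> real ^ 'd \<Rightarrow> real ^ 'd \<Rightarrow> 'a \<Rightarrow> real" where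
  "mixed_integral bb a a' J s s' x x' \<omega> = (\<integral>t. bb (t, mixed J s s' x x' t \<omega>) \<partial>lborel_on a a')"

lemma mixed_integral_integrand:
  fixes bb :: "real \<times> (real ^ 'd) \<Rightarrow> real"
  assumes [measurable]: "bb \<in> borel_measurable borel" and s: "s \<in> {0..1}" "s' \<in> {0..1}"
  shows "(\<lambda>z. bb (fst z, mixed J s s' x x' (fst z) (snd z))) \<in> borel_measurable (borel \<Otimes>\<^sub>M M)"
proof -
  have "(\<lambda>z. (fst z, mixed J s s' x x' (fst z) (snd z))) \<in> borel_measurable (borel \<Otimes>\<^sub>M M)"
    by (intro borel_measurable_Pair mixed_measurable[OF s]) measurable
  from measurable_compose[OF this assms(1)] show ?thesis .
qed

lemma mixed_integral_measurable:
  fixes bb :: "real \<times> (real ^ 'd) \<Rightarrow> real"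
  assumes "bb \<in> borel_measurable borel" "s \<in> {0..1}" "s' \<in> {0..1}"
  shows "mixed_integral bb a a' J s s' x x' \<in> borel_measurable M"
proof -
  interpret finite_measure "lborel_on a a'" by (rule finite_measure_lborel_on)
  have "(\<lambda>x. (snd x, fst x)) \<in> measurable (M \<Otimes>\<^sub>M borel) (borel \<Otimes>\<^sub>M M)" by measurable
  from measurable_compose[OF this mixed_integral_integrand[OF assms]]
  have [measurable]: "(\<lambda>(\<omega>, t). bb (t, mixed J s s' x x' t \<omega>)) \<in> borel_measurable (M \<Otimes>\<^sub>M borel)"
    by (simp add: case_prod_beta)
  show ?thesis unfolding mixed_integral_def[abs_def] by measurable
qed

lemma mixed_integral_integrable:
  fixes bb :: "real \<times> (real ^ 'd) \<Rightarrow> real"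
  assumes "bb \<in> borel_measurable borel" "\<And>p. \<bar>bb p\<bar> \<le> 1" "s \<in> {0..1}" "s' \<in> {0..1}" "\<omega> \<in> space M"
  shows "integrable (lborel_on a a') (\<lambda>t. bb (t, mixed J s s' x x' t \<omega>))"
proof -
  interpret L: finite_measure "lborel_on a a'" by (rule finite_measure_lborel_on)
  have "(\<lambda>t. (t, \<omega>)) \<in> measurable borel (borel \<Otimes>\<^sub>M M)" using assms(5) by measurable
  from measurable_compose[OF this mixed_integral_integrand[OF assms(1,3,4)]]
  have "(\<lambda>t. bb (t, mixed J s s' x x' t \<omega>)) \<in> borel_measurable borel" by simp
  then have "(\<lambda>t. bb (t, mixed J s s' x x' t \<omega>)) \<in> borel_measurable (lborel_on a a')" by simp
  then show ?thesis
    by (rule L.integrable_const_bound[of _ 1, rotated]) (simp add: assms(2))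
qed

lemma increment_sup_tail:
  assumes s: "0 < s" "s \<le> s'" "s' \<le> 1" and \<eta>: "\<eta> \<ge> 512"
  shows "\<exists>E\<in>sets M. prob E \<le> 4 * exp (- \<eta> / 32) \<and>
    (\<forall>\<omega>\<in>space M - E. \<forall>t\<in>{0..1}. \<bar>W (s', t) \<omega> $ i - W (s, t) \<omega> $ i\<bar> \<le> sqrt \<eta> * sqrt (s' - s))"
proof (cases "s = s'")
  case True
  then show ?thesis by (intro bexI[of _ "{}"]) auto
next
  case False
  then have ss: "s' - s > 0" using s by simp
  have mem: "(s, t) \<in> T" "(s', t) \<in> T" if "t \<in> {0..1}" for t
    using s that by (auto intro!: in_T)
  let ?B = "\<lambda>t \<omega>. W (s', t) \<omega> $ i - W (s, t) \<omega> $ i"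
  have Bg: "?B t \<in> gspan" if "t \<in> {0..1}" for t by (intro gspan_diff W_gspan mem that)
  have BB: "ip (?B t) (?B u) = (s' - s) * min t u" if t: "t \<in> {0..1}" and u: "u \<in> {0..1}" for t u
  proof -
    note Wt = W_gspan[OF mem(2)[OF t], of i] W_gspan[OF mem(1)[OF t], of i]
    note Wu = W_gspan[OF mem(2)[OF u], of i] W_gspan[OF mem(1)[OF u], of i]
    show ?thesis
      unfolding ip_diff_left[OF Wt Bg[OF u]] ip_diff_right[OF Wt(1) Wu] ip_diff_right[OF Wt(2) Wu]
      using s by (simp add: ip_W mem[OF t] mem[OF u] algebra_simps)
  qed
  show ?thesis
  proof (rule brownian_sup_tail[OF _ _ _ _ _ \<eta>])
    show "?B t \<in> borel_measurable M" if "t \<in> {0..1}" for t by (rule gspan_meas[OF Bg[OF that]])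
    show "continuous_on {0..1} (\<lambda>t. ?B t \<omega>)" if "\<omega> \<in> space M" for \<omega>
      by (intro continuous_on_diff W_cont that) (use s in auto)
    show "AE \<omega> in M. ?B 0 \<omega> = 0"
    proof -
      have "ip (?B 0) (?B 0) = 0" using BB[of 0 0] by simp
      then have "(\<integral>\<omega>. (?B 0 \<omega>)\<^sup>2 \<partial>M) = 0" unfolding ip_def by (simp add: power2_eq_square)
      then have "AE \<omega> in M. (?B 0 \<omega>)\<^sup>2 = 0"
        using gspan_square[OF Bg[of 0]] by (subst (asm) integral_nonneg_eq_0_iff_AE) auto
      then show ?thesis by simp
    qed
    show "distr M borel (\<lambda>\<omega>. ?B t \<omega> - ?B u \<omega>) = normal_law ((sqrt (s' - s))\<^sup>2 * (t - u))"
      if ut: "0 \<le> u" "u < t" "t \<le> 1" for u t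
    proof (rule gspan_distr)
      have m: "t \<in> {0..1}" "u \<in> {0..1}" using ut by auto
      note Bt = Bg[OF m(1)] and Bu = Bg[OF m(2)]
      show D: "(\<lambda>\<omega>. ?B t \<omega> - ?B u \<omega>) \<in> gspan" by (rule gspan_diff[OF Bt Bu])
      show "ip (\<lambda>\<omega>. ?B t \<omega> - ?B u \<omega>) (\<lambda>\<omega>. ?B t \<omega> - ?B u \<omega>) = (sqrt (s' - s))\<^sup>2 * (t - u)"
        unfolding ip_diff_left[OF Bt Bu D] ip_diff_right[OF Bt Bt Bu] ip_diff_right[OF Bu Bt Bu]
        using ut m ss by (simp add: BB algebra_simps)
      show "(sqrt (s' - s))\<^sup>2 * (t - u) > 0" using ut ss by simp
    qed
    show "sqrt (s' - s) > 0" using ss by simp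
  qed
qed

text \<open>Adding one coordinate \<open>i\<close> to \<open>J\<close>. The constants are not optimized.\<close>

lemma coordinate_tail:
  fixes bb :: "real \<times> (real ^ 'd) \<Rightarrow> real"
  assumes bb: "bb \<in> borel_measurable borel" "\<And>p. \<bar>bb p\<bar> \<le> 1"
    and s: "0 < s" "s \<le> s'" "s' \<le> 1" and ne: "(s, x) \<noteq> (s', x')"
    and a: "0 \<le> a" "a < a'" "a' \<le> 1" and \<eta>: "\<eta> > 0" and i: "i \<notin> J"
  shows "prob {\<omega>\<in>space M. \<eta> * sqrt (a' - a) * (infnorm (x' - x) + sqrt (s' - s)) \<le>
      sqrt s * \<bar>mixed_integral bb a a' (insert i J) s s' x x' \<omega> - mixed_integral bb a a' J s s' x x' \<omega>\<bar>} \<le> 5 * exp (- (1/40000) * \<eta>)"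
proof (cases "\<eta> < 40000")
  case True
  \<comment> \<open>For such \<open>\<eta>\<close> the right-hand side is at least \<open>1\<close>.\<close>
  have "exp (-1) \<le> exp (- (1/40000) * \<eta>)" using True by simp
  moreover have "1 \<le> 5 * exp (-1 :: real)" using exp_one_le_3 by (simp add: exp_minus field_simps)
  ultimately have "1 \<le> 5 * exp (- (1/40000) * \<eta>)" by linarith
  then show ?thesis by (rule order_trans[OF prob_le_1])
next
  case False
  then have \<eta>40: "\<eta> \<ge> 40000" by simp
  define \<delta> where "\<delta> = infnorm (x' - x)"
  define \<tau> where "\<tau> = sqrt (s' - s)"
  have nn: "0 \<le> \<delta>" "0 \<le> \<tau>" using s by (auto simp: \<delta>_def \<tau>_def infnorm_pos_le)
  have pos: "\<delta> + \<tau> > 0"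
  proof (rule ccontr)
    assume "\<not> \<delta> + \<tau> > 0"
    then have "\<delta> = 0" "\<tau> = 0" using nn by auto
    then have "x' = x" "s' = s" using s by (auto simp: \<delta>_def \<tau>_def infnorm_eq_0)
    then show False using ne by simp
  qed
  \<comment> \<open>Outside the exceptional event \<open>E\<close> below, the true shift is bounded by \<open>R\<close>.\<close>
  define R where "R = sqrt \<eta> * (\<delta> + \<tau>) / sqrt s"
  have R: "R > 0" using pos s \<eta> by (simp add: R_def)
  have s01: "s \<in> {0..1}" "s' \<in> {0..1}" using s by auto
  interpret S: brownian_shift M "\<lambda>m. gen_alg M (gens i s s' (min m 1))" "\<lambda>t \<omega>. W (s, unit_clamp t) \<omega> $ i / sqrt s"
    "\<lambda>t y \<omega>. bb (t, \<chi> j. if j = i then x $ i + sqrt s * y else mixed J s s' x x' t \<omega> $ j)"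
    "\<lambda>t \<omega>. clip R ((x' $ i - x $ i + W (s', unit_clamp t) \<omega> $ i - W (s, unit_clamp t) \<omega> $ i) / sqrt s)" R
    by (rule sheet_brownian_shift[OF bb s R])
  obtain E where E: "E \<in> sets M" "prob E \<le> 4 * exp (- \<eta> / 32)"
    "\<And>\<omega> t. \<omega> \<in> space M - E \<Longrightarrow> t \<in> {0..1} \<Longrightarrow> \<bar>W (s', t) \<omega> $ i - W (s, t) \<omega> $ i\<bar> \<le> sqrt \<eta> * \<tau>"
    using increment_sup_tail[OF s, of \<eta> i] \<eta>40 unfolding \<tau>_def by auto
  have eq: "S.shift_effect a a' \<omega> = mixed_integral bb a a' (insert i J) s s' x x' \<omega> - mixed_integral bb a a' J s s' x x' \<omega>" if \<omega>: "\<omega> \<in> space M - E" for \<omega>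
  proof -
    have unclip: "clip R ((x' $ i - x $ i + W (s', unit_clamp t) \<omega> $ i - W (s, unit_clamp t) \<omega> $ i) / sqrt s) = (x' $ i - x $ i + W (s', unit_clamp t) \<omega> $ i - W (s, unit_clamp t) \<omega> $ i) / sqrt s" for t
    proof -
      have "\<bar>x' $ i - x $ i\<bar> \<le> \<delta>"
        using component_le_infnorm_cart[of "x' - x" i] by (simp add: \<delta>_def)
      also have "\<delta> \<le> sqrt \<eta> * \<delta>" using nn \<eta>40 mult_right_mono[of 1 "sqrt \<eta>" \<delta>] by simp
      finally have 1: "\<bar>x' $ i - x $ i\<bar> \<le> sqrt \<eta> * \<delta>" .
      have 2: "\<bar>W (s', unit_clamp t) \<omega> $ i - W (s, unit_clamp t) \<omega> $ i\<bar> \<le> sqrt \<eta> * \<tau>" by (rule E(3)[OF \<omega>]) simp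
      have tri: "\<bar>p + q - q'\<bar> \<le> c + d" if "\<bar>p\<bar> \<le> c" "\<bar>q - q'\<bar> \<le> d" for p q q' c d :: real using that by linarith
      have "\<bar>x' $ i - x $ i + W (s', unit_clamp t) \<omega> $ i - W (s, unit_clamp t) \<omega> $ i\<bar> \<le> sqrt \<eta> * (\<delta> + \<tau>)"
        unfolding distrib_left by (rule tri[OF 1 2])
      then have "\<bar>(x' $ i - x $ i + W (s', unit_clamp t) \<omega> $ i - W (s, unit_clamp t) \<omega> $ i) / sqrt s\<bar> \<le> R"
        unfolding R_def abs_divide using s by (simp add: divide_right_mono)
      then show ?thesis by (rule clip_id)
    qed
    have 1: "(\<chi> j. if j = i then x $ i + sqrt s * (W (s, unit_clamp t) \<omega> $ i / sqrt s + (x' $ i - x $ i + W (s', unit_clamp t) \<omega> $ i - W (s, unit_clamp t) \<omega> $ i) / sqrt s)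
        else mixed J s s' x x' t \<omega> $ j) = mixed (insert i J) s s' x x' t \<omega>" for t
      using s by (auto simp: vec_eq_iff mixed_def add_divide_distrib[symmetric])
    have 2: "(\<chi> j. if j = i then x $ i + sqrt s * (W (s, unit_clamp t) \<omega> $ i / sqrt s) else mixed J s s' x x' t \<omega> $ j) = mixed J s s' x x' t \<omega>" for t
      using s i by (auto simp: vec_eq_iff mixed_def)
    have "S.shift_effect a a' \<omega> = (\<integral>t. bb (t, mixed (insert i J) s s' x x' t \<omega>) - bb (t, mixed J s s' x x' t \<omega>) \<partial>lborel_on a a')"
      unfolding S.shift_effect_def S.path_diff_def S.shift_diff_def unclip 1 2 ..
    also have "\<dots> = mixed_integral bb a a' (insert i J) s s' x x' \<omega> - mixed_integral bb a a' J s s' x x' \<omega>"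
      unfolding mixed_integral_def using \<omega> by (intro Bochner_Integration.integral_diff mixed_integral_integrable[OF bb s01]) auto
    finally show ?thesis .
  qed
  define y where "y = \<eta> * sqrt (a' - a) * (\<delta> + \<tau>) / sqrt s"
  \<comment> \<open>The pieces cost a factor \<open>2 ^ N \<le> exp (\<eta> / 40000)\<close>, whose exponent is half of the gain
    \<open>sqrt (\<eta> * N) / 66 \<ge> \<eta> / 20000\<close>.\<close>
  define N where "N = nat \<lfloor>\<eta> / 40000\<rfloor>"
  have N: "N \<ge> 1" "real N \<le> \<eta> / 40000" "\<eta> / 80000 \<le> real N"
  proof -
    have e1: "1 \<le> \<eta> / 40000" using \<eta>40 by simp
    then have f: "1 \<le> \<lfloor>\<eta> / 40000\<rfloor>" by (simp add: le_floor_iff)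
    then have r: "real N = of_int \<lfloor>\<eta> / 40000\<rfloor>" unfolding N_def by (subst of_nat_nat) auto
    show "N \<ge> 1" using f unfolding N_def by (simp add: le_nat_iff)
    show "real N \<le> \<eta> / 40000" unfolding r by (rule of_int_floor_le)
    have "1 \<le> real N" using \<open>N \<ge> 1\<close> by simp
    moreover have "\<eta> / 40000 < real N + 1" unfolding r by linarith
    ultimately show "\<eta> / 80000 \<le> real N" by simp
  qed
  have "{\<omega>\<in>space M. \<eta> * sqrt (a' - a) * (\<delta> + \<tau>) \<le> sqrt s * \<bar>mixed_integral bb a a' (insert i J) s s' x x' \<omega> - mixed_integral bb a a' J s s' x x' \<omega>\<bar>}
      \<subseteq> E \<union> {\<omega>\<in>space M. y \<le> \<bar>S.shift_effect a a' \<omega>\<bar>}"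
  proof
    fix \<omega> assume *: "\<omega> \<in> {\<omega>\<in>space M. \<eta> * sqrt (a' - a) * (\<delta> + \<tau>) \<le> sqrt s * \<bar>mixed_integral bb a a' (insert i J) s s' x x' \<omega> - mixed_integral bb a a' J s s' x x' \<omega>\<bar>}"
    show "\<omega> \<in> E \<union> {\<omega>\<in>space M. y \<le> \<bar>S.shift_effect a a' \<omega>\<bar>}"
    proof (cases "\<omega> \<in> E")
      case False
      with * have "\<omega> \<in> space M - E" by simp
      from eq[OF this] * s show ?thesis unfolding y_def by (simp add: pos_divide_le_eq mult.commute)
    qed simp
  qed
  then have "prob {\<omega>\<in>space M. \<eta> * sqrt (a' - a) * (\<delta> + \<tau>) \<le> sqrt s * \<bar>mixed_integral bb a a' (insert i J) s s' x x' \<omega> - mixed_integral bb a a' J s s' x x' \<omega>\<bar>}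
      \<le> prob (E \<union> {\<omega>\<in>space M. y \<le> \<bar>S.shift_effect a a' \<omega>\<bar>})"
    by (rule finite_measure_mono) (use E(1) in measurable)
  also have "\<dots> \<le> prob E + prob {\<omega>\<in>space M. y \<le> \<bar>S.shift_effect a a' \<omega>\<bar>}"
    by (rule measure_Un_le) (use E(1) in measurable)
  also have "\<dots> \<le> 4 * exp (- (1/40000) * \<eta>) + exp (- (1/40000) * \<eta>)"
  proof (rule add_mono)
    have "exp (- \<eta> / 32) \<le> exp (- (1/40000) * \<eta>)" using \<eta> by simp
    then show "prob E \<le> 4 * exp (- (1/40000) * \<eta>)" using E(2) by linarith
    have "prob {\<omega>\<in>space M. y \<le> \<bar>S.shift_effect a a' \<omega>\<bar>} \<le> 2 ^ N * exp (- (y * sqrt (real N) / (66 * R * sqrt (a' - a))))"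
      by (rule S.shift_effect_tail[OF a N(1)])
    also have "y * sqrt (real N) / (66 * R * sqrt (a' - a)) = sqrt \<eta> * sqrt (real N) / 66"
    proof -
      have "\<eta> = sqrt \<eta> * sqrt \<eta>" using \<eta> by simp
      then have "y = sqrt \<eta> * (R * sqrt (a' - a))" unfolding y_def R_def by (simp add: mult_ac)
      then show ?thesis using R a by simp
    qed
    also have "2 ^ N * exp (- (sqrt \<eta> * sqrt (real N) / 66)) \<le> exp (\<eta> / 40000) * exp (- (\<eta> / 20000))"
    proof (rule mult_mono)
      have "(2::real) ^ N \<le> exp 1 ^ N" using exp_ge_add_one_self[of 1] by (intro power_mono) auto
      also have "\<dots> = exp (real N)" by (simp add: exp_of_nat_mult[symmetric])
      also have "\<dots> \<le> exp (\<eta> / 40000)" using N(2) by simp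
      finally show "(2::real) ^ N \<le> exp (\<eta> / 40000)" .
      have "\<eta> / 300 \<le> sqrt (\<eta> * real N)"
      proof (rule real_le_rsqrt)
        have "(\<eta> / 300)\<^sup>2 \<le> \<eta> * (\<eta> / 80000)" by (simp add: power2_eq_square)
        also have "\<dots> \<le> \<eta> * real N" using N(3) \<eta> by (intro mult_left_mono) auto
        finally show "(\<eta> / 300)\<^sup>2 \<le> \<eta> * real N" .
      qed
      then have "\<eta> / 300 \<le> sqrt \<eta> * sqrt (real N)" by (simp add: real_sqrt_mult)
      then have "\<eta> / 300 / 66 \<le> sqrt \<eta> * sqrt (real N) / 66" by (rule divide_right_mono) simp
      moreover have "\<eta> / 20000 \<le> \<eta> / 300 / 66" using \<eta> by simp
      ultimately show "exp (- (sqrt \<eta> * sqrt (real N) / 66)) \<le> exp (- (\<eta> / 20000))" by simp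
    qed auto
    also have "\<dots> = exp (- (1/40000) * \<eta>)" by (simp add: mult_exp_exp)
    finally show "prob {\<omega>\<in>space M. y \<le> \<bar>S.shift_effect a a' \<omega>\<bar>} \<le> exp (- (1/40000) * \<eta>)" .
  qed
  finally show ?thesis by (simp add: \<delta>_def \<tau>_def)
qed

text \<open>Each coordinate costs half of \<open>\<eta>\<close>, so the constants depend on the dimension.\<close>

lemma mixed_tail:
  fixes bb :: "real \<times> (real ^ 'd) \<Rightarrow> real"
  assumes bb: "bb \<in> borel_measurable borel" "\<And>p. \<bar>bb p\<bar> \<le> 1" and J: "finite (J :: 'd set)"
  shows "\<exists>\<alpha> C :: real. \<alpha> > 0 \<and> C > 0 \<and> (\<forall>s s' x x' a a' \<eta>. 0 < s \<longrightarrow> s \<le> s' \<longrightarrow> s' \<le> 1 \<longrightarrow> (s, x) \<noteq> (s', x') \<longrightarrow>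
     0 \<le> a \<longrightarrow> a < a' \<longrightarrow> a' \<le> 1 \<longrightarrow> \<eta> > 0 \<longrightarrow>
     prob {\<omega>\<in>space M. \<eta> * sqrt (a' - a) * (infnorm (x' - x) + sqrt (s' - s)) \<le>
      sqrt s * \<bar>mixed_integral bb a a' J s s' x x' \<omega> - mixed_integral bb a a' {} s s' x x' \<omega>\<bar>} \<le> C * exp (- \<alpha> * \<eta>))"
  using J
proof (induction J rule: finite_induct)
  case empty
  show ?case
  proof (intro exI[of _ 1] conjI allI impI)
    fix s s' a a' \<eta> :: real and x x' :: "real ^ 'd"
    assume s: "0 < s" "s \<le> s'" "s' \<le> 1" and ne: "(s, x) \<noteq> (s', x')" and a: "0 \<le> a" "a < a'" "a' \<le> 1" and \<eta>: "0 < \<eta>"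
    have "infnorm (x' - x) + sqrt (s' - s) > 0"
    proof (rule ccontr)
      assume "\<not> infnorm (x' - x) + sqrt (s' - s) > 0"
      moreover have "0 \<le> infnorm (x' - x)" "0 \<le> sqrt (s' - s)" using s by (auto simp: infnorm_pos_le)
      ultimately have "infnorm (x' - x) = 0" "sqrt (s' - s) = 0" by linarith+
      then show False using ne by (simp add: infnorm_eq_0)
    qed
    then have "\<not> \<eta> * sqrt (a' - a) * (infnorm (x' - x) + sqrt (s' - s)) \<le> 0"
      using \<eta> a by (simp add: not_le)
    then show "prob {\<omega>\<in>space M. \<eta> * sqrt (a' - a) * (infnorm (x' - x) + sqrt (s' - s)) \<le>
      sqrt s * \<bar>mixed_integral bb a a' {} s s' x x' \<omega> - mixed_integral bb a a' {} s s' x x' \<omega>\<bar>} \<le> 1 * exp (- 1 * \<eta>)" by simp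
  qed auto
next
  case (insert i J)
  then obtain \<alpha> C :: real where \<alpha>: "\<alpha> > 0" "C > 0" and
    IH: "\<And>s s' x x' a a' \<eta>. 0 < s \<Longrightarrow> s \<le> s' \<Longrightarrow> s' \<le> 1 \<Longrightarrow> (s, x) \<noteq> (s', x') \<Longrightarrow>
     0 \<le> a \<Longrightarrow> a < a' \<Longrightarrow> a' \<le> 1 \<Longrightarrow> \<eta> > 0 \<Longrightarrow>
     prob {\<omega>\<in>space M. \<eta> * sqrt (a' - a) * (infnorm (x' - x) + sqrt (s' - s)) \<le>
      sqrt s * \<bar>mixed_integral bb a a' J s s' x x' \<omega> - mixed_integral bb a a' {} s s' x x' \<omega>\<bar>} \<le> C * exp (- \<alpha> * \<eta>)"
    by blast
  define \<beta> where "\<beta> = min (\<alpha> / 2) (1/80000)"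
  show ?case
  proof (rule exI[of _ \<beta>], rule exI[of _ "C + 5"], intro conjI allI impI)
    show "\<beta> > 0" "C + 5 > 0" using \<alpha> by (auto simp: \<beta>_def)
    fix s s' a a' \<eta> :: real and x x' :: "real ^ 'd"
    assume s: "0 < s" "s \<le> s'" "s' \<le> 1" and ne: "(s, x) \<noteq> (s', x')" and a: "0 \<le> a" "a < a'" "a' \<le> 1" and \<eta>: "0 < \<eta>"
    have s01: "s \<in> {0..1}" "s' \<in> {0..1}" using s by auto
    note [measurable] = mixed_integral_measurable[OF bb(1) s01]
    define L where "L = sqrt (a' - a) * (infnorm (x' - x) + sqrt (s' - s))"
    let ?D = "\<lambda>J. mixed_integral bb a a' J s s' x x'"
    let ?P1 = "{\<omega>\<in>space M. (\<eta> / 2) * sqrt (a' - a) * (infnorm (x' - x) + sqrt (s' - s)) \<le> sqrt s * \<bar>?D (insert i J) \<omega> - ?D J \<omega>\<bar>}"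
    let ?P2 = "{\<omega>\<in>space M. (\<eta> / 2) * sqrt (a' - a) * (infnorm (x' - x) + sqrt (s' - s)) \<le> sqrt s * \<bar>?D J \<omega> - ?D {} \<omega>\<bar>}"
    have "{\<omega>\<in>space M. \<eta> * sqrt (a' - a) * (infnorm (x' - x) + sqrt (s' - s)) \<le> sqrt s * \<bar>?D (insert i J) \<omega> - ?D {} \<omega>\<bar>} \<subseteq> ?P1 \<union> ?P2"
    proof (rule subsetI, rule ccontr)
      fix \<omega> assume 1: "\<omega> \<in> {\<omega>\<in>space M. \<eta> * sqrt (a' - a) * (infnorm (x' - x) + sqrt (s' - s)) \<le> sqrt s * \<bar>?D (insert i J) \<omega> - ?D {} \<omega>\<bar>}"
        and 2: "\<omega> \<notin> ?P1 \<union> ?P2"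
      have "sqrt s * \<bar>?D (insert i J) \<omega> - ?D {} \<omega>\<bar> \<le> sqrt s * (\<bar>?D (insert i J) \<omega> - ?D J \<omega>\<bar> + \<bar>?D J \<omega> - ?D {} \<omega>\<bar>)"
        using s by (intro mult_left_mono) auto
      with 1 2 show False by (simp add: not_le distrib_left mult.assoc)
    qed
    then have "prob {\<omega>\<in>space M. \<eta> * sqrt (a' - a) * (infnorm (x' - x) + sqrt (s' - s)) \<le> sqrt s * \<bar>?D (insert i J) \<omega> - ?D {} \<omega>\<bar>} \<le> prob (?P1 \<union> ?P2)"
      by (rule finite_measure_mono) measurable
    also have "\<dots> \<le> prob ?P1 + prob ?P2" by (rule measure_Un_le) measurable
    also have "\<dots> \<le> 5 * exp (- (1/40000) * (\<eta> / 2)) + C * exp (- \<alpha> * (\<eta> / 2))"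
      using \<eta> by (intro add_mono coordinate_tail[OF bb s ne a] IH[OF s ne a] insert.hyps) auto
    also have "\<dots> \<le> 5 * exp (- \<beta> * \<eta>) + C * exp (- \<beta> * \<eta>)"
    proof (intro add_mono mult_left_mono)
      have "\<beta> * \<eta> \<le> (1/80000) * \<eta>" "\<beta> * \<eta> \<le> \<alpha> / 2 * \<eta>" using \<eta> by (intro mult_right_mono; simp add: \<beta>_def)+
      then show "exp (- (1/40000) * (\<eta> / 2)) \<le> exp (- \<beta> * \<eta>)" "exp (- \<alpha> * (\<eta> / 2)) \<le> exp (- \<beta> * \<eta>)" by simp_all
    qed (use \<alpha> in auto)
    also have "\<dots> = (C + 5) * exp (- \<beta> * \<eta>)" by (simp add: algebra_simps)
    finally show "prob {\<omega>\<in>space M. \<eta> * sqrt (a' - a) * (infnorm (x' - x) + sqrt (s' - s)) \<le> sqrt s * \<bar>?D (insert i J) \<omega> - ?D {} \<omega>\<bar>} \<le> (C + 5) * exp (- \<beta> * \<eta>)" .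
  qed
qed

end

theorem corollary3p3:
  fixes M :: "'a measure"
    and T :: "(real \<times> real) set"
    and W :: "real \<times> real \<Rightarrow> 'a \<Rightarrow> real ^ 'd"
    and b :: "real \<times> (real ^ 'd) \<Rightarrow> real"
  assumes "prob_space M"
    and "{0..1} \<times> {0..1} \<subseteq> T" and "T \<subseteq> {0..} \<times> {0..}"
    and "brownian_sheet_on M T W"
    and "b \<in> borel_measurable (restrict_space borel ({0..1} \<times> UNIV))"
    and "\<And>t x. t \<in> {0..1} \<Longrightarrow> \<bar>b (t, x)\<bar> \<le> 1"
  shows "\<exists>\<alpha> C :: real. \<alpha> > 0 \<and> C > 0 \<and>
    (\<forall>s s' x x' a a' \<eta>.
      s \<in> {0<..1} \<and> s' \<in> {0<..1} \<and> s \<le> s' \<and> (s, x) \<noteq> (s', x') \<and>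
      0 \<le> a \<and> a < a' \<and> a' \<le> 1 \<and> \<eta> > 0 \<longrightarrow>
      \<P>(\<omega> in M. sqrt s * \<bar>rho b W a a' s x s' x' \<omega>\<bar>
          \<ge> \<eta> * sqrt (a' - a) * (infnorm (x' - x) + sqrt (s' - s)))
        \<le> C * exp (- \<alpha> * \<eta>))"
proof -
  interpret sheet M T W
    unfolding sheet_def sheet_axioms_def using assms(1,2,4) by blast
  define bb where "bb p = (if p \<in> {0..1} \<times> UNIV then b p else 0)" for p
  have "({0..1} \<times> UNIV :: (real \<times> (real ^ 'd)) set) \<in> sets borel"
    by (intro borel_closed closed_Times) auto
  then have bbm: "bb \<in> borel_measurable borel"
    unfolding bb_def[abs_def] using assms(5) by (subst (asm) measurable_restrict_space_iff[where c = 0]) auto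
  have bb1: "\<bar>bb p\<bar> \<le> 1" for p
    using assms(6) by (cases p) (auto simp: bb_def)
  obtain \<alpha> C :: real where \<alpha>: "\<alpha> > 0" "C > 0" and
    tail: "\<And>s s' x x' a a' \<eta>. 0 < s \<Longrightarrow> s \<le> s' \<Longrightarrow> s' \<le> 1 \<Longrightarrow> (s, x) \<noteq> (s', x') \<Longrightarrow>
     0 \<le> a \<Longrightarrow> a < a' \<Longrightarrow> a' \<le> 1 \<Longrightarrow> \<eta> > 0 \<Longrightarrow>
     prob {\<omega>\<in>space M. \<eta> * sqrt (a' - a) * (infnorm (x' - x) + sqrt (s' - s)) \<le>
      sqrt s * \<bar>mixed_integral bb a a' UNIV s s' x x' \<omega> - mixed_integral bb a a' {} s s' x x' \<omega>\<bar>} \<le> C * exp (- \<alpha> * \<eta>)"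
    using mixed_tail[OF bbm bb1 finite_class.finite_UNIV] by blast
  show ?thesis
  proof (rule exI[of _ \<alpha>], rule exI[of _ C], intro conjI allI impI)
    show "\<alpha> > 0" "C > 0" by fact+
    fix s s' a a' \<eta> :: real and x x' :: "real ^ 'd"
    assume "s \<in> {0<..1} \<and> s' \<in> {0<..1} \<and> s \<le> s' \<and> (s, x) \<noteq> (s', x') \<and> 0 \<le> a \<and> a < a' \<and> a' \<le> 1 \<and> \<eta> > 0"
    then have s: "s \<in> {0<..1}" "s' \<in> {0<..1}" "s \<le> s'" and ne: "(s, x) \<noteq> (s', x')" and a: "0 \<le> a" "a < a'" "a' \<le> 1" and \<eta>: "0 < \<eta>"
      by blast+
    have s01: "s \<in> {0..1}" "s' \<in> {0..1}" using s by auto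
    have eq: "rho b W a a' s x s' x' \<omega> = mixed_integral bb a a' UNIV s s' x x' \<omega> - mixed_integral bb a a' {} s s' x x' \<omega>" if \<omega>: "\<omega> \<in> space M" for \<omega>
    proof -
      let ?h = "\<lambda>t. bb (t, mixed UNIV s s' x x' t \<omega>) - bb (t, mixed {} s s' x x' t \<omega>)"
      have i: "integrable (lborel_on a a') (\<lambda>t. bb (t, mixed J s s' x x' t \<omega>))" for J
        by (rule mixed_integral_integrable[OF bbm bb1 s01 \<omega>])
      have hm: "?h \<in> borel_measurable lborel"
        using borel_measurable_integrable[OF i[of UNIV]] borel_measurable_integrable[OF i[of "{}"]] by simp
      have "rho b W a a' s x s' x' \<omega> = (\<integral>t. indicator {a..a'} t * ?h t \<partial>lborel)"
        unfolding rho_def set_lebesgue_integral_def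
      proof (rule Bochner_Integration.integral_cong[OF refl])
        fix t
        show "indicator {a..a'} t *\<^sub>R (b (t, x' + W (s', t) \<omega>) - b (t, x + W (s, t) \<omega>)) = indicator {a..a'} t * ?h t"
        proof (cases "t \<in> {a..a'}")
          case True
          then have "t \<in> {0..1}" using a by auto
          moreover from this have "mixed UNIV s s' x x' t \<omega> = x' + W (s', t) \<omega>" "mixed {} s s' x x' t \<omega> = x + W (s, t) \<omega>"
            by (simp_all add: mixed_def vec_eq_iff unit_clamp_id)
          ultimately show ?thesis using True by (simp add: bb_def)
        qed simp
      qed
      also have "\<dots> = (\<integral>t. ?h t \<partial>lborel_on a a')"
        unfolding lborel_on_def using hm by (subst integral_density) auto
      also have "\<dots> = mixed_integral bb a a' UNIV s s' x x' \<omega> - mixed_integral bb a a' {} s s' x x' \<omega>"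
        unfolding mixed_integral_def by (rule Bochner_Integration.integral_diff[OF i i])
      finally show ?thesis .
    qed
    have "\<P>(\<omega> in M. sqrt s * \<bar>rho b W a a' s x s' x' \<omega>\<bar> \<ge> \<eta> * sqrt (a' - a) * (infnorm (x' - x) + sqrt (s' - s)))
       = prob {\<omega>\<in>space M. \<eta> * sqrt (a' - a) * (infnorm (x' - x) + sqrt (s' - s)) \<le>
      sqrt s * \<bar>mixed_integral bb a a' UNIV s s' x x' \<omega> - mixed_integral bb a a' {} s s' x x' \<omega>\<bar>}"
      by (rule arg_cong[where f = prob]) (auto simp: eq)
    also have "\<dots> \<le> C * exp (- \<alpha> * \<eta>)"
      using s ne a \<eta> by (intro tail) auto
    finally show "\<P>(\<omega> in M. sqrt s * \<bar>rho b W a a' s x s' x' \<omega>\<bar> \<ge> \<eta> * sqrt (a' - a) * (infnorm (x' - x) + sqrt (s' - s)))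
      \<le> C * exp (- \<alpha> * \<eta>)" .
  qed
qed

end
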